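(* Let $n,m\ge 0$ and let $f_0,\dots,f_m\colon\{-1,1\}^n\to\{-1,1\}$ and $g_0,\dots,g_n\colon\{-1,1\}^m\to\{-1,1\}$ be arbitrary Boolean functions such that for all $z=(z_{ij})\in\{-1,1\}^{[n]\times[m]}$, \[ f_0(g_1(z_{11},\dots,z_{1m}),\dots,g_n(z_{n1},\dots,z_{nm}))=g_0(f_1(z_{11},\dots,z_{n1}),\dots,f_m(z_{1m},\dots,z_{nm})). \] Let $J\subseteq[m]$ be the set of $j$ such that $f_j$ is non-constant, and let $G_0\colon\{-1,1\}^J\to\{-1,1\}$ be obtained from $g_0$ by fixing, for each $j\notin J$, the $j$-th input to the constant value of $f_j$. Similarly let $I\subseteq[n]$ be the set of $i$ such that $g_i$ is non-constant, and let $F_0\colon\{-1,1\}^I\to\{-1,1\}$ be obtained from $f_0$ by fixing, for each $i\notin I$, the $i$-th input to the constant value of $g_i$. Let $\tilde J=\mathrm{Dep}(G_0)$ and $\tilde G_0$ the restriction of $G_0$ to the coordinates in $\tilde J$; let $\tilde I=\mathrm{Dep}(F_0)$ and $\tilde F_0$ the restriction of $F_0$ to the coordinates in $\tilde I$. Then each $f_j$ ($j\in\tilde J$) depends only on coordinates in $\tilde I$, each $g_i$ ($i\in\tilde I$) depends only on coordinates in $\tilde J$, and, writing $n'=\tilde I$, $m'=\tilde J$ as index sets and regarding $f_j$ ($j\in\tilde J$) as functions on $\{-1,1\}^{\tilde I}$ and $g_i$ ($i\in\tilde I$) as functions on $\{-1,1\}^{\tilde J}$, the system $\tilde F_0,(f_j)_{j\in\tilde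 J},\tilde G_0,(g_i)_{i\in\tilde I}$ has the following form. There exist a set $Z_0\subseteq\tilde I\times\tilde J$ and a partition $Z_0=Z_1\sqcup\dots\sqcup Z_k$ whose parts are pairwise disjoint in rows and in columns, such that for every $(i,j)\in Z_\ell$ we have $\mathrm{Dep}(g_i)\subseteq\mathrm{cols}(Z_\ell)$ and $\mathrm{Dep}(f_j)\subseteq\mathrm{rows}(Z_\ell)$, and for all $i'\in\mathrm{rows}(Z_\ell)$, $j'\in\mathrm{cols}(Z_\ell)$ we have $j'\in\mathrm{Dep}(g_{i'})$ iff $i'\in\mathrm{Dep}(f_{j'})$; there exist a function $h\colon\{-1,1\}^k\to\{-1,1\}$ and, for each $\ell\in[k]$, functions $f_0^{(\ell)}$ of $x|_{\mathrm{rows}(Z_\ell)}$ and $g_0^{(\ell)}$ of $y|_{\mathrm{cols}(Z_\ell)}$, such that \[ \tilde F_0(x)=h(f_0^{(1)},\dots,f_0^{(k)}),\qquad \tilde G_0(y)=h(g_0^{(1)},\dots,g_0^{(k)}), \] and for every $\ell\in[k]$ one of the following holds: (1) $Z_\ell=\{(i,j)\}$ is a singleton and $f_j(x)=\mathrm{sgn}(f_j)x_i$, $g_i(y)=\mathrm{sgn}(g_i)y_j$, $f_0^{(\ell)}(x)=\mathrm{sgn}(f_j)x_i$, $g_0^{(\ell)}(y)=\mathrm{sgn}(g_i)y_j$; (2) for every $i\in\mathrm{rows}(Z_\ell)$ and $j\in\mathrm{cols}(Z_\ell)$, $f_j(x)=\phi_j(x|_{\mathrm{Dep}_{=1}(f_j)})\prod_{i'\in\mathrm{Dep}_{\ge2}(f_j)}x_{i'}$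 and $g_i(y)=\gamma_i(y|_{\mathrm{Dep}_{=1}(g_i)})\prod_{j'\in\mathrm{Dep}_{\ge2}(g_i)}y_{j'}$ for some functions $\phi_j,\gamma_i$ with values in $\{-1,1\}$, and $f_0^{(\ell)}(x)=\prod_{i\in\mathrm{rows}_{\ge2}(Z_\ell)}x_i\prod_{j\in\mathrm{cols}_{\ge2}(Z_\ell)}\phi_j(x^{\mathrm{sgn}})$, $g_0^{(\ell)}(y)=\prod_{j\in\mathrm{cols}_{\ge2}(Z_\ell)}y_j\prod_{i\in\mathrm{rows}_{\ge2}(Z_\ell)}\gamma_i(y^{\mathrm{sgn}})$, both $\{-1,1\}$-valued; (3) for every $i\in\mathrm{rows}_{=1}(Z_\ell)$ and $j\in\mathrm{cols}_{=1}(Z_\ell)$ the functions $f_j,g_i$ are dictators; there are $B_j,D_i\in\{-1,1\}$ for $j\in\mathrm{cols}_{\ge2}(Z_\ell)$, $i\in\mathrm{rows}_{\ge2}(Z_\ell)$ and $\kappa_{ij}\in\{-1,1\}$ for $(i,j)\in Z_\ell$ with $i\in\mathrm{rows}_{\ge2}(Z_\ell)$, $j\in\mathrm{cols}_{\ge2}(Z_\ell)$, and functions $\tilde\phi_j,\tilde\gamma_i$ with values in $\{0,1\}$, such that for $j\in\mathrm{cols}_{\ge2}(Z_\ell)$, $i\in\mathrm{rows}_{\ge2}(Z_\ell)$: $f_j(x)=\tilde\phi_j(x|_{\mathrm{Dep}_{=1}(f_j)})\cdot 2B_j\prod_{i'\in\mathrm{Dep}_{\ge2}(f_j)}\frac{\kappa_{i'j}x_{i'}+1}{2}-B_j$,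 $g_i(y)=\tilde\gamma_i(y|_{\mathrm{Dep}_{=1}(g_i)})\cdot 2D_i\prod_{j'\in\mathrm{Dep}_{\ge2}(g_i)}\frac{\kappa_{ij'}y_{j'}+1}{2}-D_i$, and $f_0^{(\ell)}(x)=2\prod_{i\in\mathrm{rows}_{\ge2}(Z_\ell)}\frac{D_ix_i+1}{2}\prod_{j\in\mathrm{cols}_{\ge2}(Z_\ell)}\tilde\phi_j(x^{\mathrm{sgn}})-1$, $g_0^{(\ell)}(y)=2\prod_{j\in\mathrm{cols}_{\ge2}(Z_\ell)}\frac{B_jy_j+1}{2}\prod_{i\in\mathrm{rows}_{\ge2}(Z_\ell)}\tilde\gamma_i(y^{\mathrm{sgn}})-1$, both $\{-1,1\}$-valued. Finally, the functions $f_j$ for $j\in J\setminus\tilde J$ and $g_i$ for $i\in I\setminus\tilde I$ are completely arbitrary (unconstrained by the identity).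
   Context: Boolean values are encoded as $\pm1$. Every $f\colon\{-1,1\}^n\to\mathbb R$ is identified with its unique multilinear (Fourier) expansion $f(x)=\sum_{S\subseteq[n]}\hat f(S)\prod_{i\in S}x_i$; $\deg f$ is the degree of this polynomial; $\mathrm{Dep}(f)$ is the set of coordinates on which $f$ depends. A dictator is a non-constant function depending on exactly one coordinate; a Boolean dictator has the form $s\,x_i$ with $s\in\{-1,1\}$, and $\mathrm{sgn}$ of it is $s$. For $W\subseteq I\times J$, $\mathrm{rows}(W)$ and $\mathrm{cols}(W)$ are its projections to the first and second coordinate. For a block $Z_\ell$: $\mathrm{rows}_{=1}(Z_\ell)=\{i\in\mathrm{rows}(Z_\ell):\deg g_i=1\}$, $\mathrm{rows}_{\ge2}(Z_\ell)=\{i\in\mathrm{rows}(Z_\ell):\deg g_i\ge2\}$, and $\mathrm{cols}_{=1},\mathrm{cols}_{\ge2}$ analogously with $\deg f_j$. For $i$: $\mathrm{Dep}_{=1}(g_i)=\{j\in\mathrm{Dep}(g_i):\deg f_j=1\}$, $\mathrm{Dep}_{\ge2}(g_i)=\{j\in\mathrm{Dep}(g_i):\deg f_j\ge2\}$; for $j$: $\mathrm{Dep}_{=1}(f_j)=\{i\in\mathrm{Dep}(f_j):\deg g_i=1\}$, $\mathrm{Dep}_{\ge2}(f_j)=\{i\in\mathrm{Dep}(f_j):\deg g_i\ge2\}$. $x^{\mathrm{sgn}}$ is obtained from $x$ by replacing $x_i$ by $\mathrm{sgn}(g_i)x_i$ whenever $\deg g_i=1$ (other entries unchanged), and $y^{\mathrm{sgn}}$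 from $y$ by replacing $y_j$ by $\mathrm{sgn}(f_j)y_j$ whenever $\deg f_j=1$; $\phi_j(x^{\mathrm{sgn}})$ means $\phi_j$ applied to the coordinates of $x^{\mathrm{sgn}}$ indexed by $\mathrm{Dep}_{=1}(f_j)$, and similarly for $\gamma_i,\tilde\phi_j,\tilde\gamma_i$. *)

theory Defs
  imports "HOL-Analysis.Analysis"
begin

section \<open>Functions on the Boolean cube\<close>

text \<open>
  The cube over an index set \<open>A\<close> consists of the extensional functions \<open>A \<rightarrow> {-1, 1}\<close>.
  A function on it is any \<open>u :: ('a \<Rightarrow> real) \<Rightarrow> real\<close>, of which only the values on
  \<open>cube A\<close> matter; \<open>u \<in> cube A \<rightarrow> {-1, 1}\<close> says that it is Boolean.
\<close>

definition cube :: "'a set \<Rightarrow> ('a \<Rightarrow> real) set" where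
  "cube A = A \<rightarrow>\<^sub>E {-1, 1}"

definition fourier_coeff :: "'a set \<Rightarrow> (('a \<Rightarrow> real) \<Rightarrow> real) \<Rightarrow> 'a set \<Rightarrow> real" where
  "fourier_coeff A u S = (\<Sum>x\<in>cube A. u x * (\<Prod>i\<in>S. x i)) / 2 ^ card A"

lemma finite_cube: "finite A \<Longrightarrow> finite (cube A)"
  unfolding cube_def by (intro finite_PiE) auto

lemma fourier_expansion:
  assumes fin: "finite A" and x: "x \<in> cube A"
  shows "u x = (\<Sum>S\<in>Pow A. fourier_coeff A u S * (\<Prod>i\<in>S. x i))"
proof -
  have kernel: "(\<Prod>i\<in>A. y i * x i + 1) = (if y = x then 2 ^ card A else 0)"
    if y: "y \<in> cube A" for y
  proof (cases "y = x")
    case True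
    have "(\<Prod>i\<in>A. y i * x i + 1) = (\<Prod>i\<in>A. 2)"
      using x True by (intro prod.cong) (auto simp: cube_def PiE_iff)
    with True show ?thesis by simp
  next
    case False
    then obtain i where i: "i \<in> A" "y i \<noteq> x i"
      using x y unfolding cube_def by (meson PiE_ext)
    have "y i \<in> {-1, 1}" "x i \<in> {-1, 1}"
      using x y i(1) by (auto simp: cube_def)
    with i(2) have "y i * x i + 1 = 0" by auto
    with i(1) fin have "(\<Prod>i\<in>A. y i * x i + 1) = 0" by (metis prod_zero)
    with False show ?thesis by simp
  qed
  have "(\<Sum>S\<in>Pow A. fourier_coeff A u S * (\<Prod>i\<in>S. x i))
      = (\<Sum>S\<in>Pow A. \<Sum>y\<in>cube A. u y * (\<Prod>i\<in>S. y i * x i)) / 2 ^ card A"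
    by (simp add: fourier_coeff_def sum_divide_distrib sum_distrib_right prod.distrib mult.assoc)
  also have "\<dots> = (\<Sum>y\<in>cube A. \<Sum>S\<in>Pow A. u y * (\<Prod>i\<in>S. y i * x i)) / 2 ^ card A"
    by (subst sum.swap) simp
  also have "\<dots> = (\<Sum>y\<in>cube A. u y * (\<Prod>i\<in>A. y i * x i + 1)) / 2 ^ card A"
    by (simp add: prod_add[OF fin] sum_distrib_left)
  also have "(\<Sum>y\<in>cube A. u y * (\<Prod>i\<in>A. y i * x i + 1))
      = (\<Sum>y\<in>cube A. if y = x then u x * 2 ^ card A else 0)"
    by (intro sum.cong) (auto simp: kernel)
  also have "\<dots> = u x * 2 ^ card A"
    using x finite_cube[OF fin] by simp
  finally show ?thesis by simp
qed

lemma fourier_coeff_unique: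
  assumes fin: "finite A" and T: "T \<subseteq> A"
    and u: "\<And>x. x \<in> cube A \<Longrightarrow> u x = (\<Sum>S\<in>Pow A. c S * (\<Prod>i\<in>S. x i))"
  shows "c T = fourier_coeff A u T"
proof -
  have orth: "(\<Sum>x\<in>cube A. (\<Prod>i\<in>S. x i) * (\<Prod>i\<in>T. x i)) = (if S = T then 2 ^ card A else 0)"
    if S: "S \<subseteq> A" for S
  proof -
    define e where "e i a = (if i \<in> S then a else 1) * (if i \<in> T then a else (1::real))" for i a
    have conv: "(\<Prod>i\<in>U. x i) = (\<Prod>i\<in>A. if i \<in> U then x i else (1::real))" if "U \<subseteq> A" for U x
      using that fin by (intro prod.mono_neutral_cong_left) auto
    have "(\<Sum>x\<in>cube A. (\<Prod>i\<in>S. x i) * (\<Prod>i\<in>T. x i)) = (\<Sum>x\<in>cube A. \<Prod>i\<in>A. e i (x i))"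
      by (simp only: conv[OF S] conv[OF T] e_def prod.distrib)
    also have "\<dots> = (\<Prod>i\<in>A. \<Sum>a\<in>{-1,1}. e i a)"
      unfolding cube_def by (rule prod_sum_PiE[symmetric]) (use fin in auto)
    also have "\<dots> = (if S = T then 2 ^ card A else 0)"
    proof (cases "S = T")
      case True
      have "(\<Prod>i\<in>A. \<Sum>a\<in>{-1,1}. e i a) = (\<Prod>i\<in>A. 2)"
        using True by (intro prod.cong) (auto simp: e_def)
      with True show ?thesis by simp
    next
      case False
      then obtain i where i: "i \<in> A" "(i \<in> S) \<noteq> (i \<in> T)" using S T by blast
      then have "(\<Sum>a\<in>{-1,1}. e i a) = 0" by (auto simp: e_def)
      with i(1) fin have "(\<Prod>i\<in>A. \<Sum>a\<in>{-1,1}. e i a) = 0" by (metis prod_zero)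
      with False show ?thesis by simp
    qed
    finally show ?thesis .
  qed
  have "(\<Sum>x\<in>cube A. u x * (\<Prod>i\<in>T. x i))
      = (\<Sum>x\<in>cube A. \<Sum>S\<in>Pow A. c S * ((\<Prod>i\<in>S. x i) * (\<Prod>i\<in>T. x i)))"
    by (intro sum.cong) (auto simp: u sum_distrib_right mult.assoc)
  also have "\<dots> = (\<Sum>S\<in>Pow A. c S * (\<Sum>x\<in>cube A. (\<Prod>i\<in>S. x i) * (\<Prod>i\<in>T. x i)))"
    by (subst sum.swap) (simp add: sum_distrib_left)
  also have "\<dots> = (\<Sum>S\<in>Pow A. if S = T then c T * 2 ^ card A else 0)"
    by (intro sum.cong) (auto simp: orth)
  also have "\<dots> = c T * 2 ^ card A"
    using T fin by simp
  finally show ?thesis by (simp add: fourier_coeff_def)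
qed

definition deg :: "'a set \<Rightarrow> (('a \<Rightarrow> real) \<Rightarrow> real) \<Rightarrow> nat" where
  "deg A u = Max (insert 0 (card ` {S. S \<subseteq> A \<and> fourier_coeff A u S \<noteq> 0}))"

definition Dep :: "'a set \<Rightarrow> (('a \<Rightarrow> real) \<Rightarrow> real) \<Rightarrow> 'a set" where
  "Dep A u = {i \<in> A. \<exists>x\<in>cube A. u (x(i := - x i)) \<noteq> u x}"

definition dictator :: "'a set \<Rightarrow> (('a \<Rightarrow> real) \<Rightarrow> real) \<Rightarrow> bool" where
  "dictator A u \<longleftrightarrow> \<not> u constant_on cube A \<and> (\<exists>i. Dep A u = {i})"

definition dict_sgn :: "'a set \<Rightarrow> (('a \<Rightarrow> real) \<Rightarrow> real) \<Rightarrow> real" where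
  "dict_sgn A u = (THE s. s \<in> {-1, 1} \<and> (\<exists>i\<in>A. \<forall>x\<in>cube A. u x = s * x i))"

text \<open>
  \<open>restrict_coords A B u\<close> regards a function \<open>u\<close> on \<open>cube A\<close> as a function on \<open>cube B\<close>, for
  \<open>B \<subseteq> A\<close>. It is meant for \<open>Dep A u \<subseteq> B\<close>, when the filler value \<open>1\<close> is irrelevant.
\<close>

definition restrict_coords ::
    "'a set \<Rightarrow> 'a set \<Rightarrow> (('a \<Rightarrow> real) \<Rightarrow> real) \<Rightarrow> ('a \<Rightarrow> real) \<Rightarrow> real" where
  "restrict_coords A B u = (\<lambda>y. u (\<lambda>i\<in>A. if i \<in> B then y i else 1))"


section \<open>The functional equation and its reduction\<close>

definition composition_identity ::
    "nat \<Rightarrow> nat \<Rightarrow> (nat \<Rightarrow> (nat \<Rightarrow> real) \<Rightarrow> real) \<Rightarrow> (nat \<Rightarrow> (nat \<Rightarrow> real) \<Rightarrow> real) \<Rightarrow> bool" where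
  "composition_identity n m f g \<longleftrightarrow>
    (\<forall>z\<in>cube ({1..n} \<times> {1..m}).
       f 0 (\<lambda>i\<in>{1..n}. g i (\<lambda>j\<in>{1..m}. z (i, j))) =
       g 0 (\<lambda>j\<in>{1..m}. f j (\<lambda>i\<in>{1..n}. z (i, j))))"

text \<open>
  In the next two definitions \<open>(v k)\<close>, for \<open>k \<in> K\<close>, is a family of functions on \<open>cube A\<close> and
  \<open>u\<close> is a function on \<open>cube K\<close>.
\<close>

definition nonconst_indices ::
    "'k set \<Rightarrow> 'a set \<Rightarrow> ('k \<Rightarrow> ('a \<Rightarrow> real) \<Rightarrow> real) \<Rightarrow> 'k set" where
  "nonconst_indices K A v = {k \<in> K. \<not> v k constant_on cube A}"

definition fix_constants ::
    "'k set \<Rightarrow> 'a set \<Rightarrow> ('k \<Rightarrow> ('a \<Rightarrow> real) \<Rightarrow> real) \<Rightarrow> (('k \<Rightarrow> real) \<Rightarrow> real) \<Rightarrow>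
     ('k \<Rightarrow> real) \<Rightarrow> real" where
  "fix_constants K A v u = (\<lambda>y. u (\<lambda>k\<in>K.
     if k \<in> nonconst_indices K A v then y k else the_elem (v k ` cube A)))"


section \<open>Blocks\<close>

definition rows_of :: "('a \<times> 'b) set \<Rightarrow> 'a set" where "rows_of W = fst ` W"
definition cols_of :: "('a \<times> 'b) set \<Rightarrow> 'b set" where "cols_of W = snd ` W"

text \<open>
  Throughout, \<open>A\<close> is the set of row indices and \<open>B\<close> the set of column indices; \<open>f j\<close>, for
  \<open>j \<in> B\<close>, are functions on \<open>cube A\<close>, and \<open>g i\<close>, for \<open>i \<in> A\<close>, are functions on \<open>cube B\<close>.
\<close>

definition rows_eq1 where "rows_eq1 B g W = {i \<in> rows_of W. deg B (g i) = 1}"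
definition rows_ge2 where "rows_ge2 B g W = {i \<in> rows_of W. deg B (g i) \<ge> 2}"
definition cols_eq1 where "cols_eq1 A f W = {j \<in> cols_of W. deg A (f j) = 1}"
definition cols_ge2 where "cols_ge2 A f W = {j \<in> cols_of W. deg A (f j) \<ge> 2}"

text \<open>
  In \<open>dep_eq1\<close>, \<open>dep_ge2\<close> and \<open>sgn_point\<close> the pair \<open>B, v\<close> gives the functions whose degrees
  and signs are attached to the coordinates in \<open>A\<close>: thus $x^{\mathrm{sgn}}$ is
  \<open>sgn_point A B g x\<close>, and $y^{\mathrm{sgn}}$ is \<open>sgn_point B A f y\<close>.
\<close>

definition dep_eq1 :: "'a set \<Rightarrow> (('a \<Rightarrow> real) \<Rightarrow> real) \<Rightarrow> 'b set \<Rightarrow> ('a \<Rightarrow> ('b \<Rightarrow> real) \<Rightarrow> real) \<Rightarrow> 'a set" where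
  "dep_eq1 A u B v = {i \<in> Dep A u. deg B (v i) = 1}"

definition dep_ge2 :: "'a set \<Rightarrow> (('a \<Rightarrow> real) \<Rightarrow> real) \<Rightarrow> 'b set \<Rightarrow> ('a \<Rightarrow> ('b \<Rightarrow> real) \<Rightarrow> real) \<Rightarrow> 'a set" where
  "dep_ge2 A u B v = {i \<in> Dep A u. deg B (v i) \<ge> 2}"

definition sgn_point :: "'a set \<Rightarrow> 'b set \<Rightarrow> ('a \<Rightarrow> ('b \<Rightarrow> real) \<Rightarrow> real) \<Rightarrow> ('a \<Rightarrow> real) \<Rightarrow> 'a \<Rightarrow> real" where
  "sgn_point A B v x = (\<lambda>i\<in>A. if deg B (v i) = 1 then dict_sgn B (v i) * x i else x i)"

text \<open>
  The three possible shapes of a block \<open>W\<close>; \<open>p\<close> and \<open>q\<close> stand for $f_0^{(\ell)}$ and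
  $g_0^{(\ell)}$, functions on \<open>cube (rows_of W)\<close> and \<open>cube (cols_of W)\<close>. In \<open>and_block\<close> the signs \<open>\<kappa> i j\<close>
  are given for all pairs of a row and a column of degree at least 2, not only for those in \<open>W\<close>;
  the values that do not occur in the formulas for \<open>f j\<close> and \<open>g i\<close> are irrelevant.
\<close>

definition singleton_block ::
    "'a set \<Rightarrow> 'b set \<Rightarrow> ('b \<Rightarrow> ('a \<Rightarrow> real) \<Rightarrow> real) \<Rightarrow> ('a \<Rightarrow> ('b \<Rightarrow> real) \<Rightarrow> real) \<Rightarrow>
     ('a \<times> 'b) set \<Rightarrow> (('a \<Rightarrow> real) \<Rightarrow> real) \<Rightarrow> (('b \<Rightarrow> real) \<Rightarrow> real) \<Rightarrow> bool" where
  "singleton_block A B f g W p q \<longleftrightarrow>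
    (\<exists>i j. W = {(i, j)} \<and>
      (\<forall>x\<in>cube A. f j x = dict_sgn A (f j) * x i) \<and>
      (\<forall>y\<in>cube B. g i y = dict_sgn B (g i) * y j) \<and>
      (\<forall>x\<in>cube A. p (restrict x (rows_of W)) = dict_sgn A (f j) * x i) \<and>
      (\<forall>y\<in>cube B. q (restrict y (cols_of W)) = dict_sgn B (g i) * y j))"

definition xor_block ::
    "'a set \<Rightarrow> 'b set \<Rightarrow> ('b \<Rightarrow> ('a \<Rightarrow> real) \<Rightarrow> real) \<Rightarrow> ('a \<Rightarrow> ('b \<Rightarrow> real) \<Rightarrow> real) \<Rightarrow>
     ('a \<times> 'b) set \<Rightarrow> (('a \<Rightarrow> real) \<Rightarrow> real) \<Rightarrow> (('b \<Rightarrow> real) \<Rightarrow> real) \<Rightarrow> bool" where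
  "xor_block A B f g W p q \<longleftrightarrow>
    (\<exists>\<phi> \<gamma>.
      (\<forall>j\<in>cols_of W. \<phi> j \<in> cube (dep_eq1 A (f j) B g) \<rightarrow> {-1, 1} \<and>
        (\<forall>x\<in>cube A. f j x =
           \<phi> j (restrict x (dep_eq1 A (f j) B g)) * (\<Prod>i'\<in>dep_ge2 A (f j) B g. x i'))) \<and>
      (\<forall>i\<in>rows_of W. \<gamma> i \<in> cube (dep_eq1 B (g i) A f) \<rightarrow> {-1, 1} \<and>
        (\<forall>y\<in>cube B. g i y =
           \<gamma> i (restrict y (dep_eq1 B (g i) A f)) * (\<Prod>j'\<in>dep_ge2 B (g i) A f. y j'))) \<and>
      (\<forall>x\<in>cube A. p (restrict x (rows_of W)) =
         (\<Prod>i\<in>rows_ge2 B g W. x i) *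
         (\<Prod>j\<in>cols_ge2 A f W. \<phi> j (restrict (sgn_point A B g x) (dep_eq1 A (f j) B g)))) \<and>
      (\<forall>y\<in>cube B. q (restrict y (cols_of W)) =
         (\<Prod>j\<in>cols_ge2 A f W. y j) *
         (\<Prod>i\<in>rows_ge2 B g W. \<gamma> i (restrict (sgn_point B A f y) (dep_eq1 B (g i) A f)))))"

definition and_block ::
    "'a set \<Rightarrow> 'b set \<Rightarrow> ('b \<Rightarrow> ('a \<Rightarrow> real) \<Rightarrow> real) \<Rightarrow> ('a \<Rightarrow> ('b \<Rightarrow> real) \<Rightarrow> real) \<Rightarrow>
     ('a \<times> 'b) set \<Rightarrow> (('a \<Rightarrow> real) \<Rightarrow> real) \<Rightarrow> (('b \<Rightarrow> real) \<Rightarrow> real) \<Rightarrow> bool" where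
  "and_block A B f g W p q \<longleftrightarrow>
    (\<forall>i\<in>rows_eq1 B g W. dictator B (g i)) \<and>
    (\<forall>j\<in>cols_eq1 A f W. dictator A (f j)) \<and>
    (\<exists>b d \<kappa> \<phi> \<gamma>.
      (\<forall>j\<in>cols_ge2 A f W. b j \<in> {-1, 1}) \<and>
      (\<forall>i\<in>rows_ge2 B g W. d i \<in> {-1, 1}) \<and>
      (\<forall>i\<in>rows_ge2 B g W. \<forall>j\<in>cols_ge2 A f W. \<kappa> i j \<in> {-1, 1}) \<and>
      (\<forall>j\<in>cols_ge2 A f W. \<phi> j \<in> cube (dep_eq1 A (f j) B g) \<rightarrow> {0, 1} \<and>
        (\<forall>x\<in>cube A. f j x =
           \<phi> j (restrict x (dep_eq1 A (f j) B g)) *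
           (2 * b j * (\<Prod>i'\<in>dep_ge2 A (f j) B g. (\<kappa> i' j * x i' + 1) / 2)) - b j)) \<and>
      (\<forall>i\<in>rows_ge2 B g W. \<gamma> i \<in> cube (dep_eq1 B (g i) A f) \<rightarrow> {0, 1} \<and>
        (\<forall>y\<in>cube B. g i y =
           \<gamma> i (restrict y (dep_eq1 B (g i) A f)) *
           (2 * d i * (\<Prod>j'\<in>dep_ge2 B (g i) A f. (\<kappa> i j' * y j' + 1) / 2)) - d i)) \<and>
      (\<forall>x\<in>cube A. p (restrict x (rows_of W)) =
         2 * (\<Prod>i\<in>rows_ge2 B g W. (d i * x i + 1) / 2) *
         (\<Prod>j\<in>cols_ge2 A f W. \<phi> j (restrict (sgn_point A B g x) (dep_eq1 A (f j) B g))) - 1) \<and>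
      (\<forall>y\<in>cube B. q (restrict y (cols_of W)) =
         2 * (\<Prod>j\<in>cols_ge2 A f W. (b j * y j + 1) / 2) *
         (\<Prod>i\<in>rows_ge2 B g W. \<gamma> i (restrict (sgn_point B A f y) (dep_eq1 B (g i) A f))) - 1))"

end

theory Submission
  imports Defs
begin

text \<open>
  Write \<open>H(z)\<close> for the common value of both sides. It depends on the cell \<open>z(i, j)\<close> iff \<open>i\<close> and \<open>j\<close> are
  relevant to the outer functions and \<open>g\<^sub>i\<close> depends on \<open>j\<close>, and equally iff \<open>f\<^sub>j\<close> depends on \<open>i\<close>; the blocks
  are the connected components of these cells under sharing a row or a column. At a core cell,
  where both \<open>g\<^sub>i\<close> and \<open>f\<^sub>j\<close> depend on at least two coordinates, varying only row \<open>i\<close> and column \<open>j\<close>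
  shows that either both functions always flip with the cell (XOR), or each has a value that forces
  the cell to one common value \<open>\<kappa>\<close> (AND). The two types cannot meet in a row or a column, so a block
  is of one type. Conversely \<open>H\<close> is unchanged by every change of cells that keeps all row values or all
  column values; such changes connect any two configurations of a block with the same value of
  the block function, so \<open>H\<close> is a function \<open>h\<close> of the values of the block functions.
\<close>

section \<open>Boolean functions of finitely many coordinates\<close>

text \<open>Flipping and forcing exclude each other only for functions with at least two relevant
  coordinates: a literal flips with its coordinate and also forces it, at both of its values. Hence
  the dichotomy is confined to core cells, and the other cells need an argument of their own. A cell
  outside the core is alone in its row or in its column, so no path needs it in order to join two
  core cells; this makes the core of a block connected and lets one type spread over all of it. A
  block without core cells is either a single cell or a star around one function of arbitrary shape;
  the XOR formulas cover a star because dictators flip. The signs in \<open>sgn_point\<close> arise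
  as follows: the value of a row of degree 1 determines the one cell it reads up to a sign, so
  multiplying by that sign recovers the cell. In this way a function of the row values alone can
  evaluate the factors that belong to columns. The combinatorics runs over truth values, on total
  functions \<open>'a \<Rightarrow> bool\<close> of finite support, where rows and columns are
  symmetric and no care about index sets is needed; signs and Fourier degrees enter only through a
  translation.\<close>

definition bdep :: "(('a \<Rightarrow> bool) \<Rightarrow> bool) \<Rightarrow> 'a set" where
  "bdep u = {i. \<exists>x. u (x(i := \<not> x i)) \<noteq> u x}"

text \<open>Takes the place of a finite index set. Over an infinite type a function such as
  "infinitely many entries are true" has empty \<open>bdep\<close> and is not constant; finite
  support excludes this.\<close>

definition fsupp :: "(('a \<Rightarrow> bool) \<Rightarrow> bool) \<Rightarrow> bool" where
  "fsupp u \<longleftrightarrow> (\<exists>S. finite S \<and> (\<forall>x y. (\<forall>i\<in>S. x i = y i) \<longrightarrow> u x = u y))"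

text \<open>The Boolean counterpart of degree at least 2, see \<open>deg_ge_2_iff\<close>.\<close>

definition junta2 :: "(('a \<Rightarrow> bool) \<Rightarrow> bool) \<Rightarrow> bool" where
  "junta2 u \<longleftrightarrow> (\<exists>i\<in>bdep u. \<exists>j\<in>bdep u. i \<noteq> j)"

lemma bdep_subset_support:
  assumes "\<And>x y. (\<And>i. i \<in> S \<Longrightarrow> x i = y i) \<Longrightarrow> u x = u y"
  shows "bdep u \<subseteq> S"
proof
  fix i assume "i \<in> bdep u"
  then obtain x where "u (x(i := \<not> x i)) \<noteq> u x" by (auto simp: bdep_def)
  then show "i \<in> S" using assms[of "x(i := \<not> x i)" x] by (metis fun_upd_other)
qed

lemma finite_bdep:
  assumes "fsupp u" shows "finite (bdep u)"
proof -
  obtain S where S: "finite S" "\<And>x y. (\<forall>i\<in>S. x i = y i) \<Longrightarrow> u x = u y"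
    using assms by (auto simp: fsupp_def)
  have "bdep u \<subseteq> S" by (rule bdep_subset_support) (rule S(2), blast)
  with S(1) show ?thesis by (rule finite_subset[rotated])
qed

text \<open>\<open>x\<close> is changed into \<open>y\<close> one support coordinate at a time. A
  coordinate where they differ is outside \<open>bdep u\<close>, so no single change affects
  \<open>u\<close>.\<close>

lemma eq_if_agree_on_bdep:
  assumes "fsupp u" and agree: "\<And>i. i \<in> bdep u \<Longrightarrow> x i = y i"
  shows "u x = u y"
proof -
  obtain S where S: "finite S" and supp: "\<And>x y. (\<forall>i\<in>S. x i = y i) \<Longrightarrow> u x = u y"
    using assms(1) by (auto simp: fsupp_def)
  have "u (\<lambda>i. if i \<in> T then y i else x i) = u x" if "finite T" for T
    using that
  proof induction
    case (insert i T)
    define w where "w = (\<lambda>k. if k \<in> T then y k else x k)"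
    have eq: "(\<lambda>k. if k \<in> insert i T then y k else x k) = w(i := y i)"
      by (rule ext) (simp add: w_def)
    have "u (w(i := y i)) = u w"
    proof (cases "y i = w i")
      case True
      then show ?thesis by simp
    next
      case False
      then have "x i \<noteq> y i" by (auto simp: w_def split: if_splits)
      with agree have "i \<notin> bdep u" by blast
      then have "u (w(i := \<not> w i)) = u w" unfolding bdep_def by blast
      moreover have "y i = (\<not> w i)" using False by blast
      ultimately show ?thesis by simp
    qed
    with insert.IH show ?case unfolding eq w_def by simp
  qed simp
  from this[OF S] supp[of y "\<lambda>i. if i \<in> S then y i else x i"] show ?thesis by simp
qed

lemma attains_if_bdep_nonempty:
  assumes "bdep u \<noteq> {}" shows "\<exists>x. u x = t"
proof -
  from assms obtain i x where "u (x(i := \<not> x i)) \<noteq> u x" by (auto simp: bdep_def)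
  then show ?thesis by (cases "u x = t") auto
qed

lemma junta2D:
  assumes "junta2 u" shows "\<exists>j'\<in>bdep u. j' \<noteq> j"
  using assms unfolding junta2_def by metis

lemma not_junta2_unique: "\<not> junta2 u \<Longrightarrow> i \<in> bdep u \<Longrightarrow> j \<in> bdep u \<Longrightarrow> i = j"
  unfolding junta2_def by blast

lemma junta2_not_literal:
  assumes "junta2 u" shows "\<not> (\<forall>y. u y = (y j = \<delta>))"
proof
  assume *: "\<forall>y. u y = (y j = \<delta>)"
  obtain j' where "j' \<in> bdep u" "j' \<noteq> j" using junta2D[OF assms] by blast
  with * show False by (auto simp: bdep_def)
qed


text \<open>
  The local analysis at a cell \<open>c\<close>: \<open>a c u\<close> is the value of its row, \<open>b c v\<close> that of its
  column, with \<open>u\<close> and \<open>v\<close> the other entries of the row and of the column.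
\<close>

lemma sensitive_cell_dichotomy:
  fixes a :: "bool \<Rightarrow> 'u \<Rightarrow> bool" and b :: "bool \<Rightarrow> 'v \<Rightarrow> bool"
    and \<Phi> :: "'v \<Rightarrow> bool \<Rightarrow> bool" and \<Psi> :: "'u \<Rightarrow> bool \<Rightarrow> bool"
  assumes eq: "\<And>c u v. \<Phi> v (a c u) = \<Psi> u (b c v)"
    and sens: "\<Phi> v0 (a True u0) \<noteq> \<Phi> v0 (a False u0)"
    and nda: "\<And>\<delta>. \<not> (\<forall>c u. a c u = (c = \<delta>))"
    and ndb: "\<And>\<delta>. \<not> (\<forall>c v. b c v = (c = \<delta>))"
  shows "(\<forall>u. a True u \<noteq> a False u) \<and> (\<forall>v. b True v \<noteq> b False v) \<or>
    (\<exists>\<kappa> d \<beta>. (\<forall>c u. a c u = d \<longrightarrow> c = \<kappa>) \<and> (\<forall>c v. b c v = \<beta> \<longrightarrow> c = \<kappa>))"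
proof -
  define sa where "sa u \<longleftrightarrow> a True u \<noteq> a False u" for u
  define sb where "sb v \<longleftrightarrow> b True v \<noteq> b False v" for v
  have saD: "sa u \<Longrightarrow> a (\<not> c) u = (\<not> a c u)" "\<not> sa u \<Longrightarrow> a c u = a c' u" for c c' u
    unfolding sa_def by (cases c; cases c'; auto)+
  have sbD: "sb u \<Longrightarrow> b (\<not> c) u = (\<not> b c u)" "\<not> sb u \<Longrightarrow> b c u = b c' u" for c c' u
    unfolding sb_def by (cases c; cases c'; auto)+
  \<comment> \<open>Toggling \<open>c\<close> changes the common value iff the inner value reacts
    and the outer function reacts to it. This is read off from both sides of the equation.\<close>
  have prod: "sa u \<and> \<Phi> v True \<noteq> \<Phi> v False \<longleftrightarrow> sb v \<and> \<Psi> u True \<noteq> \<Psi> u False" for u v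
    using eq[of v True u] eq[of v False u] unfolding sa_def sb_def
    by (cases "a True u"; cases "a False u"; cases "b True v"; cases "b False v") auto
  have "sa u0 \<and> \<Phi> v0 True \<noteq> \<Phi> v0 False"
    using sens unfolding sa_def by (cases "a True u0"; cases "a False u0") auto
  \<comment> \<open>All four reactions occur at \<open>u0\<close> and \<open>v0\<close>. Putting
    \<open>u0\<close> or \<open>v0\<close> into \<open>prod\<close> therefore decouples it: the
    outer function at \<open>v\<close> reacts iff \<open>b\<close> does, and the one at
    \<open>u\<close> iff \<open>a\<close> does.\<close>
  then have 0: "sa u0" "sb v0" "\<Phi> v True \<noteq> \<Phi> v False \<longleftrightarrow> sb v"
    "\<Psi> u True \<noteq> \<Psi> u False \<longleftrightarrow> sa u" for u v
    using prod by blast+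
  have \<Phi>I: "sb v \<Longrightarrow> \<Phi> v (\<not> t) = (\<not> \<Phi> v t)" "\<not> sb v \<Longrightarrow> \<Phi> v t = \<Phi> v t'" for v t t'
    using 0(3)[of v] by (cases t; cases t'; auto)+
  have \<Psi>I: "sa v \<Longrightarrow> \<Psi> v (\<not> t) = (\<not> \<Psi> v t)" "\<not> sa v \<Longrightarrow> \<Psi> v t = \<Psi> v t'" for v t t'
    using 0(4)[of v] by (cases t; cases t'; auto)+
  have inj\<Phi>: "\<Phi> v0 t = \<Phi> v0 t' \<Longrightarrow> t = t'" for t t'
    using \<Phi>I(1)[OF 0(2), of t] by (cases "t = t'") auto
  have inj\<Psi>: "\<Psi> u0 t = \<Psi> u0 t' \<Longrightarrow> t = t'" for t t'
    using \<Psi>I(1)[OF 0(1), of t] by (cases "t = t'") auto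
  show ?thesis
  proof (cases "\<forall>u. sa u")
    case True
    have "sb v1" for v1
    proof (rule ccontr)
      \<comment> \<open>At such a \<open>v1\<close> the common value is constant. Every
        \<open>\<Psi> u\<close> is injective here and takes this constant at the same point, so
        \<open>\<Psi> u\<close> is the same for all \<open>u\<close>. Then \<open>a c u\<close> is
        independent of \<open>u\<close>, which makes it a literal in \<open>c\<close>.\<close>
      assume v1: "\<not> sb v1"
      have "\<Psi> u t = \<Psi> u0 t" for u t
        using eq[of v1 True u] eq[of v1 True u0] \<Phi>I(2)[OF v1, of "a True u" "a True u0"]
          True \<Psi>I(1)[of u "b True v1"] \<Psi>I(1)[of u0 "b True v1"]
        by (cases "t = b True v1") auto
      then have "\<Phi> v0 (a c u) = \<Phi> v0 (a c u0)" for c u using eq by metis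
      then have au: "a c u = a c u0" for c u
        using inj\<Phi> by blast
      have "\<forall>c u. a c u = (c = a True u0)"
      proof (intro allI)
        fix c u show "a c u = (c = a True u0)"
          using au[of c u] saD(1)[OF 0(1), of True] by (cases c) auto
      qed
      with nda show False by blast
    qed
    with True show ?thesis by (simp add: sa_def sb_def)
  next
    case False
    then obtain u1 where u1: "\<not> sa u1" by blast
    show ?thesis
    proof (cases "\<forall>v. sb v")
      case True
      have "\<Phi> v t = \<Phi> v0 t" for v t
        using eq[of v True u1] eq[of v0 True u1] \<Psi>I(2)[OF u1, of "b True v" "b True v0"]
          True \<Phi>I(1)[of v "a True u1"] \<Phi>I(1)[of v0 "a True u1"]
        by (cases "t = a True u1") auto
      then have "\<Psi> u0 (b c v) = \<Psi> u0 (b c v0)" for c v using eq by metis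
      then have bv: "b c v = b c v0" for c v
        using inj\<Psi> by blast
      have "\<forall>c v. b c v = (c = b True v0)"
      proof (intro allI)
        fix c v show "b c v = (c = b True v0)"
          using bv[of c v] sbD(1)[OF 0(2), of True] by (cases c) auto
      qed
      with ndb show ?thesis by blast
    next
      case False
      then obtain v1 where v1: "\<not> sb v1" by blast
      \<comment> \<open>At \<open>u1\<close> and \<open>v1\<close> the inner values no longer react:
        \<open>\<alpha>\<close> and \<open>\<beta>\<close> are the values at which they are stuck,
        and \<open>T\<close> is the resulting output. Every outer function sends the stuck value to
        \<open>T\<close>, so an output other than \<open>T\<close> needs both opposite values
        \<open>\<not> \<alpha>\<close> and \<open>\<not> \<beta>\<close>. These are the forcing
        values.\<close>
      define \<alpha> \<beta> T where "\<alpha> = a True u1" and "\<beta> = b True v1" and "T = \<Phi> v1 True"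
      have a1: "a c u1 = \<alpha>" for c using saD(2)[OF u1] \<alpha>_def by blast
      have b1: "b c v1 = \<beta>" for c using sbD(2)[OF v1] \<beta>_def by blast
      have \<Phi>1: "\<Phi> v1 t = T" for t using \<Phi>I(2)[OF v1] T_def by blast
      have \<Psi>1: "\<Psi> u1 t = T" for t
        using \<Psi>I(2)[OF u1] eq[of v1 True u1] \<Phi>1 by metis
      have \<Phi>0: "\<Phi> v \<alpha> = T" for v using eq[of v True u1] a1 \<Psi>1 by simp
      have \<Psi>0: "\<Psi> u \<beta> = T" for u using eq[of v1 True u] b1 \<Phi>1 by simp
      have E1: "\<Phi> v0 t = T \<longleftrightarrow> t = \<alpha>" for t
        using \<Phi>0[of v0] \<Phi>I(1)[OF 0(2), of \<alpha>] by (cases "t = \<alpha>") auto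
      have E2: "\<Psi> u0 t = T \<longleftrightarrow> t = \<beta>" for t
        using \<Psi>0[of u0] \<Psi>I(1)[OF 0(1), of \<beta>] by (cases "t = \<beta>") auto
      \<comment> \<open>\<open>b\<close> reacts to \<open>c\<close> at \<open>v0\<close>, so exactly
        one \<open>c\<close> yields the value \<open>\<not> \<beta>\<close> there. If
        \<open>a c u\<close> is \<open>\<not> \<alpha>\<close>, the output at \<open>v0\<close> is
        not \<open>T\<close>, hence \<open>b c v0\<close> is \<open>\<not> \<beta>\<close> and
        \<open>c\<close> is this bit.\<close>
      define \<kappa> where "\<kappa> = (if b True v0 = (\<not> \<beta>) then True else False)"
      have k: "b c v0 = (\<not> \<beta>) \<longleftrightarrow> c = \<kappa>" for c
        using sbD(1)[OF 0(2), of True] by (cases c) (auto simp: \<kappa>_def)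
      have "a c u = (\<not> \<alpha>) \<longrightarrow> c = \<kappa>" for c u
        using E1[of "a c u"] eq[of v0 c u] \<Psi>0[of u] k[of c] by auto
      moreover have "a c u0 = (\<not> \<alpha>) \<longleftrightarrow> c = \<kappa>" for c
        using E1[of "a c u0"] eq[of v0 c u0] E2[of "b c v0"] k[of c] by auto
      then have "b c v = (\<not> \<beta>) \<longrightarrow> c = \<kappa>" for c v
        using E2[of "b c v"] eq[of v c u0] \<Phi>0[of v] by (cases "a c u0 = \<alpha>") auto
      ultimately show ?thesis by blast
    qed
  qed
qed

section \<open>The functional equation and its cells\<close>

definition flips :: "(('a \<Rightarrow> bool) \<Rightarrow> bool) \<Rightarrow> 'a \<Rightarrow> bool" where
  "flips u i \<longleftrightarrow> (\<forall>x. u (x(i := \<not> x i)) \<noteq> u x)"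

definition forces :: "(('a \<Rightarrow> bool) \<Rightarrow> bool) \<Rightarrow> bool \<Rightarrow> 'a \<Rightarrow> bool \<Rightarrow> bool" where
  "forces u d i \<kappa> \<longleftrightarrow> (\<forall>x. u x = d \<longrightarrow> x i = \<kappa>)"

lemma forcesD: "forces u d i \<kappa> \<Longrightarrow> u x = d \<Longrightarrow> x i = \<kappa>"
  unfolding forces_def by (drule spec[of _ x]) (erule mp)

lemma flipsD: "flips u i \<Longrightarrow> u (x(i := \<not> x i)) = (\<not> u x)"
  unfolding flips_def by blast

text \<open>If opposite values forced different coordinates, a point violating both conditions would
  have no value left. If they forced the same coordinate, \<open>u\<close> would be a
  literal.\<close>

lemma forces_value_unique:
  assumes big: "junta2 u" and 1: "forces u d i \<kappa>" and 2: "forces u d' i' \<kappa>'"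
  shows "d = d'"
proof (rule ccontr)
  assume dd: "d \<noteq> d'"
  show False
  proof (cases "i = i'")
    case False
    define y where "y = (\<lambda>_. False)(i := \<not> \<kappa>, i' := \<not> \<kappa>')"
    have "u y \<noteq> d" "u y \<noteq> d'"
      using forcesD[OF 1, of y] forcesD[OF 2, of y] False by (auto simp: y_def)
    with dd show False by auto
  next
    case True
    have "u y = (y i = (\<kappa> = d))" for y
      using forcesD[OF 1, of y] forcesD[OF 2, of y]
        forcesD[OF 1, of "\<lambda>_. \<not> \<kappa>"] forcesD[OF 2, of "\<lambda>_. \<not> \<kappa>"] True dd
      by (cases "u y"; cases d) auto
    with junta2_not_literal[OF big] show False by blast
  qed
qed

text \<open>While the forced coordinate is wrong, \<open>u\<close> is stuck at
  \<open>\<not> d\<close>, so no other coordinate can flip it. If the flipping coordinate is the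
  forced one, \<open>u\<close> is a literal.\<close>

lemma flips_not_forces:
  assumes big: "junta2 u" and fl: "flips u i" and fo: "forces u d i' \<kappa>"
  shows False
proof (cases "i = i'")
  case True
  have "u y = (y i = (\<kappa> = d))" for y
    using flipsD[OF fl, of y] forcesD[OF fo, of y] forcesD[OF fo, of "y(i := \<not> y i)"] True
    by (cases d) auto
  with junta2_not_literal[OF big] show False by blast
next
  case False
  have "u (\<lambda>_. \<not> \<kappa>) \<noteq> d" using forcesD[OF fo, of "\<lambda>_. \<not> \<kappa>"] by auto
  moreover have "u ((\<lambda>_. \<not> \<kappa>)(i := \<kappa>)) \<noteq> d"
    using forcesD[OF fo, of "(\<lambda>_. \<not> \<kappa>)(i := \<kappa>)"] False by auto
  moreover have "u ((\<lambda>_. \<not> \<kappa>)(i := \<kappa>)) \<noteq> u (\<lambda>_. \<not> \<kappa>)"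
    using flipsD[OF fl, of "\<lambda>_. \<not> \<kappa>"] by simp
  ultimately show False by blast
qed

section \<open>Row values, column values and output of a configuration of cells\<close>

locale bool_system =
  fixes F :: "('a \<Rightarrow> bool) \<Rightarrow> bool" and G :: "('b \<Rightarrow> bool) \<Rightarrow> bool"
    and f :: "'b \<Rightarrow> ('a \<Rightarrow> bool) \<Rightarrow> bool" and g :: "'a \<Rightarrow> ('b \<Rightarrow> bool) \<Rightarrow> bool"
  assumes fsupp_F: "fsupp F" and fsupp_G: "fsupp G"
    and fsupp_f: "\<And>j. fsupp (f j)" and fsupp_g: "\<And>i. fsupp (g i)"
    and f_nonconst: "\<And>j. j \<in> bdep G \<Longrightarrow> bdep (f j) \<noteq> {}"
    and g_nonconst: "\<And>i. i \<in> bdep F \<Longrightarrow> bdep (g i) \<noteq> {}"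
    and identity: "\<And>z. F (\<lambda>i. g i (\<lambda>j. z (i, j))) = G (\<lambda>j. f j (\<lambda>i. z (i, j)))"
begin

text \<open>Transposing the configuration exchanges the two sides of the identity, so every fact
  about rows also holds for columns.\<close>

lemma swapped: "bool_system G F g f"
proof
  fix z :: "'b \<times> 'a \<Rightarrow> bool"
  show "G (\<lambda>i. f i (\<lambda>j. z (i, j))) = F (\<lambda>j. g j (\<lambda>i. z (i, j)))"
    using identity[of "\<lambda>(i, j). z (j, i)"] by simp
qed (fact fsupp_F fsupp_G fsupp_f fsupp_g f_nonconst g_nonconst)+

definition row_value :: "('a \<times> 'b \<Rightarrow> bool) \<Rightarrow> 'a \<Rightarrow> bool" where
  "row_value z i = g i (\<lambda>j. z (i, j))"

definition col_value :: "('a \<times> 'b \<Rightarrow> bool) \<Rightarrow> 'b \<Rightarrow> bool" where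
  "col_value z j = f j (\<lambda>i. z (i, j))"

definition outp :: "('a \<times> 'b \<Rightarrow> bool) \<Rightarrow> bool" where
  "outp z = F (row_value z)"

lemma outp_col: "outp z = G (col_value z)"
  using identity[of z] by (simp add: outp_def row_value_def[abs_def] col_value_def[abs_def])

lemma outp_eq_if_rows:
  "(\<And>i. i \<in> bdep F \<Longrightarrow> row_value z i = row_value z' i) \<Longrightarrow> outp z = outp z'"
  unfolding outp_def by (rule eq_if_agree_on_bdep[OF fsupp_F]) blast

lemma outp_eq_if_cols:
  "(\<And>j. j \<in> bdep G \<Longrightarrow> col_value z j = col_value z' j) \<Longrightarrow> outp z = outp z'"
  unfolding outp_col by (rule eq_if_agree_on_bdep[OF fsupp_G]) blast

lemma row_value_upd: "i \<noteq> i' \<Longrightarrow> row_value (z((i', j) := t)) i = row_value z i"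
  by (simp add: row_value_def)

lemma col_value_upd: "j \<noteq> j' \<Longrightarrow> col_value (z((i, j') := t)) j = col_value z j"
  by (simp add: col_value_def)

lemma row_value_upd_same: "row_value (z((i, j) := t)) i = g i ((\<lambda>j. z (i, j))(j := t))"
  unfolding row_value_def by (rule arg_cong[of _ _ "g i"]) auto

lemma col_value_upd_same: "col_value (z((i, j) := t)) j = f j ((\<lambda>i. z (i, j))(i := t))"
  unfolding col_value_def by (rule arg_cong[of _ _ "f j"]) auto

text \<open>Different rows read disjoint sets of cells, so their values can be prescribed
  independently.\<close>

lemma row_values_surj: "\<exists>z. \<forall>i\<in>bdep F. row_value z i = x i"
proof -
  have "\<exists>y. g i y = x i" if "i \<in> bdep F" for i
    by (rule attains_if_bdep_nonempty) (rule g_nonconst[OF that])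
  then obtain r where r: "\<And>i. i \<in> bdep F \<Longrightarrow> g i (r i) = x i" by metis
  show ?thesis
    by (rule exI[of _ "\<lambda>(i, j). r i j"]) (simp add: row_value_def r)
qed

text \<open>Row \<open>i\<close> is filled with a point where \<open>g i\<close> reacts to
  \<open>j\<close>, the other rows with a preimage of a point where \<open>F\<close> reacts to
  \<open>i\<close>. The flip then passes through both functions.\<close>

lemma outp_sensitive:
  assumes i: "i \<in> bdep F" and j: "j \<in> bdep (g i)"
  shows "\<exists>z. outp (z((i, j) := \<not> z (i, j))) \<noteq> outp z"
proof -
  obtain x where x: "F (x(i := \<not> x i)) \<noteq> F x" using i by (auto simp: bdep_def)
  obtain y where y: "g i (y(j := \<not> y j)) \<noteq> g i y" using j by (auto simp: bdep_def)
  obtain z where z: "\<forall>a\<in>bdep F. row_value z a = x a" using row_values_surj by blast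
  define w where "w = (\<lambda>(a, b). if a = i then y b else z (a, b))"
  have wi: "(\<lambda>b. w (i, b)) = y" by (simp add: w_def)
  have w: "row_value w a = (if a = i then g i y else x a)" if "a \<in> bdep F" for a
    using z that by (auto simp: w_def row_value_def)
  have w': "row_value (w((i, j) := \<not> w (i, j))) a = (if a = i then \<not> g i y else x a)"
    if "a \<in> bdep F" for a
    using w[OF that] y row_value_upd_same[of w i j "\<not> w (i, j)"] row_value_upd[of a i w j "\<not> w (i, j)"]
    unfolding wi by (auto simp: w_def)
  have "outp w = F (x(i := g i y))" unfolding outp_def
    by (rule eq_if_agree_on_bdep[OF fsupp_F]) (simp add: w)
  moreover have "outp (w((i, j) := \<not> w (i, j))) = F (x(i := \<not> g i y))" unfolding outp_def
    by (rule eq_if_agree_on_bdep[OF fsupp_F]) (simp add: w')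
  moreover have "F (x(i := \<not> g i y)) \<noteq> F (x(i := g i y))"
    using x by (cases "g i y = x i") (auto simp: fun_upd_idem)
  ultimately show ?thesis by auto
qed

text \<open>Some flip of the cell changes the output. Seen from the other side it meets column
  \<open>j\<close> only, so \<open>G\<close> must read that column and \<open>f j\<close> must react
  to \<open>i\<close>. This one fact gives both the symmetry of the dependence relation and the
  inclusions of dependence sets in the final theorem.\<close>

lemma dep_transfer:
  assumes i: "i \<in> bdep F" and j: "j \<in> bdep (g i)"
  shows "j \<in> bdep G \<and> i \<in> bdep (f j)"
proof -
  obtain z where z: "outp (z((i, j) := \<not> z (i, j))) \<noteq> outp z"
    using outp_sensitive[OF assms] by blast
  let ?z = "z((i, j) := \<not> z (i, j))"
  have j': "\<exists>b\<in>bdep G. col_value ?z b \<noteq> col_value z b"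
    using z outp_eq_if_cols by blast
  then have jj: "j \<in> bdep G" "col_value ?z j \<noteq> col_value z j" using col_value_upd by metis+
  then have "i \<in> bdep (f j)"
    unfolding col_value_upd_same unfolding col_value_def bdep_def by auto
  with jj show ?thesis by blast
qed

definition cells :: "('a \<times> 'b) set" where
  "cells = {(i, j). i \<in> bdep F \<and> j \<in> bdep (g i)}"

lemma cells_col: "cells = {(i, j). j \<in> bdep G \<and> i \<in> bdep (f j)}"
  using dep_transfer bool_system.dep_transfer[OF swapped] unfolding cells_def by blast

lemma finite_cells: "finite cells"
proof (rule finite_subset)
  show "cells \<subseteq> (SIGMA i:bdep F. bdep (g i))" unfolding cells_def by auto
  show "finite (SIGMA i:bdep F. bdep (g i))"
    using finite_bdep[OF fsupp_F] finite_bdep[OF fsupp_g] by (intro finite_SigmaI)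
qed

definition core :: "('a \<times> 'b) set" where
  "core = {(i, j) \<in> cells. junta2 (g i) \<and> junta2 (f j)}"

definition xor_cell :: "'a \<times> 'b \<Rightarrow> bool" where
  "xor_cell = (\<lambda>(i, j). flips (g i) j \<and> flips (f j) i)"

definition and_cell :: "'a \<times> 'b \<Rightarrow> bool \<Rightarrow> bool \<Rightarrow> bool \<Rightarrow> bool" where
  "and_cell = (\<lambda>(i, j) \<kappa> d \<beta>. forces (g i) d j \<kappa> \<and> forces (f j) \<beta> i \<kappa>)"

section \<open>Core cells and their two types\<close>

lemma coreD:
  assumes "(i, j) \<in> core"
  shows "(i, j) \<in> cells" "i \<in> bdep F" "j \<in> bdep G" "j \<in> bdep (g i)" "i \<in> bdep (f j)"
    "junta2 (g i)" "junta2 (f j)"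
  using assms dep_transfer[of i j] by (auto simp: core_def cells_def)

lemma core_cell_dichotomy:
  assumes core: "(i, j) \<in> core"
  shows "xor_cell (i, j) \<or> (\<exists>\<kappa> d \<beta>. and_cell (i, j) \<kappa> d \<beta>)"
proof -
  have E: "i \<in> bdep F" "j \<in> bdep (g i)" and big: "junta2 (g i)" "junta2 (f j)"
    using core by (auto simp: core_def cells_def)
  obtain w where w: "outp (w((i, j) := \<not> w (i, j))) \<noteq> outp w"
    using outp_sensitive[OF E] by blast
  \<comment> \<open>Here \<open>u\<close> and \<open>v\<close> are full points whose entry at the
    cell is overwritten by \<open>c\<close>. Taking \<open>c\<close> to be that entry recovers
    \<open>g i\<close> and \<open>f j\<close> themselves.\<close>
  define a where "a c u = g i (u(j := c))" for c u
  define b where "b c v = f j (v(i := c))" for c v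
  \<comment> \<open>The cross of row \<open>i\<close> and column \<open>j\<close> is free and all
    else is frozen at \<open>w\<close>. The other rows then see only the column entries
    \<open>v\<close>, and row \<open>i\<close> enters through its value \<open>t\<close> alone;
    \<open>\<Psi>\<close> is the same with rows and columns exchanged.\<close>
  define \<Phi> where "\<Phi> v t = F ((\<lambda>a. g a (\<lambda>b. if b = j then v a else w (a, b)))(i := t))" for v t
  define \<Psi> where "\<Psi> u t = G ((\<lambda>b. f b (\<lambda>a. if a = i then u b else w (a, b)))(j := t))" for u t
  define cross where "cross c u v = (\<lambda>(a, b). if a = i then (if b = j then c else u b)
    else if b = j then v a else w (a, b))" for c u v
  have rows: "outp (cross c u v) = \<Phi> v (a c u)" for c u v
  proof -
    have "row_value (cross c u v) = (\<lambda>a. g a (\<lambda>b. if b = j then v a else w (a, b)))(i := a c u)"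
    proof
      fix k show "row_value (cross c u v) k =
        ((\<lambda>a. g a (\<lambda>b. if b = j then v a else w (a, b)))(i := a c u)) k"
        by (cases "k = i") (auto simp: row_value_def cross_def a_def fun_upd_def)
    qed
    then show ?thesis by (simp add: outp_def \<Phi>_def)
  qed
  have cols: "outp (cross c u v) = \<Psi> u (b c v)" for c u v
  proof -
    have "col_value (cross c u v) = (\<lambda>b. f b (\<lambda>a. if a = i then u b else w (a, b)))(j := b c v)"
    proof
      fix k show "col_value (cross c u v) k =
        ((\<lambda>b. f b (\<lambda>a. if a = i then u b else w (a, b)))(j := b c v)) k"
        by (cases "k = j") (auto simp: col_value_def cross_def b_def fun_upd_def)
    qed
    then show ?thesis by (simp add: outp_col \<Psi>_def)
  qed
  define u0 v0 where "u0 = (\<lambda>b. w (i, b))" and "v0 = (\<lambda>a. w (a, j))"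
  have cw: "cross c u0 v0 = w((i, j) := c)" for c
    by (auto simp: fun_eq_iff cross_def u0_def v0_def)
  have "outp (cross True u0 v0) \<noteq> outp (cross False u0 v0)"
    unfolding cw using w by (cases "w (i, j)") (auto simp: fun_upd_idem)
  then have sens: "\<Phi> v0 (a True u0) \<noteq> \<Phi> v0 (a False u0)" unfolding rows .
  have eq: "\<Phi> v (a c u) = \<Psi> u (b c v)" for c u v using rows cols by metis
  have nda: "\<not> (\<forall>c u. a c u = (c = \<delta>))" for \<delta>
  proof
    assume "\<forall>c u. a c u = (c = \<delta>)"
    then have "g i y = (y j = \<delta>)" for y unfolding a_def by (metis fun_upd_triv)
    with junta2_not_literal[OF big(1)] show False by blast
  qed
  have ndb: "\<not> (\<forall>c u. b c u = (c = \<delta>))" for \<delta>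
  proof
    assume "\<forall>c u. b c u = (c = \<delta>)"
    then have "f j y = (y i = \<delta>)" for y unfolding b_def by (metis fun_upd_triv)
    with junta2_not_literal[OF big(2)] show False by blast
  qed
  from sensitive_cell_dichotomy[OF eq sens nda ndb] show ?thesis
  proof
    assume *: "(\<forall>u. a True u \<noteq> a False u) \<and> (\<forall>v. b True v \<noteq> b False v)"
    have "g i (y(j := \<not> y j)) \<noteq> g i y" for y
    proof -
      have "a (\<not> y j) y \<noteq> a (y j) y" using * by (cases "y j") auto
      then show ?thesis by (simp add: a_def)
    qed
    moreover have "f j (y(i := \<not> y i)) \<noteq> f j y" for y
    proof -
      have "b (\<not> y i) y \<noteq> b (y i) y" using * by (cases "y i") auto
      then show ?thesis by (simp add: b_def)
    qed
    ultimately show ?thesis by (simp add: xor_cell_def flips_def)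
  next
    assume "\<exists>\<kappa> d \<beta>. (\<forall>c u. a c u = d \<longrightarrow> c = \<kappa>) \<and> (\<forall>c v. b c v = \<beta> \<longrightarrow> c = \<kappa>)"
    then obtain \<kappa> d \<beta> where *: "\<And>c u. a c u = d \<Longrightarrow> c = \<kappa>" "\<And>c v. b c v = \<beta> \<Longrightarrow> c = \<kappa>" by blast
    have "g i y = d \<longrightarrow> y j = \<kappa>" for y using *(1)[of "y j" y] unfolding a_def by simp
    moreover have "f j y = \<beta> \<longrightarrow> y i = \<kappa>" for y using *(2)[of "y i" y] unfolding b_def by simp
    ultimately have "and_cell (i, j) \<kappa> d \<beta>"
      by (simp add: and_cell_def forces_def)
    then show ?thesis by blast
  qed
qed

lemma xor_cell_unmixed:
  assumes core: "(i, j) \<in> core" and adj: "i = i' \<or> j = j'"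
    and x: "xor_cell (i, j)" and a: "and_cell (i', j') \<kappa> d \<beta>"
  shows False
proof -
  have x': "flips (g i) j" "flips (f j) i" using x by (simp_all add: xor_cell_def)
  have a': "forces (g i') d j' \<kappa>" "forces (f j') \<beta> i' \<kappa>" using a by (simp_all add: and_cell_def)
  show False
    using adj flips_not_forces[OF coreD(6)[OF core] x'(1)] flips_not_forces[OF coreD(7)[OF core] x'(2)]
      a' by metis
qed

text \<open>The dichotomy supplies separate parameters for each cell. By
  \<open>forces_value_unique\<close> the forcing value of \<open>g i\<close> is the same for all its
  AND cells, and likewise for \<open>f j\<close>, so one cell chosen by \<open>SOME\<close> in each
  row or column represents them all.\<close>

lemma and_cell_parameters:
  "\<exists>\<kappa> d \<beta>. \<forall>i j. (i, j) \<in> core \<longrightarrow> \<not> xor_cell (i, j) \<longrightarrow>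
    and_cell (i, j) (\<kappa> i j) (d i) (\<beta> j)"
proof -
  define C where "C = {(i, j) \<in> core. \<not> xor_cell (i, j)}"
  have "\<forall>e. \<exists>\<kappa> d \<beta>. e \<in> C \<longrightarrow> and_cell e \<kappa> d \<beta>"
    using core_cell_dichotomy unfolding C_def 
    by (metis (no_types, lifting) case_prod_unfold mem_Collect_eq prod.collapse)
  then obtain \<kappa> d \<beta> where *: "\<And>e. e \<in> C \<Longrightarrow> and_cell e (\<kappa> e) (d e) (\<beta> e)" by metis
  define d' where "d' i = d (i, SOME j. (i, j) \<in> C)" for i
  define \<beta>' where "\<beta>' j = \<beta> (SOME i. (i, j) \<in> C, j)" for j
  have "d' i = d (i, j)" if c: "(i, j) \<in> C" for i j
  proof -
    obtain j' where j': "(i, j') \<in> C" "d' i = d (i, j')"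
      unfolding d'_def using someI[of "\<lambda>j. (i, j) \<in> C", OF c] by blast
    have "junta2 (g i)" using c by (simp add: C_def core_def)
    then show ?thesis
      unfolding j'(2) using *[OF c] *[OF j'(1)] by (auto simp: and_cell_def dest: forces_value_unique)
  qed
  moreover have "\<beta>' j = \<beta> (i, j)" if c: "(i, j) \<in> C" for i j
  proof -
    obtain i' where i': "(i', j) \<in> C" "\<beta>' j = \<beta> (i', j)"
      unfolding \<beta>'_def using someI[of "\<lambda>i. (i, j) \<in> C", OF c] by blast
    have "junta2 (f j)" using c by (simp add: C_def core_def)
    then show ?thesis
      unfolding i'(2) using *[OF c] *[OF i'(1)] by (auto simp: and_cell_def dest: forces_value_unique)
  qed
  ultimately have "and_cell (i, j) (\<kappa> (i, j)) (d' i) (\<beta>' j)"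
    if "(i, j) \<in> core" "\<not> xor_cell (i, j)" for i j
    using *[of "(i, j)"] that by (simp add: C_def)
  then show ?thesis
    by (intro exI[of _ "\<lambda>i j. \<kappa> (i, j)"] exI[of _ d'] exI[of _ \<beta>'] allI impI)
qed

end

section \<open>Blocks of cells\<close>

context bool_system
begin

text \<open>Each cell is linked to itself, so already \<open>link\<^sup>+\<close> is reflexive on
  \<open>cells\<close>.\<close>

definition link :: "(('a \<times> 'b) \<times> ('a \<times> 'b)) set" where
  "link = {(e, e'). e \<in> cells \<and> e' \<in> cells \<and> (fst e = fst e' \<or> snd e = snd e')}"

definition core_link :: "(('a \<times> 'b) \<times> ('a \<times> 'b)) set" where
  "core_link = link \<inter> core \<times> core"

definition blocks :: "('a \<times> 'b) set set" where
  "blocks = cells // link\<^sup>+"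

lemma equiv_link: "equiv cells (link\<^sup>+)"
proof (rule equivI)
  show sub: "link\<^sup>+ \<subseteq> cells \<times> cells"
    using trancl_subset_Sigma[of link cells] unfolding link_def by auto
  show "refl_on cells (link\<^sup>+)"
    by (rule refl_onI) (auto simp: link_def intro!: r_into_trancl)
  show "sym (link\<^sup>+)" by (rule sym_trancl) (auto simp: sym_def link_def)
qed simp

lemma block_subset: "W \<in> blocks \<Longrightarrow> W \<subseteq> cells"
  unfolding blocks_def using in_quotient_imp_subset[OF equiv_link] by blast

lemma block_nonempty: "W \<in> blocks \<Longrightarrow> W \<noteq> {}"
  unfolding blocks_def using in_quotient_imp_non_empty[OF equiv_link] by blast

lemma finite_block: "W \<in> blocks \<Longrightarrow> finite W"
  using block_subset finite_cells finite_subset by blast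

lemma block_closed:
  assumes W: "W \<in> blocks" and e: "e \<in> W" "e' \<in> cells" "fst e = fst e' \<or> snd e = snd e'"
  shows "e' \<in> W"
proof -
  have "(e, e') \<in> link\<^sup>+"
    using e block_subset[OF W] by (intro r_into_trancl) (auto simp: link_def)
  with W e(1) show ?thesis
    unfolding blocks_def using in_quotient_imp_closed[OF equiv_link] by blast
qed

lemma block_connected: "W \<in> blocks \<Longrightarrow> e \<in> W \<Longrightarrow> e' \<in> W \<Longrightarrow> (e, e') \<in> link\<^sup>*"
  unfolding blocks_def using in_quotient_imp_in_rel[OF equiv_link, of W e e'] trancl_into_rtrancl by auto

lemma finite_blocks: "finite blocks"
  unfolding blocks_def by (rule finite_quotient[OF finite_cells]) (use equiv_link in \<open>auto simp: equiv_def refl_on_def\<close>)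

lemma Union_blocks: "\<Union>blocks = cells"
  unfolding blocks_def by (rule Union_quotient[OF equiv_link])

lemma blocks_eq_if_adjacent:
  assumes "W \<in> blocks" "W' \<in> blocks" "e \<in> W" "e' \<in> W'" "fst e = fst e' \<or> snd e = snd e'"
  shows "W = W'"
proof -
  have "e' \<in> W" using block_closed assms block_subset by blast
  then show ?thesis
    using quotient_disj[OF equiv_link, of W W'] assms unfolding blocks_def by blast
qed

text \<open>One of the two functions through such a cell has just this one relevant coordinate. The
  cell is therefore a leaf: all its neighbours lie on one line.\<close>

lemma noncore_cell_unique:
  assumes "e \<in> cells" "e \<notin> core"
  shows "(\<forall>e'\<in>cells. fst e' = fst e \<longrightarrow> e' = e) \<or> (\<forall>e'\<in>cells. snd e' = snd e \<longrightarrow> e' = e)"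
proof -
  obtain i j where e: "e = (i, j)" by fastforce
  have ij: "j \<in> bdep (g i)" "i \<in> bdep (f j)" using assms(1) dep_transfer[of i j] by (auto simp: e cells_def)
  consider "\<not> junta2 (g i)" | "\<not> junta2 (f j)" using assms by (auto simp: e core_def)
  then show ?thesis
  proof cases
    case 1
    then have "\<forall>e'\<in>cells. fst e' = fst e \<longrightarrow> e' = e"
      using not_junta2_unique[OF 1 ij(1)] by (auto simp: cells_def e)
    then show ?thesis ..
  next
    case 2
    then have "\<forall>e'\<in>cells. snd e' = snd e \<longrightarrow> e' = e"
      using not_junta2_unique[OF 2 ij(2)] by (auto simp: cells_col e)
    then show ?thesis ..
  qed
qed

text \<open>A path through leaves can be rerouted inside the core. The endpoint \<open>e\<close> may
  itself be a leaf, so the induction carries a statement about the core cells on its two lines: some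
  such cell is reached, and all of them are.\<close>

lemma core_connected:
  assumes e0: "e0 \<in> core" and "(e0, e) \<in> link\<^sup>*"
  shows "(\<exists>e'\<in>core. (e0, e') \<in> core_link\<^sup>* \<and> (fst e' = fst e \<or> snd e' = snd e)) \<and>
    (\<forall>e'\<in>core. fst e' = fst e \<or> snd e' = snd e \<longrightarrow> (e0, e') \<in> core_link\<^sup>*)"
  using assms(2)
proof induction
  case base
  have "(e0, e') \<in> core_link" if "e' \<in> core" "fst e' = fst e0 \<or> snd e' = snd e0" for e'
    using that e0 by (auto simp: core_link_def link_def core_def)
  then show ?case using e0 by blast
next
  case (step e1 e2)
  have cells: "e1 \<in> cells" "e2 \<in> cells" and adj: "fst e1 = fst e2 \<or> snd e1 = snd e2"
    using step.hyps(2) by (auto simp: link_def)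
  show ?case
  proof (cases "e2 \<in> core")
    case True
    then have r: "(e0, e2) \<in> core_link\<^sup>*" using step.IH adj by metis
    have "(e0, e') \<in> core_link\<^sup>*" if "e' \<in> core" "fst e' = fst e2 \<or> snd e' = snd e2" for e'
    proof -
      have "(e2, e') \<in> core_link"
        using that True by (auto simp: core_link_def link_def core_def)
      with r show ?thesis by simp
    qed
    with True r show ?thesis by blast
  next
    case False
    have core_cells: "e' \<in> core \<Longrightarrow> e' \<in> cells" for e' by (auto simp: core_def)
    have nb: "(\<forall>e'\<in>cells. fst e' = fst e2 \<longrightarrow> e' = e2) \<or> (\<forall>e'\<in>cells. snd e' = snd e2 \<longrightarrow> e' = e2)"
      using noncore_cell_unique[OF cells(2) False] .
    \<comment> \<open>If \<open>e1\<close> differs from \<open>e2\<close>, then the line they share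
      is the one on which \<open>e2\<close> is not alone. Every core neighbour of \<open>e2\<close>
      lies on that line too and so is a neighbour of \<open>e1\<close>.\<close>
    have 2: "(e0, e') \<in> core_link\<^sup>*" if "e' \<in> core" "fst e' = fst e2 \<or> snd e' = snd e2" for e'
    proof -
      have "fst e' = fst e1 \<or> snd e' = snd e1"
        using nb adj that core_cells[OF that(1)] cells False by metis
      with step.IH that show ?thesis by blast
    qed
    have 1: "\<exists>e'\<in>core. (e0, e') \<in> core_link\<^sup>* \<and> (fst e' = fst e2 \<or> snd e' = snd e2)"
    proof (cases "e1 \<in> core")
      case True
      then show ?thesis using 2 adj by metis
    next
      \<comment> \<open>Both cells are leaves. If they are distinct, each is alone on its line
        across the shared one, so the core neighbour of \<open>e1\<close> lies on the shared
        line.\<close>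
      case F1: False
      obtain e' where e': "e' \<in> core" "(e0, e') \<in> core_link\<^sup>*" "fst e' = fst e1 \<or> snd e' = snd e1"
        using step.IH by blast
      have "fst e' = fst e2 \<or> snd e' = snd e2"
        using nb adj e' noncore_cell_unique[OF cells(1) F1] cells core_cells[OF e'(1)] False F1
        by metis
      with e' show ?thesis by blast
    qed
    from 1 2 show ?thesis by blast
  qed
qed

lemma core_block_connected:
  assumes "W \<in> blocks" "e0 \<in> W" "e0 \<in> core" "e \<in> W" "e \<in> core"
  shows "(e0, e) \<in> core_link\<^sup>*"
  using core_connected[OF assms(3) block_connected[OF assms(1,2,4)]] assms(5) by blast

lemma core_neighbour:
  assumes "W \<in> blocks" "e0 \<in> W" "e0 \<in> core" "e \<in> W"
  shows "\<exists>e'\<in>core \<inter> W. fst e' = fst e \<or> snd e' = snd e"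
proof -
  obtain e' where e': "e' \<in> core" "fst e' = fst e \<or> snd e' = snd e"
    using core_connected[OF assms(3) block_connected[OF assms(1,2,4)]] by blast
  then have "e' \<in> W"
    using block_closed[OF assms(1,4), of e'] by (auto simp: core_def)
  with e' show ?thesis by blast
qed

text \<open>If the core cell found nearby lies in column \<open>j\<close> instead, then
  \<open>f j\<close> satisfies \<open>junta2\<close>, and \<open>(i, j)\<close> is itself a core
  cell.\<close>

lemma core_row_neighbour:
  assumes W: "W \<in> blocks" "e0 \<in> W" "e0 \<in> core" and e: "(i, j) \<in> W" "junta2 (g i)"
  shows "\<exists>j'. (i, j') \<in> core \<inter> W"
proof -
  obtain e' where e': "e' \<in> core \<inter> W" "fst e' = i \<or> snd e' = j"
    using core_neighbour[OF W e(1)] by auto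
  show ?thesis
  proof (cases "fst e' = i")
    case True
    with e' show ?thesis by (cases e') auto
  next
    case False
    with e' have "snd e' = j" by auto
    then have "junta2 (f j)" using e' by (auto simp: core_def)
    then have "(i, j) \<in> core" using e block_subset[OF W(1)] by (auto simp: core_def)
    with e show ?thesis by blast
  qed
qed

lemma core_col_neighbour:
  assumes W: "W \<in> blocks" "e0 \<in> W" "e0 \<in> core" and e: "(i, j) \<in> W" "junta2 (f j)"
  shows "\<exists>i'. (i', j) \<in> core \<inter> W"
proof -
  obtain e' where e': "e' \<in> core \<inter> W" "fst e' = i \<or> snd e' = j"
    using core_neighbour[OF W e(1)] by auto
  show ?thesis
  proof (cases "snd e' = j")
    case True
    with e' show ?thesis by (cases e') auto
  next
    case False
    with e' have "fst e' = i" by auto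
    then have "junta2 (g i)" using e' by (auto simp: core_def)
    then have "(i, j) \<in> core" using e block_subset[OF W(1)] by (auto simp: core_def)
    with e show ?thesis by blast
  qed
qed

lemma core_block_uniform:
  assumes W: "W \<in> blocks" and e: "e \<in> W \<inter> core" "e' \<in> W \<inter> core" and x: "xor_cell e"
  shows "xor_cell e'"
proof -
  have "(e, e') \<in> core_link\<^sup>*" using core_block_connected[OF W] e by blast
  then show ?thesis
  proof induction
    case base
    show ?case by (rule x)
  next
    case (step e1 e2)
    obtain i j i' j' where [simp]: "e1 = (i, j)" "e2 = (i', j')" by fastforce
    have "(i, j) \<in> core" "(i', j') \<in> core" "i = i' \<or> j = j'"
      using step.hyps(2) by (auto simp: core_link_def link_def)
    then show ?case
      using core_cell_dichotomy[of i' j'] xor_cell_unmixed[of i j i' j'] step.IH by auto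
  qed
qed

text \<open>
  Flipping two linked core cells preserves all row values or all column values; this is why
  only the parity of the core cells matters to the output.
\<close>

lemma xor_block_outp:
  fixes \<pi> :: "('a \<times> 'b \<Rightarrow> bool) \<Rightarrow> 'c"
  assumes W: "W \<in> blocks" and e0: "e0 \<in> W \<inter> core"
    and xor: "\<And>e. e \<in> W \<inter> core \<Longrightarrow> xor_cell e"
    and prow: "\<And>z z'. row_value z = row_value z' \<Longrightarrow> \<pi> z = \<pi> z'"
    and pcol: "\<And>z z'. col_value z = col_value z' \<Longrightarrow> \<pi> z = \<pi> z'"
    and pflip: "\<And>z. \<pi> (z(e0 := \<not> z e0)) \<noteq> \<pi> z"
    and agree: "\<And>e. e \<notin> W \<Longrightarrow> z' e = z e" and eq: "\<pi> z' = \<pi> z"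
  shows "outp z' = outp z"
proof -
  define flip where "flip z e = z(e := \<not> z e)" for z :: "'a \<times> 'b \<Rightarrow> bool" and e
  \<comment> \<open>Output and block function are tracked together: both are computable from the row
    values and also from the column values, so a move that keeps either family keeps both.\<close>
  define sim where "sim z z' \<longleftrightarrow> outp z = outp z' \<and> \<pi> z = \<pi> z'" for z z'
  have sim_trans: "sim z1 z2 \<Longrightarrow> sim z2 z3 \<Longrightarrow> sim z1 z3" for z1 z2 z3 by (simp add: sim_def)
  have sim_row: "sim z1 z2" if r: "row_value z1 = row_value z2" for z1 z2
    using prow[OF r] unfolding sim_def outp_def r by simp
  have sim_col: "sim z1 z2" if r: "col_value z1 = col_value z2" for z1 z2
    using pcol[OF r] unfolding sim_def outp_col r by simp
  have row_other: "row_value (flip z e) i = row_value z i" if "i \<noteq> fst e" for z e i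
    using that row_value_upd[of i "fst e" z "snd e"] by (simp add: flip_def)
  have col_other: "col_value (flip z e) j = col_value z j" if "j \<noteq> snd e" for z e j
    using that col_value_upd[of j "snd e" z "fst e"] by (simp add: flip_def)
  have row_core: "row_value (flip z e) (fst e) = (\<not> row_value z (fst e))"
    "col_value (flip z e) (snd e) = (\<not> col_value z (snd e))" if "e \<in> W \<inter> core" for z e
  proof -
    obtain i j where e: "e = (i, j)" by fastforce
    have "flips (g i) j" "flips (f j) i" using xor[OF that] by (simp_all add: e xor_cell_def)
    then show "row_value (flip z e) (fst e) = (\<not> row_value z (fst e))"
      "col_value (flip z e) (snd e) = (\<not> col_value z (snd e))"
      using flipsD[of "g i" j "\<lambda>j. z (i, j)"] flipsD[of "f j" i "\<lambda>i. z (i, j)"]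
      by (simp_all add: e flip_def row_value_upd_same col_value_upd_same)
        (simp_all add: row_value_def col_value_def)
  qed
  have same_row: "sim (flip z e) (flip z e')"
    if "fst e = fst e'" "row_value (flip z e) (fst e) = row_value (flip z e') (fst e)" for z e e'
  proof (rule sim_row, rule ext)
    fix i show "row_value (flip z e) i = row_value (flip z e') i"
      using that row_other[of i e z] row_other[of i e' z] by (cases "i = fst e") auto
  qed
  have same_col: "sim (flip z e) (flip z e')"
    if "snd e = snd e'" "col_value (flip z e) (snd e) = col_value (flip z e') (snd e)" for z e e'
  proof (rule sim_col, rule ext)
    fix i show "col_value (flip z e) i = col_value (flip z e') i"
      using that col_other[of i e z] col_other[of i e' z] by (cases "i = snd e") auto
  qed
  have core: "sim (flip z e) (flip z e0)" if "e \<in> W \<inter> core" for e z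
  proof -
    have "(e, e0) \<in> core_link\<^sup>*" using core_block_connected[OF W] that e0 by blast
    then have "e0 \<in> W \<and> sim (flip z e) (flip z e0)"
    proof induction
      case base
      then show ?case using that by (simp add: sim_def)
    next
      case (step e1 e2)
      have c: "e1 \<in> core" "e2 \<in> core" "fst e1 = fst e2 \<or> snd e1 = snd e2"
        using step.hyps(2) by (auto simp: core_link_def link_def)
      have W12: "e1 \<in> W" "e2 \<in> W"
        using step.IH block_closed[OF W _ _ c(3)] c(2) by (auto simp: core_def)
      have "sim (flip z e1) (flip z e2)"
        using c(3)
      proof
        assume "fst e1 = fst e2"
        then show ?thesis using row_core(1)[of e1 z] row_core(1)[of e2 z] W12 c
          by (intro same_row) auto
      next
        assume "snd e1 = snd e2"
        then show ?thesis using row_core(2)[of e1 z] row_core(2)[of e2 z] W12 c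
          by (intro same_col) auto
      qed
      with W12 step.IH show ?case using sim_trans by blast
    qed
    then show ?thesis ..
  qed
  \<comment> \<open>A flip anywhere in the block shares a line with some core cell. On that line it
    either leaves the value alone or changes it exactly as the core flip does.\<close>
  have single: "sim (flip z e) z \<or> sim (flip z e) (flip z e0)" if eW: "e \<in> W" for e z
  proof -
    obtain e' where e': "e' \<in> core \<inter> W" "fst e' = fst e \<or> snd e' = snd e"
      using core_neighbour[OF W _ _ eW, of e0] e0 by auto
    have c: "sim (flip z e') (flip z e0)" using core e' by auto
    from e'(2) show ?thesis
    proof
      assume f: "fst e' = fst e"
      show ?thesis
      proof (cases "row_value (flip z e) (fst e) = row_value z (fst e)")
        case True
        then have "row_value (flip z e) = row_value z" using row_other unfolding fun_eq_iff by metis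
        then show ?thesis using sim_row by blast
      next
        case False
        then have "sim (flip z e) (flip z e')"
          using row_core(1)[of e' z] e' f by (intro same_row) auto
        then show ?thesis using c sim_trans by blast
      qed
    next
      assume f: "snd e' = snd e"
      show ?thesis
      proof (cases "col_value (flip z e) (snd e) = col_value z (snd e)")
        case True
        then have "col_value (flip z e) = col_value z" using col_other unfolding fun_eq_iff by metis
        then show ?thesis using sim_col by blast
      next
        case False
        then have "sim (flip z e) (flip z e')"
          using row_core(2)[of e' z] e' f by (intro same_col) auto
        then show ?thesis using c sim_trans by blast
      qed
    qed
  qed
  define flips_on where "flips_on z S = (\<lambda>e. if e \<in> S then \<not> z e else z e)"
    for z :: "'a \<times> 'b \<Rightarrow> bool" and S
  \<comment> \<open>Two flips of \<open>e0\<close> cancel, so any set of flips in the block reduces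
    to none or to the one at \<open>e0\<close>.\<close>
  have many: "sim (flips_on z S) z \<or> sim (flips_on z S) (flip z e0)" if "finite S" "S \<subseteq> W" for S z
    using that
  proof (induction arbitrary: z)
    case empty
    then show ?case by (simp add: flips_on_def sim_def)
  next
    case (insert e S)
    have eq: "flips_on z (insert e S) = flips_on (flip z e) S"
      using insert.hyps by (auto simp: flips_on_def flip_def fun_eq_iff)
    have e0': "flip (flip z e) e0 = flip (flip z e0) e" "flip (flip z e0) e0 = z"
      by (auto simp: flip_def fun_eq_iff)
    have "sim (flips_on (flip z e) S) (flip z e) \<or> sim (flips_on (flip z e) S) (flip (flip z e) e0)"
      using insert by blast
    moreover have "sim (flip z e) z \<or> sim (flip z e) (flip z e0)"
      using single insert.prems by blast
    moreover have "sim (flip (flip z e0) e) (flip z e0) \<or> sim (flip (flip z e0) e) z"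
      using single[of e "flip z e0"] insert.prems unfolding e0'(2) by blast
    ultimately show ?case unfolding eq e0'(1) using sim_trans by blast
  qed
  define S where "S = {e \<in> W. z' e \<noteq> z e}"
  have "z' = flips_on z S" using agree by (auto simp: flips_on_def S_def fun_eq_iff)
  moreover have "finite S" "S \<subseteq> W" using finite_block[OF W] by (auto simp: S_def)
  ultimately have "sim z' z \<or> sim z' (flip z e0)" using many by blast
  \<comment> \<open>The flip at \<open>e0\<close> would change \<open>\<pi>\<close>, which
    contradicts \<open>eq\<close>; so only the trivial alternative is left.\<close>
  then show ?thesis using pflip[of z] eq by (auto simp: sim_def flip_def)
qed

text \<open>
  Once a row has a core cell different from the forced value \<open>\<kappa>\<close>, its other cells can be changed
  without changing the output; propagating this along the block leads to one canonical
  configuration, in which every core cell differs from its forced value.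
\<close>

lemma and_block_outp:
  fixes W \<kappa> d \<beta>
  defines "P \<equiv> \<lambda>z. \<forall>(i, j)\<in>W. (junta2 (g i) \<longrightarrow> row_value z i = d i) \<and> (junta2 (f j) \<longrightarrow> col_value z j = \<beta> j)"
  assumes W: "W \<in> blocks" and e0: "e0 \<in> W \<inter> core"
    and "and": "\<And>i j. (i, j) \<in> W \<inter> core \<Longrightarrow> and_cell (i, j) (\<kappa> i j) (d i) (\<beta> j)"
    and agree: "\<And>e. e \<notin> W \<Longrightarrow> z' e = z e" and eq: "P z' = P z"
  shows "outp z' = outp z"
proof -
  \<comment> \<open>At a core cell this is the bit that rules out the forcing value on both of its
    lines. \<open>True\<close> at the other cells merely fixes one common target.\<close>
  define can where "can e = (if e \<in> core then \<not> \<kappa> (fst e) (snd e) else True)" for e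
  have row_ne: "row_value z (fst e) \<noteq> d (fst e)" and col_ne: "col_value z (snd e) \<noteq> \<beta> (snd e)"
    if "e \<in> W \<inter> core" "z e = can e" for z e
  proof -
    obtain i j where e: "e = (i, j)" by fastforce
    have "forces (g i) (d i) j (\<kappa> i j)" "forces (f j) (\<beta> j) i (\<kappa> i j)"
      using "and"[of i j] that by (simp_all add: e and_cell_def)
    then show "row_value z (fst e) \<noteq> d (fst e)" "col_value z (snd e) \<noteq> \<beta> (snd e)"
      using forcesD[of "g i" "d i" j "\<kappa> i j" "\<lambda>j. z (i, j)"]
        forcesD[of "f j" "\<beta> j" i "\<kappa> i j" "\<lambda>i. z (i, j)"] that
      by (auto simp: e row_value_def col_value_def can_def)
  qed
  have row_other: "row_value (z(e := t)) i = row_value z i" if "i \<noteq> fst e" for z e i t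
    using that row_value_upd[of i "fst e" z "snd e"] by simp
  have col_other: "col_value (z(e := t)) j = col_value z j" if "j \<noteq> snd e" for z e j t
    using that col_value_upd[of j "snd e" z "fst e"] by simp
  have adj: "outp (z(e' := can e')) = outp z"
    if e: "e \<in> W \<inter> core" "z e = can e" and a: "fst e = fst e' \<or> snd e = snd e'" for z e e'
  proof -
    have e2: "(z(e' := can e')) e = can e" using e by simp
    from a show ?thesis
    proof
      assume f: "fst e = fst e'"
      have "row_value (z(e' := can e')) = row_value z"
      proof
        fix i show "row_value (z(e' := can e')) i = row_value z i"
          using row_ne[of e z] row_ne[of e "z(e' := can e')"] e e2 row_other[of i e' z] f by (cases "i = fst e") auto
      qed
      then show ?thesis by (simp add: outp_def)
    next
      assume f: "snd e = snd e'"
      have "col_value (z(e' := can e')) = col_value z"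
      proof
        fix i show "col_value (z(e' := can e')) i = col_value z i"
          using col_ne[of e z] col_ne[of e "z(e' := can e')"] e e2 col_other[of i e' z] f by (cases "i = snd e") auto
      qed
      then show ?thesis by (simp add: outp_col)
    qed
  qed
  define canon where "canon z = (\<lambda>e. if e \<in> W then can e else z e)" for z
  have canon: "outp (canon z) = outp z" if e1: "e1 \<in> W \<inter> core" "z e1 = can e1" for e1 z
  proof -
    \<comment> \<open>Quantified over all configurations that are canonical at \<open>e1\<close>, so
      that further cells may be changed before and after. Writing a canonical value keeps this
      condition even when the cell written is \<open>e1\<close>.\<close>
    define R where "R e \<longleftrightarrow> (\<forall>z. z e1 = can e1 \<longrightarrow> outp (z(e := can e)) = outp z)" for e
    have R_step: "R e'" if R: "R e" and e: "e \<in> W \<inter> core" and a: "fst e = fst e' \<or> snd e = snd e'" for e e'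
      unfolding R_def
    proof (intro allI impI)
      fix z assume z: "z e1 = can e1"
      \<comment> \<open>The cell \<open>e\<close> is made canonical first, which is free by
        \<open>R e\<close>; this stops the shared line from reacting to \<open>e'\<close>.
        Afterwards the change at \<open>e\<close> is undone.\<close>
      have "outp (z(e' := can e')) = outp (z(e' := can e', e := can e))"
        using R z by (auto simp: R_def)
      also have "z(e' := can e', e := can e) = z(e := can e, e' := can e')" by (simp add: fun_eq_iff)
      also have "outp \<dots> = outp (z(e := can e))" using adj[OF e _ a] by simp
      also have "\<dots> = outp z" using R z by (auto simp: R_def)
      finally show "outp (z(e' := can e')) = outp z" .
    qed
    have R_core: "R e" if "e \<in> W \<inter> core" for e
    proof -
      have "(e1, e) \<in> core_link\<^sup>*" using core_block_connected[OF W] that e1 by blast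
      then have "e \<in> W \<and> e \<in> core \<and> R e"
      proof induction
        case base
        have "z(e1 := can e1) = z" if "z e1 = can e1" for z
          using that by (rule fun_upd_idem)
        then show ?case using e1 by (simp add: R_def)
      next
        case (step e e')
        have c: "e' \<in> core" "fst e = fst e' \<or> snd e = snd e'"
          using step.hyps(2) by (auto simp: core_link_def link_def)
        then have "e' \<in> W" using step.IH block_closed[OF W _ _ c(2)] by (auto simp: core_def)
        with c step.IH R_step show ?case by blast
      qed
      then show ?thesis by blast
    qed
    have R_all: "R e" if e: "e \<in> W" for e
    proof -
      obtain e' where "e' \<in> core \<inter> W" "fst e' = fst e \<or> snd e' = snd e"
        using core_neighbour[OF W _ _ e, of e0] e0 by auto
      then show ?thesis using R_step[of e' e] R_core by blast
    qed
    have "outp (\<lambda>e. if e \<in> S then can e else z e) = outp z" if "finite S" "S \<subseteq> W" for S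
      using that
    proof induction
      case (insert e S)
      let ?z = "\<lambda>e. if e \<in> S then can e else z e"
      have "(\<lambda>e'. if e' \<in> insert e S then can e' else z e') = ?z(e := can e)" by (simp add: fun_eq_iff)
      moreover have "outp (?z(e := can e)) = outp ?z"
        using R_all[of e] insert.prems e1(2) unfolding R_def by simp
      ultimately show ?case using insert by simp
    qed simp
    from this[OF finite_block[OF W]] show ?thesis by (simp add: canon_def)
  qed
  have canon_if_not_P: "outp (canon z) = outp z" if nP: "\<not> P z" for z
  proof -
    obtain i j where ij: "(i, j) \<in> W"
      and cases: "junta2 (g i) \<and> row_value z i \<noteq> d i \<or> junta2 (f j) \<and> col_value z j \<noteq> \<beta> j"
      using nP unfolding P_def by blast
    have upd: "canon (z(e := t)) = canon z" if "e \<in> W" for e t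
      using that by (auto simp: canon_def fun_eq_iff)
    \<comment> \<open>The line already misses its forcing value. Making one of its core cells
      canonical keeps it off that value, hence keeps its truth value, and the other lines in the
      same direction do not contain the cell.\<close>
    have "\<exists>e\<in>W \<inter> core. outp (z(e := can e)) = outp z"
      using cases
    proof
      assume r: "junta2 (g i) \<and> row_value z i \<noteq> d i"
      obtain j' where j': "(i, j') \<in> core \<inter> W" using core_row_neighbour[OF W _ _ ij] e0 r by blast
      have "row_value (z((i, j') := can (i, j'))) = row_value z"
      proof
        fix k show "row_value (z((i, j') := can (i, j'))) k = row_value z k"
          using row_ne[of "(i, j')" "z((i, j') := can (i, j'))"] j' r row_other[of k "(i, j')" z]
          by (cases "k = i") auto
      qed
      then show ?thesis using j' by (intro bexI[of _ "(i, j')"]) (auto simp: outp_def)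
    next
      assume r: "junta2 (f j) \<and> col_value z j \<noteq> \<beta> j"
      obtain i' where i': "(i', j) \<in> core \<inter> W" using core_col_neighbour[OF W _ _ ij] e0 r by blast
      have "col_value (z((i', j) := can (i', j))) = col_value z"
      proof
        fix k show "col_value (z((i', j) := can (i', j))) k = col_value z k"
          using col_ne[of "(i', j)" "z((i', j) := can (i', j))"] i' r col_other[of k "(i', j)" z]
          by (cases "k = j") auto
      qed
      then show ?thesis using i' by (intro bexI[of _ "(i', j)"]) (auto simp: outp_col)
    qed
    then obtain e where e: "e \<in> W \<inter> core" "outp (z(e := can e)) = outp z" by blast
    then show ?thesis using canon[OF e(1), of "z(e := can e)"] upd[of e] by simp
  qed
  show ?thesis
  proof (cases "P z")
    case False
    moreover have "canon z' = canon z" using agree by (auto simp: canon_def fun_eq_iff)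
    ultimately show ?thesis using canon_if_not_P[of z] canon_if_not_P[of z'] eq by simp
  next
    case True
    then have P: "P z" "P z'" using eq by simp_all
    have core_val: "z (i, j) = \<kappa> i j" if "P z" "(i, j) \<in> W \<inter> core" for z i j
    proof -
      have "forces (g i) (d i) j (\<kappa> i j)" using "and"[OF that(2)] by (simp add: and_cell_def)
      moreover have "row_value z i = d i" using that unfolding P_def core_def by blast
      ultimately show ?thesis
        using forcesD[of "g i" "d i" j "\<kappa> i j" "\<lambda>j. z (i, j)"] by (simp add: row_value_def)
    qed
    \<comment> \<open>A hybrid compared with \<open>z'\<close> by rows and with \<open>z\<close> by
      columns. Rows with \<open>junta2\<close> that meet the block have the value \<open>d i\<close>
      in both configurations. In a column with \<open>junta2\<close> the core cells all carry their
      forced bit, so \<open>w\<close> agrees there with \<open>z'\<close>, whose column value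
      \<open>\<beta> j\<close> is also that of \<open>z\<close>. Any other column in the block reads
      cells only of rows with \<open>junta2\<close>, where \<open>w\<close> is
      \<open>z\<close>.\<close>
    define w where "w = (\<lambda>(i, j). if junta2 (g i) then z (i, j) else z' (i, j))"
    have "outp w = outp z'"
    proof (rule outp_eq_if_rows)
      fix i
      show "row_value w i = row_value z' i"
      proof (cases "junta2 (g i)")
        case False
        then show ?thesis by (simp add: row_value_def w_def)
      next
        case big: True
        then have w: "row_value w i = row_value z i" by (simp add: row_value_def w_def)
        show ?thesis
        proof (cases "\<exists>j. (i, j) \<in> W")
          case True
          then have "row_value z i = d i" "row_value z' i = d i" using P big unfolding P_def by blast+
          with w show ?thesis by simp
        next
          case False
          then show ?thesis using w agree by (simp add: row_value_def)
        qed
      qed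
    qed
    moreover have "outp w = outp z"
    proof (rule outp_eq_if_cols)
      fix j assume j: "j \<in> bdep G"
      show "col_value w j = col_value z j"
      proof (cases "\<exists>i. (i, j) \<in> W")
        case False
        then have "w (i, j) = z (i, j)" for i using agree by (auto simp: w_def)
        then show ?thesis by (simp add: col_value_def)
      next
        case True
        then obtain i0 where i0: "(i0, j) \<in> W" by blast
        have inW: "(i, j) \<in> W" if "i \<in> bdep (f j)" for i
          using block_closed[OF W i0, of "(i, j)"] that j by (auto simp: cells_col)
        show ?thesis
        proof (cases "junta2 (f j)")
          case big: True
          have "col_value w j = col_value z' j"
            unfolding col_value_def
          proof (rule eq_if_agree_on_bdep[OF fsupp_f])
            fix i assume "i \<in> bdep (f j)"
            then have i: "(i, j) \<in> W" by (rule inW)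
            show "w (i, j) = z' (i, j)"
            proof (cases "junta2 (g i)")
              case True
              then have "(i, j) \<in> W \<inter> core" using i big block_subset[OF W] by (auto simp: core_def)
              then show ?thesis using core_val[OF P(1)] core_val[OF P(2)] by (simp add: w_def)
            qed (simp add: w_def)
          qed
          moreover have "col_value z' j = \<beta> j" "col_value z j = \<beta> j"
            using P i0 big unfolding P_def by blast+
          ultimately show ?thesis by simp
        next
          case small: False
          show ?thesis
            unfolding col_value_def
          proof (rule eq_if_agree_on_bdep[OF fsupp_f])
            fix i assume i: "i \<in> bdep (f j)"
            have "junta2 (g i)"
            proof -
              obtain e' where "e' \<in> core \<inter> W" "fst e' = i \<or> snd e' = j"
                using core_neighbour[OF W _ _ inW[OF i], of e0] e0 by auto
              then show ?thesis using small by (auto simp: core_def)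
            qed
            then show "w (i, j) = z (i, j)" by (simp add: w_def)
          qed
        qed
      qed
    qed
    ultimately show ?thesis by simp
  qed
qed

end

section \<open>Passage between signs and truth values\<close>

definition sign_of :: "bool \<Rightarrow> real" where
  "sign_of t = (if t then 1 else -1)"

definition point :: "'a set \<Rightarrow> ('a \<Rightarrow> bool) \<Rightarrow> 'a \<Rightarrow> real" where
  "point A x = (\<lambda>i\<in>A. sign_of (x i))"

definition bool_fun :: "'a set \<Rightarrow> (('a \<Rightarrow> real) \<Rightarrow> real) \<Rightarrow> ('a \<Rightarrow> bool) \<Rightarrow> bool" where
  "bool_fun A u x \<longleftrightarrow> u (point A x) = 1"

lemma sign_of_simps [simp]:
  "sign_of True = 1" "sign_of False = -1" "sign_of t \<in> {-1, 1}" "sign_of t = 1 \<longleftrightarrow> t" "sign_of t = -1 \<longleftrightarrow> \<not> t"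
  "sign_of s = sign_of t \<longleftrightarrow> s = t" "sign_of (\<not> t) = - sign_of t" "sign_of t \<noteq> 0" "sign_of t * sign_of t = 1"
  by (auto simp: sign_of_def)

lemma point_in_cube [simp]: "point A x \<in> cube A"
  by (auto simp: point_def cube_def sign_of_def)

lemma point_apply [simp]: "i \<in> A \<Longrightarrow> point A x i = sign_of (x i)"
  by (simp add: point_def)

lemma cube_values: "x \<in> cube A \<Longrightarrow> i \<in> A \<Longrightarrow> x i = -1 \<or> x i = 1"
  by (auto simp: cube_def PiE_iff)

lemma cube_point: "x \<in> cube A \<Longrightarrow> x = point A (\<lambda>i. x i = 1)"
  by (rule ext) (auto simp: cube_def PiE_iff extensional_def point_def sign_of_def)

lemma cubeE:
  assumes "x \<in> cube A" obtains x' where "x = point A x'"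
  using cube_point[OF assms] by blast

lemma point_cong: "(\<And>i. i \<in> A \<Longrightarrow> x i = y i) \<Longrightarrow> point A x = point A y"
  by (auto simp: point_def)

lemma point_upd: "i \<in> A \<Longrightarrow> (point A x)(i := - point A x i) = point A (x(i := \<not> x i))"
  by (auto simp: point_def fun_eq_iff)

lemma bool_fun_value:
  assumes "u \<in> cube A \<rightarrow> {-1, 1}" shows "u (point A x) = sign_of (bool_fun A u x)"
  using funcset_mem[OF assms point_in_cube[of A x]] by (auto simp: bool_fun_def sign_of_def)

lemma bool_fun_cong: "(\<And>i. i \<in> A \<Longrightarrow> x i = y i) \<Longrightarrow> bool_fun A u x = bool_fun A u y"
  unfolding bool_fun_def by (simp cong: point_cong)

lemma fsupp_bool_fun: "finite A \<Longrightarrow> fsupp (bool_fun A u)"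
  unfolding fsupp_def by (intro exI[of _ A]) (metis bool_fun_cong)

lemma bdep_bool_fun_subset: "bdep (bool_fun A u) \<subseteq> A"
  by (rule bdep_subset_support) (rule bool_fun_cong)

lemma Dep_eq_bdep:
  assumes u: "u \<in> cube A \<rightarrow> {-1, 1}" shows "Dep A u = bdep (bool_fun A u)"
proof (rule set_eqI)
  fix i
  have 1: "(\<exists>x\<in>cube A. u (x(i := - x i)) \<noteq> u x) \<longleftrightarrow>
      (\<exists>x. bool_fun A u (x(i := \<not> x i)) \<noteq> bool_fun A u x)" if i: "i \<in> A"
  proof -
    have "(\<exists>x\<in>cube A. u (x(i := - x i)) \<noteq> u x) \<longleftrightarrow>
        (\<exists>x. u ((point A x)(i := - point A x i)) \<noteq> u (point A x))"
      by (metis cubeE point_in_cube)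
    also have "\<dots> \<longleftrightarrow> (\<exists>x. bool_fun A u (x(i := \<not> x i)) \<noteq> bool_fun A u x)"
      by (simp only: point_upd[OF i] bool_fun_value[OF u] sign_of_simps)
    finally show ?thesis .
  qed
  show "i \<in> Dep A u \<longleftrightarrow> i \<in> bdep (bool_fun A u)"
    using 1 bdep_bool_fun_subset[of A u] unfolding Dep_def bdep_def by blast
qed

lemma constant_iff_bdep_empty:
  assumes "finite A" and u: "u \<in> cube A \<rightarrow> {-1, 1}"
  shows "u constant_on cube A \<longleftrightarrow> bdep (bool_fun A u) = {}"
proof
  assume "u constant_on cube A"
  then obtain c where "\<And>x. x \<in> cube A \<Longrightarrow> u x = c" by (auto simp: constant_on_def)
  then show "bdep (bool_fun A u) = {}" by (simp add: bdep_def bool_fun_def)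
next
  assume e: "bdep (bool_fun A u) = {}"
  have "u x = sign_of (bool_fun A u (\<lambda>_. True))" if "x \<in> cube A" for x
  proof -
    obtain x' where "x = point A x'" using cubeE[OF \<open>x \<in> cube A\<close>] .
    moreover have "bool_fun A u x' = bool_fun A u (\<lambda>_. True)"
      by (rule eq_if_agree_on_bdep[OF fsupp_bool_fun[OF assms(1)]]) (simp add: e)
    ultimately show ?thesis by (simp add: bool_fun_value[OF u])
  qed
  then show "u constant_on cube A" unfolding constant_on_def by blast
qed

section \<open>Fourier degree and number of relevant coordinates\<close>

lemma card_le_deg:
  assumes "finite A" "S \<subseteq> A" "fourier_coeff A u S \<noteq> 0" shows "card S \<le> deg A u"
proof -
  have "finite {S. S \<subseteq> A \<and> fourier_coeff A u S \<noteq> 0}"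
    using assms(1) by (rule_tac finite_subset[of _ "Pow A"]) auto
  then show ?thesis unfolding deg_def using assms(2,3) by (intro Max_ge) auto
qed

lemma deg_le:
  assumes "finite A" "\<And>S. S \<subseteq> A \<Longrightarrow> fourier_coeff A u S \<noteq> 0 \<Longrightarrow> card S \<le> k"
  shows "deg A u \<le> k"
proof -
  have "finite {S. S \<subseteq> A \<and> fourier_coeff A u S \<noteq> 0}"
    using assms(1) by (rule_tac finite_subset[of _ "Pow A"]) auto
  then show ?thesis unfolding deg_def using assms(2) by (subst Max_le_iff) auto
qed

lemma deg_monomial:
  assumes "finite A" "T \<subseteq> A" "c \<noteq> 0" and u: "\<And>x. x \<in> cube A \<Longrightarrow> u x = c * (\<Prod>i\<in>T. x i)"
  shows "deg A u = card T"
proof -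
  have coeff: "fourier_coeff A u S = (if S = T then c else 0)" if "S \<subseteq> A" for S
  proof -
    define c' where "c' S = (if S = T then c else 0)" for S
    have "u x = (\<Sum>S\<in>Pow A. c' S * (\<Prod>i\<in>S. x i))" if "x \<in> cube A" for x
    proof -
      have "(\<Sum>S\<in>Pow A. c' S * (\<Prod>i\<in>S. x i)) = (\<Sum>S\<in>Pow A. if S = T then c * (\<Prod>i\<in>T. x i) else 0)"
        by (intro sum.cong) (auto simp: c'_def)
      also have "\<dots> = c * (\<Prod>i\<in>T. x i)" using assms(1,2) by simp
      finally show ?thesis using u[OF that] by simp
    qed
    from fourier_coeff_unique[OF assms(1) that this] show ?thesis by (simp add: c'_def)
  qed
  show ?thesis
  proof (rule antisym)
    show "deg A u \<le> card T"
    proof (rule deg_le[OF assms(1)])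
      fix S assume "S \<subseteq> A" "fourier_coeff A u S \<noteq> 0"
      then have "S = T" using coeff[of S] by (auto split: if_splits)
      then show "card S \<le> card T" by simp
    qed
    show "card T \<le> deg A u" using card_le_deg[OF assms(1,2)] coeff[OF assms(2)] assms(3) by simp
  qed
qed

text \<open>Among the monomials of degree at most 1 only the singleton \<open>{i}\<close> contains
  \<open>i\<close>; its term changes sign and all others cancel.\<close>

lemma derivative_if_deg_le_1:
  assumes fin: "finite A" and d: "deg A u \<le> 1" and i: "i \<in> A" and x: "x \<in> cube A"
  shows "u x - u (x(i := - x i)) = 2 * fourier_coeff A u {i} * x i"
proof -
  have x': "x(i := - x i) \<in> cube A"
    using x i cube_values[OF x i] by (auto simp: cube_def PiE_iff extensional_def)
  have "u x - u (x(i := - x i)) =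
      (\<Sum>S\<in>Pow A. fourier_coeff A u S * ((\<Prod>k\<in>S. x k) - (\<Prod>k\<in>S. (x(i := - x i)) k)))"
    unfolding fourier_expansion[OF fin x, of u] fourier_expansion[OF fin x', of u]
    by (simp add: sum_subtractf right_diff_distrib)
  also have "\<dots> = (\<Sum>S\<in>{{i}}. fourier_coeff A u S * ((\<Prod>k\<in>S. x k) - (\<Prod>k\<in>S. (x(i := - x i)) k)))"
  proof (rule sum.mono_neutral_right)
    show "\<forall>S\<in>Pow A - {{i}}. fourier_coeff A u S * ((\<Prod>k\<in>S. x k) - (\<Prod>k\<in>S. (x(i := - x i)) k)) = 0"
    proof
      fix S assume S: "S \<in> Pow A - {{i}}"
      show "fourier_coeff A u S * ((\<Prod>k\<in>S. x k) - (\<Prod>k\<in>S. (x(i := - x i)) k)) = 0"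
      proof (cases "fourier_coeff A u S = 0 \<or> i \<notin> S")
        case True
        moreover have "(\<Prod>k\<in>S. (x(i := - x i)) k) = (\<Prod>k\<in>S. x k)" if "i \<notin> S"
          using that by (intro prod.cong) auto
        ultimately show ?thesis by auto
      next
        case False
        then have "card S \<le> 1" using card_le_deg[OF fin, of S u] S d by auto
        moreover have "finite S" using S fin finite_subset by blast
        ultimately have "S = {i}" using False by (auto simp: card_le_Suc0_iff_eq)
        with S show ?thesis by simp
      qed
    qed
  qed (use fin i in auto)
  finally show ?thesis by simp
qed

lemma literal_if_bdep_singleton:
  assumes fin: "finite A" and u: "u \<in> cube A \<rightarrow> {-1, 1}" and i: "bdep (bool_fun A u) = {i}"
  obtains s where "s \<in> {-1, 1}" "\<And>x. x \<in> cube A \<Longrightarrow> u x = s * x i"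
proof -
  have iA: "i \<in> A" using i bdep_bool_fun_subset[of A u] by blast
  define \<delta> where "\<delta> = bool_fun A u (\<lambda>_. True)"
  have val: "bool_fun A u x = bool_fun A u (\<lambda>_. x i)" for x
    by (rule eq_if_agree_on_bdep[OF fsupp_bool_fun[OF fin]]) (simp add: i)
  obtain x where "bool_fun A u (x(i := \<not> x i)) \<noteq> bool_fun A u x" using i unfolding bdep_def by blast
  then have ne: "bool_fun A u (\<lambda>_. False) = (\<not> \<delta>)"
    unfolding val[of x] val[of "x(i := \<not> x i)"] \<delta>_def by (cases "x i") auto
  have "u x = sign_of \<delta> * x i" if xA: "x \<in> cube A" for x
  proof -
    obtain x' where x: "x = point A x'" using cubeE[OF xA] .
    show ?thesis
      unfolding x bool_fun_value[OF u] val[of x'] using iA ne by (cases "x' i") (auto simp: \<delta>_def)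
  qed
  then show ?thesis by (intro that[of "sign_of \<delta>"]) auto
qed

lemma deg_eq_0: "finite A \<Longrightarrow> u \<in> cube A \<rightarrow> {-1, 1} \<Longrightarrow> bdep (bool_fun A u) = {} \<Longrightarrow> deg A u = 0"
proof -
  assume a: "finite A" "u \<in> cube A \<rightarrow> {-1, 1}" "bdep (bool_fun A u) = {}"
  then obtain c where c: "\<And>x. x \<in> cube A \<Longrightarrow> u x = c"
    using constant_iff_bdep_empty[of A u] by (auto simp: constant_on_def)
  moreover have "c \<noteq> 0" using c[of "point A (\<lambda>_. True)"] bool_fun_value[OF a(2), of "\<lambda>_. True"] by auto
  ultimately show "deg A u = 0" using deg_monomial[OF a(1), of "{}" c u] by simp
qed

text \<open>In degree at most 1 the coefficient of a relevant coordinate must be a sign, since the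
  function jumps by 2. Two such coordinates, both aligned with their coefficients, would let the
  function drop by 2 twice, which the range {-1, 1} does not allow.\<close>

lemma deg_ge_2_if_junta2:
  assumes fin: "finite A" and u: "u \<in> cube A \<rightarrow> {-1, 1}" and big: "junta2 (bool_fun A u)"
  shows "deg A u \<ge> 2"
proof (rule ccontr)
  assume "\<not> deg A u \<ge> 2"
  then have d: "deg A u \<le> 1" by simp
  obtain i j where ij: "i \<in> bdep (bool_fun A u)" "j \<in> bdep (bool_fun A u)" "i \<noteq> j"
    using big unfolding junta2_def by blast
  have A: "i \<in> A" "j \<in> A" using ij bdep_bool_fun_subset[of A u] by blast+
  have der: "sign_of (bool_fun A u x) - sign_of (bool_fun A u (x(k := \<not> x k))) =
      2 * fourier_coeff A u {k} * sign_of (x k)" if "k \<in> A" for k x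
    using derivative_if_deg_le_1[OF fin d that point_in_cube[of A x]] that
    unfolding point_upd[OF that] bool_fun_value[OF u] by simp
  have coeff: "\<exists>c. fourier_coeff A u {k} = sign_of c" if k: "k \<in> bdep (bool_fun A u)" for k
  proof -
    have kA: "k \<in> A" using k bdep_bool_fun_subset[of A u] by blast
    obtain x where x: "bool_fun A u (x(k := \<not> x k)) \<noteq> bool_fun A u x" using k unfolding bdep_def by blast
    then have "sign_of (bool_fun A u (x(k := \<not> x k))) = - sign_of (bool_fun A u x)"
      by (auto simp: sign_of_def)
    then have "sign_of (bool_fun A u x) = fourier_coeff A u {k} * sign_of (x k)"
      using der[OF kA, of x] by simp
    then have "fourier_coeff A u {k} = sign_of (bool_fun A u x = x k)"
      by (auto simp: sign_of_def split: if_splits)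
    then show ?thesis ..
  qed
  obtain c c' where c: "fourier_coeff A u {i} = sign_of c" "fourier_coeff A u {j} = sign_of c'"
    using coeff ij by metis
  define x where "x = (\<lambda>_. False)(i := c, j := c')"
  have xi: "x i = c" "x j = c'" "(x(i := \<not> x i)) j = c'" using ij(3) by (auto simp: x_def)
  have "sign_of (bool_fun A u x) - sign_of (bool_fun A u (x(i := \<not> x i))) = 2"
    by (rule trans[OF der[OF A(1)]]) (simp add: c xi mult.assoc)
  moreover have "sign_of (bool_fun A u (x(i := \<not> x i))) -
      sign_of (bool_fun A u ((x(i := \<not> x i))(j := \<not> (x(i := \<not> x i)) j))) = 2"
    by (rule trans[OF der[OF A(2)]]) (use xi(3) in \<open>simp add: c mult.assoc\<close>)
  ultimately show False
    by (auto simp: sign_of_def split: if_splits)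
qed

lemma deg_eq_1_if_bdep_singleton:
  assumes "finite A" "u \<in> cube A \<rightarrow> {-1, 1}" "bdep (bool_fun A u) = {i}"
  shows "deg A u = 1"
proof -
  obtain s where "s \<in> {-1, 1}" "\<And>x. x \<in> cube A \<Longrightarrow> u x = s * x i"
    using literal_if_bdep_singleton[OF assms] by blast
  moreover have "i \<in> A" using assms(3) bdep_bool_fun_subset[of A u] by blast
  ultimately show ?thesis using deg_monomial[OF assms(1), of "{i}" s u] by auto
qed

lemma not_junta2_cases: "\<not> junta2 u \<Longrightarrow> bdep u = {} \<or> (\<exists>i. bdep u = {i})"
  unfolding junta2_def by blast

lemma deg_ge_2_iff:
  assumes "finite A" "u \<in> cube A \<rightarrow> {-1, 1}" shows "deg A u \<ge> 2 \<longleftrightarrow> junta2 (bool_fun A u)"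
proof (cases "junta2 (bool_fun A u)")
  case True
  then show ?thesis using deg_ge_2_if_junta2[OF assms] by simp
next
  case False
  then show ?thesis
    using not_junta2_cases[OF False] deg_eq_0[OF assms] deg_eq_1_if_bdep_singleton[OF assms] by auto
qed

lemma deg_eq_1_iff:
  assumes "finite A" "u \<in> cube A \<rightarrow> {-1, 1}" "bdep (bool_fun A u) \<noteq> {}"
  shows "deg A u = 1 \<longleftrightarrow> \<not> junta2 (bool_fun A u)"
  using deg_ge_2_iff[OF assms(1,2)] deg_eq_1_if_bdep_singleton[OF assms(1,2)]
    not_junta2_cases[of "bool_fun A u"] assms(3) by auto

text \<open>The all-ones point reads off the sign whatever the index is, so the description in
  \<open>dict_sgn\<close> is unique although it hides the index.\<close>

lemma dict_sgn_eqI: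
  assumes "s \<in> {-1, 1}" "i \<in> A" and u: "\<And>x. x \<in> cube A \<Longrightarrow> u x = s * x i"
  shows "dict_sgn A u = s"
  unfolding dict_sgn_def
proof (rule the_equality)
  show "s \<in> {- 1, 1} \<and> (\<exists>i\<in>A. \<forall>x\<in>cube A. u x = s * x i)" using assms by blast
next
  fix t assume "t \<in> {- 1, 1} \<and> (\<exists>i\<in>A. \<forall>x\<in>cube A. u x = t * x i)"
  then obtain k where "k \<in> A" "\<forall>x\<in>cube A. u x = t * x k" by blast
  then have "u (point A (\<lambda>_. True)) = t" by simp
  moreover have "u (point A (\<lambda>_. True)) = s" using u assms(2) by simp
  ultimately show "t = s" by simp
qed

section \<open>Factorisation of flipping and forced functions\<close>

lemma prod_in_signs: "(\<And>i. i \<in> S \<Longrightarrow> h i \<in> {-1, 1}) \<Longrightarrow> prod h S \<in> {-1, 1 :: real}"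
proof (induction S rule: infinite_finite_induct)
  case (insert i S)
  then have "h i \<in> {-1, 1}" "prod h S \<in> {-1, 1}" by blast+
  with insert.hyps show ?case by auto
qed auto

text \<open>Pins the coordinates outside \<open>S\<close>. A factor that may depend on
  \<open>S\<close> only can then be taken as a value of the original function.\<close>

definition fill :: "'a set \<Rightarrow> 'a set \<Rightarrow> ('a \<Rightarrow> bool) \<Rightarrow> ('a \<Rightarrow> real) \<Rightarrow> 'a \<Rightarrow> real" where
  "fill A S c x = (\<lambda>i\<in>A. if i \<in> S then x i else sign_of (c i))"

lemma fill_in_cube: "x \<in> cube S \<Longrightarrow> fill A S c x \<in> cube A"
  using sign_of_simps(3) by (auto simp: fill_def cube_def PiE_iff extensional_def)

lemma fill_point: "S \<subseteq> A \<Longrightarrow> fill A S c (restrict (point A x) S) = point A (\<lambda>i. if i \<in> S then x i else c i)"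
  by (auto simp: fill_def point_def fun_eq_iff)

lemma restrict_in_cube: "S \<subseteq> A \<Longrightarrow> x \<in> cube A \<Longrightarrow> restrict x S \<in> cube S"
  by (auto simp: cube_def PiE_iff)

text \<open>Replacing a flipping coordinate by \<open>True\<close> multiplies the value by the sign
  of that coordinate; doing this for all of \<open>T\<close> leaves a function of
  \<open>S\<close>.\<close>

lemma flips_factor:
  assumes fin: "finite A" and u: "u \<in> cube A \<rightarrow> {-1, 1}"
    and dep: "bdep (bool_fun A u) = S \<union> T" "S \<inter> T = {}"
    and fl: "\<And>i. i \<in> T \<Longrightarrow> flips (bool_fun A u) i" and x: "x \<in> cube A"
  shows "u x = u (fill A S (\<lambda>_. True) (restrict x S)) * (\<Prod>i\<in>T. x i)"
proof -
  obtain x' where x': "x = point A x'" using cubeE[OF x] .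
  have ST: "S \<subseteq> A" "T \<subseteq> A" using dep(1) bdep_bool_fun_subset[of A u] by auto
  have "sign_of (bool_fun A u x') =
      sign_of (bool_fun A u (\<lambda>i. if i \<in> R then True else x' i)) * (\<Prod>i\<in>R. sign_of (x' i))"
    if "finite R" "R \<subseteq> T" for R
    using that
  proof induction
    case (insert i R)
    define v where "v = (\<lambda>i. if i \<in> R then True else x' i)"
    have v: "(\<lambda>k. if k \<in> insert i R then True else x' k) = v(i := True)"
      by (auto simp: v_def fun_eq_iff)
    have vi: "v i = x' i" using insert.hyps by (simp add: v_def)
    have "sign_of (bool_fun A u v) = sign_of (bool_fun A u (v(i := True))) * sign_of (x' i)"
    proof (cases "x' i")
      case True
      then have "v(i := True) = v" using vi by (simp add: fun_upd_idem)
      then show ?thesis using True by simp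
    next
      case False
      then show ?thesis using flipsD[OF fl[of i], of v] insert.prems vi by simp
    qed
    then show ?case using insert unfolding v v_def[symmetric] by simp
  qed simp
  from this[of T] have "sign_of (bool_fun A u x') =
      sign_of (bool_fun A u (\<lambda>i. if i \<in> T then True else x' i)) * (\<Prod>i\<in>T. sign_of (x' i))"
    using finite_subset[OF ST(2) fin] by simp
  also have "bool_fun A u (\<lambda>i. if i \<in> T then True else x' i) = bool_fun A u (\<lambda>i. if i \<in> S then x' i else True)"
    by (rule eq_if_agree_on_bdep[OF fsupp_bool_fun[OF fin]]) (use dep in auto)
  also have "(\<Prod>i\<in>T. sign_of (x' i)) = (\<Prod>i\<in>T. x i)"
    using ST by (intro prod.cong) (auto simp: x')
  finally show ?thesis
    unfolding x' fill_point[OF ST(1)] bool_fun_value[OF u] .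
qed

text \<open>With the forced coordinates at their required bits, what remains of the condition for
  the value \<open>b\<close> concerns \<open>S\<close> only; this is its 0/1 indicator.\<close>

definition forced_part ::
    "'a set \<Rightarrow> (('a \<Rightarrow> real) \<Rightarrow> real) \<Rightarrow> 'a set \<Rightarrow> ('a \<Rightarrow> bool) \<Rightarrow> bool \<Rightarrow> ('a \<Rightarrow> real) \<Rightarrow> real" where
  "forced_part A u S \<kappa> b x = (if u (fill A S \<kappa> x) = sign_of b then 1 else 0)"

lemma prod_indicator:
  "finite T \<Longrightarrow> (\<Prod>i\<in>T. (sign_of (a i) * sign_of (b i) + 1) / 2) = (if \<forall>i\<in>T. a i = b i then 1 else 0)"
  by (induction T rule: finite_induct) (auto simp: sign_of_def)

lemma prod_indicator':
  "finite T \<Longrightarrow> (\<Prod>i\<in>T. if P i then 1 else 0 :: real) = (if \<forall>i\<in>T. P i then 1 else 0)"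
  by (induction T rule: finite_induct) auto

lemma forced_part_point:
  assumes fin: "finite A" and u: "u \<in> cube A \<rightarrow> {-1, 1}"
    and dep: "bdep (bool_fun A u) = S \<union> T" "S \<inter> T = {}" and x: "\<And>i. i \<in> T \<Longrightarrow> x i = \<kappa> i"
  shows "forced_part A u S \<kappa> b (restrict (point A x) S) = (if bool_fun A u x = b then 1 else 0)"
proof -
  have ST: "S \<subseteq> A" using dep(1) bdep_bool_fun_subset[of A u] by auto
  have "bool_fun A u (\<lambda>i. if i \<in> S then x i else \<kappa> i) = bool_fun A u x"
    by (rule eq_if_agree_on_bdep[OF fsupp_bool_fun[OF fin]]) (use dep x in auto)
  then show ?thesis
    unfolding forced_part_def fill_point[OF ST] bool_fun_value[OF u] by simp
qed

text \<open>A wrong bit in \<open>T\<close> makes the product vanish and keeps \<open>u\<close> away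
  from the value \<open>b\<close>, so both sides are minus the sign of \<open>b\<close>. With all
  bits right, the forced part decides.\<close>

lemma forces_factor:
  assumes fin: "finite A" and u: "u \<in> cube A \<rightarrow> {-1, 1}"
    and dep: "bdep (bool_fun A u) = S \<union> T" "S \<inter> T = {}"
    and fo: "\<And>i. i \<in> T \<Longrightarrow> forces (bool_fun A u) b i (\<kappa> i)" and x: "x \<in> cube A"
  shows "u x = forced_part A u S \<kappa> b (restrict x S) *
    (2 * sign_of b * (\<Prod>i\<in>T. (sign_of (\<kappa> i) * x i + 1) / 2)) - sign_of b"
proof -
  obtain x' where x': "x = point A x'" using cubeE[OF x] .
  have ST: "S \<subseteq> A" "T \<subseteq> A" using dep(1) bdep_bool_fun_subset[of A u] by auto
  have "(\<Prod>i\<in>T. (sign_of (\<kappa> i) * x i + 1) / 2) = (\<Prod>i\<in>T. (sign_of (\<kappa> i) * sign_of (x' i) + 1) / 2)"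
    using ST by (intro prod.cong) (auto simp: x')
  also have "\<dots> = (if \<forall>i\<in>T. \<kappa> i = x' i then 1 else 0)"
    by (rule prod_indicator) (use finite_subset[OF ST(2) fin] in auto)
  finally have pr: "(\<Prod>i\<in>T. (sign_of (\<kappa> i) * x i + 1) / 2) = (if \<forall>i\<in>T. \<kappa> i = x' i then 1 else 0)" .
  have ux: "u x = sign_of (bool_fun A u x')" unfolding x' by (rule bool_fun_value[OF u])
  show ?thesis
  proof (cases "\<forall>i\<in>T. \<kappa> i = x' i")
    case True
    then have fp: "forced_part A u S \<kappa> b (restrict x S) = (if bool_fun A u x' = b then 1 else 0)"
      unfolding x' by (intro forced_part_point[OF fin u dep]) simp
    show ?thesis unfolding pr fp ux using True by (cases b) auto
  next
    case False
    then obtain i where i: "i \<in> T" "x' i \<noteq> \<kappa> i" by metis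
    then have "bool_fun A u x' \<noteq> b" using forcesD[OF fo[OF i(1)], of x'] by blast
    then have "bool_fun A u x' = (\<not> b)" by blast
    then show ?thesis unfolding pr ux if_not_P[OF False] by simp
  qed
qed

section \<open>The reduced system over signs and its translation to truth values\<close>

locale real_system =
  fixes A :: "'a set" and B :: "'b set" and F :: "('a \<Rightarrow> real) \<Rightarrow> real" and G :: "('b \<Rightarrow> real) \<Rightarrow> real"
    and f :: "'b \<Rightarrow> ('a \<Rightarrow> real) \<Rightarrow> real" and g :: "'a \<Rightarrow> ('b \<Rightarrow> real) \<Rightarrow> real"
  assumes finA: "finite A" and finB: "finite B"
    and F_bool: "F \<in> cube A \<rightarrow> {-1, 1}" and G_bool: "G \<in> cube B \<rightarrow> {-1, 1}"
    and f_bool: "\<And>j. j \<in> B \<Longrightarrow> f j \<in> cube A \<rightarrow> {-1, 1}"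
    and g_bool: "\<And>i. i \<in> A \<Longrightarrow> g i \<in> cube B \<rightarrow> {-1, 1}"
    and system: "bool_system (bool_fun A F) (bool_fun B G) (\<lambda>j. bool_fun A (f j)) (\<lambda>i. bool_fun B (g i))"
    and dep_F: "bdep (bool_fun A F) = A" and dep_G: "bdep (bool_fun B G) = B"
begin

lemma real_swapped: "real_system B A G F g f"
  by (rule real_system.intro) (fact finA finB F_bool G_bool f_bool g_bool dep_F dep_G bool_system.swapped[OF system])+

sublocale bool_system "bool_fun A F" "bool_fun B G" "\<lambda>j. bool_fun A (f j)" "\<lambda>i. bool_fun B (g i)"
  by (rule system)

definition row_point :: "('a \<times> 'b \<Rightarrow> bool) \<Rightarrow> 'a \<Rightarrow> real" where
  "row_point z = point A (row_value z)"

definition col_point :: "('a \<times> 'b \<Rightarrow> bool) \<Rightarrow> 'b \<Rightarrow> real" where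
  "col_point z = point B (col_value z)"

lemma row_point_swap: "real_system.row_point B A f (\<lambda>(j, i). z (i, j)) = col_point z"
  unfolding real_system.row_point_def[OF real_swapped] col_point_def
    bool_system.row_value_def[OF bool_system.swapped[OF system]] col_value_def[abs_def] by simp

lemma cellsD:
  assumes "(i, j) \<in> cells"
  shows "i \<in> A" "j \<in> B" "j \<in> bdep (bool_fun B (g i))" "i \<in> bdep (bool_fun A (f j))"
  using assms dep_transfer[of i j] unfolding cells_def dep_F dep_G by auto

lemma dep_f: "j \<in> B \<Longrightarrow> Dep A (f j) = bdep (bool_fun A (f j))"
  by (rule Dep_eq_bdep[OF f_bool])

lemma deg_f:
  assumes "j \<in> B"
  shows "deg A (f j) = 1 \<longleftrightarrow> \<not> junta2 (bool_fun A (f j))" "2 \<le> deg A (f j) \<longleftrightarrow> junta2 (bool_fun A (f j))"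
  using deg_eq_1_iff[OF finA f_bool[OF assms]] deg_ge_2_iff[OF finA f_bool[OF assms]] f_nonconst[of j] assms
  unfolding dep_G by auto

lemma deg_g:
  assumes "i \<in> A"
  shows "deg B (g i) = 1 \<longleftrightarrow> \<not> junta2 (bool_fun B (g i))" "2 \<le> deg B (g i) \<longleftrightarrow> junta2 (bool_fun B (g i))"
  using deg_eq_1_iff[OF finB g_bool[OF assms]] deg_ge_2_iff[OF finB g_bool[OF assms]] g_nonconst[of i] assms
  unfolding dep_F by auto

lemma dep_eq1_f:
  "j \<in> B \<Longrightarrow> dep_eq1 A (f j) B g = {i \<in> bdep (bool_fun A (f j)). \<not> junta2 (bool_fun B (g i))}"
  unfolding dep_eq1_def dep_f using deg_g(1) bdep_bool_fun_subset[of A "f j"] by blast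

lemma dep_ge2_f:
  "j \<in> B \<Longrightarrow> dep_ge2 A (f j) B g = {i \<in> bdep (bool_fun A (f j)). junta2 (bool_fun B (g i))}"
  unfolding dep_ge2_def dep_f using deg_g(2) bdep_bool_fun_subset[of A "f j"] by blast

lemma dep_split_f:
  assumes "j \<in> B"
  shows "bdep (bool_fun A (f j)) = dep_eq1 A (f j) B g \<union> dep_ge2 A (f j) B g"
    "dep_eq1 A (f j) B g \<inter> dep_ge2 A (f j) B g = {}" "dep_eq1 A (f j) B g \<subseteq> A"
  unfolding dep_eq1_f[OF assms] dep_ge2_f[OF assms] using bdep_bool_fun_subset[of A "f j"] by auto

lemma rows_ge2_block:
  "W \<in> blocks \<Longrightarrow> rows_ge2 B g W = {i \<in> rows_of W. junta2 (bool_fun B (g i))}"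
  unfolding rows_ge2_def using deg_g(2) block_subset cellsD(1) by (fastforce simp: rows_of_def)

lemma dictator_g:
  assumes "(i, j) \<in> cells" "\<not> junta2 (bool_fun B (g i))"
  shows "dict_sgn B (g i) \<in> {-1, 1}" "\<And>y. y \<in> cube B \<Longrightarrow> g i y = dict_sgn B (g i) * y j"
    "bdep (bool_fun B (g i)) = {j}"
proof -
  show b: "bdep (bool_fun B (g i)) = {j}"
    using not_junta2_cases[OF assms(2)] cellsD(3)[OF assms(1)] by auto
  obtain s where s: "s \<in> {-1, 1}" "\<And>y. y \<in> cube B \<Longrightarrow> g i y = s * y j"
    using literal_if_bdep_singleton[OF finB g_bool[OF cellsD(1)[OF assms(1)]] b] by blast
  then have "dict_sgn B (g i) = s" using cellsD(2)[OF assms(1)] by (intro dict_sgn_eqI)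
  with s show "dict_sgn B (g i) \<in> {-1, 1}" "\<And>y. y \<in> cube B \<Longrightarrow> g i y = dict_sgn B (g i) * y j"
    by auto
qed

lemma row_point_eq: "i \<in> A \<Longrightarrow> row_point z i = g i (point B (\<lambda>j. z (i, j)))"
  by (simp add: row_point_def row_value_def bool_fun_value[OF g_bool])

text \<open>If \<open>g i\<close> has degree 1 and reads the cell in column \<open>j\<close>, its
  value is its sign times that cell, and a second multiplication by the sign cancels. So the signed
  row values contain the true entries of column \<open>j\<close> in all rows of degree 1.\<close>

lemma sgn_point_row_point:
  assumes j: "j \<in> B"
  shows "restrict (sgn_point A B g (row_point z)) (dep_eq1 A (f j) B g) =
    restrict (point A (\<lambda>i. z (i, j))) (dep_eq1 A (f j) B g)"
proof (rule restrict_ext)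
  fix i assume "i \<in> dep_eq1 A (f j) B g"
  then have i: "i \<in> bdep (bool_fun A (f j))" "\<not> junta2 (bool_fun B (g i))" by (auto simp: dep_eq1_f[OF j])
  then have ij: "(i, j) \<in> cells" using j by (simp add: cells_col dep_G)
  have iA: "i \<in> A" using cellsD[OF ij] by blast
  note d = dictator_g[OF ij i(2)]
  have "dict_sgn B (g i) * row_point z i = dict_sgn B (g i) * (dict_sgn B (g i) * sign_of (z (i, j)))"
    using d(2)[of "point B (\<lambda>j. z (i, j))"] j by (simp add: row_point_eq[OF iA])
  also have "\<dots> = sign_of (z (i, j))" using d(1) by auto
  finally show "sgn_point A B g (row_point z) i = point A (\<lambda>i. z (i, j)) i"
    using iA i(2) deg_g(1)[OF iA] by (simp add: sgn_point_def)
qed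

text \<open>Turns a claim about every point of a cube into one about configurations, for which row
  and column values can be compared.\<close>

lemma row_point_surj:
  assumes "R \<subseteq> A" "x \<in> cube R" shows "\<exists>z. x = restrict (row_point z) R"
proof -
  obtain x' where x': "x = point R x'" using cubeE[OF assms(2)] .
  obtain z where z: "\<forall>i\<in>A. row_value z i = x' i" using row_values_surj[of x'] unfolding dep_F by blast
  show ?thesis
    using z assms(1) by (intro exI[of _ z]) (auto simp: x' row_point_def point_def fun_eq_iff)
qed

lemma cube_row_point:
  assumes "x \<in> cube A" shows "\<exists>z. x = row_point z"
proof -
  obtain z where "x = restrict (row_point z) A" using row_point_surj[OF subset_refl assms] by blast
  then show ?thesis by (auto simp: row_point_def point_def)
qed

lemma rows_of_block: "W \<in> blocks \<Longrightarrow> rows_of W \<subseteq> A"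
  using block_subset cellsD(1) by (fastforce simp: rows_of_def)

lemma dep_f_block:
  assumes "W \<in> blocks" "j \<in> cols_of W" shows "j \<in> B" "bdep (bool_fun A (f j)) \<subseteq> rows_of W"
    "\<And>i. i \<in> bdep (bool_fun A (f j)) \<Longrightarrow> (i, j) \<in> W"
proof -
  obtain i where i: "(i, j) \<in> W" using assms(2) by (auto simp: cols_of_def)
  show j: "j \<in> B" using cellsD(2) block_subset[OF assms(1)] i by blast
  show W: "(i', j) \<in> W" if "i' \<in> bdep (bool_fun A (f j))" for i'
    using block_closed[OF assms(1) i, of "(i', j)"] that j by (simp add: cells_col dep_G)
  then show "bdep (bool_fun A (f j)) \<subseteq> rows_of W" by (force simp: rows_of_def)
qed

lemma dep_g_block:
  assumes "W \<in> blocks" "i \<in> rows_of W" shows "i \<in> A" "bdep (bool_fun B (g i)) \<subseteq> cols_of W"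
    "\<And>j. j \<in> bdep (bool_fun B (g i)) \<Longrightarrow> (i, j) \<in> W"
proof -
  obtain j where j: "(i, j) \<in> W" using assms(2) by (auto simp: rows_of_def)
  show i: "i \<in> A" using cellsD(1) block_subset[OF assms(1)] j by blast
  show W: "(i, j') \<in> W" if "j' \<in> bdep (bool_fun B (g i))" for j'
    using block_closed[OF assms(1) j, of "(i, j')"] that i by (simp add: cells_def dep_F)
  then show "bdep (bool_fun B (g i)) \<subseteq> cols_of W" by (force simp: cols_of_def)
qed

lemma cols_of_block: "W \<in> blocks \<Longrightarrow> cols_of W \<subseteq> B"
  using block_subset cellsD(2) by (fastforce simp: cols_of_def)

lemma cols_ge2_block:
  "W \<in> blocks \<Longrightarrow> cols_ge2 A f W = {j \<in> cols_of W. junta2 (bool_fun A (f j))}"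
  unfolding cols_ge2_def using deg_f(2) block_subset cellsD(2) by (fastforce simp: cols_of_def)

lemmas dep_g = real_system.dep_f[OF real_swapped]
lemmas dep_ge2_g = real_system.dep_ge2_f[OF real_swapped]
lemmas dep_split_g = real_system.dep_split_f[OF real_swapped]

lemma dictator_f:
  assumes "(i, j) \<in> cells" "\<not> junta2 (bool_fun A (f j))"
  shows "dict_sgn A (f j) \<in> {-1, 1}" "\<And>x. x \<in> cube A \<Longrightarrow> f j x = dict_sgn A (f j) * x i"
    "bdep (bool_fun A (f j)) = {i}"
proof -
  interpret sw: real_system B A G F g f by (rule real_swapped)
  have "(j, i) \<in> sw.cells" using assms(1) unfolding sw.cells_def cells_col by simp
  note * = sw.dictator_g[OF this assms(2)]
  show "dict_sgn A (f j) \<in> {-1, 1}" "bdep (bool_fun A (f j)) = {i}" by (fact *)+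
  show "f j x = dict_sgn A (f j) * x i" if "x \<in> cube A" for x by (rule *(2)[OF that])
qed

lemma sgn_point_col_point:
  "i \<in> A \<Longrightarrow> restrict (sgn_point B A f (col_point z)) (dep_eq1 B (g i) A f) =
    restrict (point B (\<lambda>j. z (i, j))) (dep_eq1 B (g i) A f)"
  using real_system.sgn_point_row_point[OF real_swapped, of i "\<lambda>(j, i). z (i, j)"]
  unfolding row_point_swap by simp

lemma col_point_surj:
  assumes "C \<subseteq> B" "y \<in> cube C" shows "\<exists>z. y = restrict (col_point z) C"
proof -
  obtain z where z: "y = restrict (real_system.row_point B A f z) C"
    using real_system.row_point_surj[OF real_swapped assms] by blast
  show ?thesis
    using z row_point_swap[of "\<lambda>(i, j). z (j, i)"] by (intro exI[of _ "\<lambda>(i, j). z (j, i)"]) simp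
qed

lemma cube_col_point:
  assumes "y \<in> cube B" shows "\<exists>z. y = col_point z"
proof -
  obtain z where "y = restrict (col_point z) B" using col_point_surj[OF subset_refl assms] by blast
  then show ?thesis by (auto simp: col_point_def point_def)
qed

lemma col_point_eq: "j \<in> B \<Longrightarrow> col_point z j = f j (point A (\<lambda>i. z (i, j)))"
  by (simp add: col_point_def col_value_def bool_fun_value[OF f_bool])

lemma row_point_in_cube [simp]: "row_point z \<in> cube A"
  by (simp add: row_point_def)

lemma col_point_in_cube [simp]: "col_point z \<in> cube B"
  by (simp add: col_point_def)

lemma sgn_point_restrict_rows:
  assumes "W \<in> blocks" "j \<in> cols_of W"
  shows "restrict (sgn_point A B g (restrict x (rows_of W))) (dep_eq1 A (f j) B g) =
    restrict (sgn_point A B g x) (dep_eq1 A (f j) B g)"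
  using dep_f_block(2)[OF assms] dep_split_f(1)[OF dep_f_block(1)[OF assms]]
  by (intro restrict_ext) (auto simp: sgn_point_def)

lemma sgn_point_restrict_cols:
  assumes "W \<in> blocks" "i \<in> rows_of W"
  shows "restrict (sgn_point B A f (restrict y (cols_of W))) (dep_eq1 B (g i) A f) =
    restrict (sgn_point B A f y) (dep_eq1 B (g i) A f)"
  using dep_g_block(2)[OF assms] dep_split_g(1)[OF dep_g_block(1)[OF assms]]
  by (intro restrict_ext) (auto simp: sgn_point_def)

text \<open>Expanding the row values in \<open>p\<close> gives the product of all
  \<open>\<Gamma>\<close>, all \<open>\<Phi>\<close> and all core cells. Expanding the column values
  in \<open>q\<close> gives the same product with the cells collected by columns. The hypotheses ask
  for flipping at noncore cells as well, where it comes from dictators; so stars without core cells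
  are covered.\<close>

lemma xor_block_exists:
  assumes W: "W \<in> blocks"
    and xr: "\<And>i j. (i, j) \<in> W \<Longrightarrow> junta2 (bool_fun B (g i)) \<Longrightarrow> flips (bool_fun A (f j)) i"
    and xc: "\<And>i j. (i, j) \<in> W \<Longrightarrow> junta2 (bool_fun A (f j)) \<Longrightarrow> flips (bool_fun B (g i)) j"
  shows "\<exists>p q. p \<in> cube (rows_of W) \<rightarrow> {-1, 1} \<and> q \<in> cube (cols_of W) \<rightarrow> {-1, 1} \<and>
    xor_block A B f g W p q \<and>
    (\<forall>z. p (restrict (row_point z) (rows_of W)) = q (restrict (col_point z) (cols_of W)))"
proof -
  define S where "S j = dep_eq1 A (f j) B g" for j
  define T where "T i = dep_eq1 B (g i) A f" for i
  define S2 where "S2 j = dep_ge2 A (f j) B g" for j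
  define T2 where "T2 i = dep_ge2 B (g i) A f" for i
  define R C where "R = rows_ge2 B g W" and "C = cols_ge2 A f W"
  have R: "R = {i \<in> rows_of W. junta2 (bool_fun B (g i))}" unfolding R_def by (rule rows_ge2_block[OF W])
  have C: "C = {j \<in> cols_of W. junta2 (bool_fun A (f j))}" unfolding C_def by (rule cols_ge2_block[OF W])
  have fin: "finite R" "finite C"
    using finite_block[OF W] unfolding R C rows_of_def cols_of_def by auto
  \<comment> \<open>\<open>True\<close> stands for the sign 1, so pinning the flipping coordinates
    there makes their product 1 and leaves exactly the cofactor.\<close>
  define \<phi> where "\<phi> j x = f j (fill A (S j) (\<lambda>_. True) x)" for j x
  define \<gamma> where "\<gamma> i y = g i (fill B (T i) (\<lambda>_. True) y)" for i y
  have \<phi>: "\<phi> j \<in> cube (S j) \<rightarrow> {-1, 1}" "\<forall>x\<in>cube A. f j x = \<phi> j (restrict x (S j)) * (\<Prod>i\<in>S2 j. x i)"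
    if j: "j \<in> cols_of W" for j
  proof -
    note jB = dep_f_block(1)[OF W j]
    show "\<phi> j \<in> cube (S j) \<rightarrow> {-1, 1}"
      unfolding \<phi>_def using fill_in_cube f_bool[OF jB] by blast
    show "\<forall>x\<in>cube A. f j x = \<phi> j (restrict x (S j)) * (\<Prod>i\<in>S2 j. x i)"
      unfolding \<phi>_def S_def S2_def
    proof
      fix x assume x: "x \<in> cube A"
      show "f j x = f j (fill A (dep_eq1 A (f j) B g) (\<lambda>_. True) (restrict x (dep_eq1 A (f j) B g))) *
          (\<Prod>i\<in>dep_ge2 A (f j) B g. x i)"
        using dep_f_block(3)[OF W j] xr
        by (intro flips_factor[OF finA f_bool[OF jB] dep_split_f(1,2)[OF jB] _ x])
          (auto simp: dep_ge2_f[OF jB])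
    qed
  qed
  have \<gamma>: "\<gamma> i \<in> cube (T i) \<rightarrow> {-1, 1}" "\<forall>y\<in>cube B. g i y = \<gamma> i (restrict y (T i)) * (\<Prod>j\<in>T2 i. y j)"
    if i: "i \<in> rows_of W" for i
  proof -
    note iA = dep_g_block(1)[OF W i]
    show "\<gamma> i \<in> cube (T i) \<rightarrow> {-1, 1}"
      unfolding \<gamma>_def using fill_in_cube g_bool[OF iA] by blast
    show "\<forall>y\<in>cube B. g i y = \<gamma> i (restrict y (T i)) * (\<Prod>j\<in>T2 i. y j)"
      unfolding \<gamma>_def T_def T2_def
    proof
      fix y assume y: "y \<in> cube B"
      show "g i y = g i (fill B (dep_eq1 B (g i) A f) (\<lambda>_. True) (restrict y (dep_eq1 B (g i) A f))) *
          (\<Prod>j\<in>dep_ge2 B (g i) A f. y j)"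
        using dep_g_block(3)[OF W i] xc
        by (intro flips_factor[OF finB g_bool[OF iA] dep_split_g(1,2)[OF iA] _ y])
          (auto simp: dep_ge2_g[OF iA])
    qed
  qed
  define p where "p x = (\<Prod>i\<in>R. x i) * (\<Prod>j\<in>C. \<phi> j (restrict (sgn_point A B g x) (S j)))" for x
  define q where "q y = (\<Prod>j\<in>C. y j) * (\<Prod>i\<in>R. \<gamma> i (restrict (sgn_point B A f y) (T i)))" for y
  have p: "p (restrict x (rows_of W)) = p x" for x
    unfolding p_def S_def using sgn_point_restrict_rows[OF W]
    by (intro arg_cong2[of _ _ _ _ "(*)"] prod.cong) (auto simp: R C)
  have q: "q (restrict y (cols_of W)) = q y" for y
    unfolding q_def T_def using sgn_point_restrict_cols[OF W]
    by (intro arg_cong2[of _ _ _ _ "(*)"] prod.cong) (auto simp: R C)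
  have RA: "i \<in> A" "i \<in> rows_of W" if "i \<in> R" for i using that rows_of_block[OF W] by (auto simp: R)
  have CB: "j \<in> B" "j \<in> cols_of W" if "j \<in> C" for j using that cols_of_block[OF W] by (auto simp: C)
  define \<Phi> where "\<Phi> z j = \<phi> j (restrict (point A (\<lambda>i. z (i, j))) (S j))" for z j
  define \<Gamma> where "\<Gamma> z i = \<gamma> i (restrict (point B (\<lambda>j. z (i, j))) (T i))" for z i
  have p_row: "p (row_point z) = (\<Prod>i\<in>R. row_point z i) * (\<Prod>j\<in>C. \<Phi> z j)" for z
    unfolding p_def \<Phi>_def S_def using sgn_point_row_point CB
    by (intro arg_cong2[of _ _ _ _ "(*)"] prod.cong) auto
  have q_col: "q (col_point z) = (\<Prod>j\<in>C. col_point z j) * (\<Prod>i\<in>R. \<Gamma> z i)" for z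
    unfolding q_def \<Gamma>_def T_def using sgn_point_col_point RA
    by (intro arg_cong2[of _ _ _ _ "(*)"] prod.cong) auto
  have T2: "T2 i = {j. j \<in> C \<and> (i, j) \<in> W}" if "i \<in> R" for i
    using dep_g_block(2,3)[OF W RA(2)[OF that]] cellsD(3) block_subset[OF W]
    unfolding T2_def dep_ge2_g[OF RA(1)[OF that]] C by (auto simp: cols_of_def)
  have S2: "S2 j = {i. i \<in> R \<and> (i, j) \<in> W}" if "j \<in> C" for j
    using dep_f_block(2,3)[OF W CB(2)[OF that]] cellsD(4) block_subset[OF W]
    unfolding S2_def dep_ge2_f[OF CB(1)[OF that]] R by (auto simp: rows_of_def)
  have row: "row_point z i = \<Gamma> z i * (\<Prod>j | j \<in> C \<and> (i, j) \<in> W. sign_of (z (i, j)))" if i: "i \<in> R" for z i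
  proof -
    have "row_point z i = \<Gamma> z i * (\<Prod>j\<in>T2 i. point B (\<lambda>j. z (i, j)) j)"
      using \<gamma>(2)[OF RA(2)[OF i]] by (simp add: row_point_eq[OF RA(1)[OF i]] \<Gamma>_def)
    also have "(\<Prod>j\<in>T2 i. point B (\<lambda>j. z (i, j)) j) = (\<Prod>j | j \<in> C \<and> (i, j) \<in> W. sign_of (z (i, j)))"
      unfolding T2[OF i] using CB by (intro prod.cong) auto
    finally show ?thesis .
  qed
  have col: "col_point z j = \<Phi> z j * (\<Prod>i | i \<in> R \<and> (i, j) \<in> W. sign_of (z (i, j)))" if j: "j \<in> C" for z j
  proof -
    have "col_point z j = \<Phi> z j * (\<Prod>i\<in>S2 j. point A (\<lambda>i. z (i, j)) i)"
      using \<phi>(2)[OF CB(2)[OF j]] by (simp add: col_point_eq[OF CB(1)[OF j]] \<Phi>_def)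
    also have "(\<Prod>i\<in>S2 j. point A (\<lambda>i. z (i, j)) i) = (\<Prod>i | i \<in> R \<and> (i, j) \<in> W. sign_of (z (i, j)))"
      unfolding S2[OF j] using RA by (intro prod.cong) auto
    finally show ?thesis .
  qed
  have pq: "p (row_point z) = q (col_point z)" for z
  proof -
    have "(\<Prod>i\<in>R. row_point z i) =
        (\<Prod>i\<in>R. \<Gamma> z i) * (\<Prod>i\<in>R. \<Prod>j | j \<in> C \<and> (i, j) \<in> W. sign_of (z (i, j)))"
      using row by (simp add: prod.distrib)
    moreover have "(\<Prod>j\<in>C. col_point z j) =
        (\<Prod>j\<in>C. \<Phi> z j) * (\<Prod>j\<in>C. \<Prod>i | i \<in> R \<and> (i, j) \<in> W. sign_of (z (i, j)))"
      using col by (simp add: prod.distrib)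
    ultimately show ?thesis
      unfolding p_row q_col prod.swap_restrict[OF fin, of "\<lambda>i j. sign_of (z (i, j))" "\<lambda>i j. (i, j) \<in> W"]
      by simp
  qed
  have p_val: "p (row_point z) \<in> {-1, 1}" for z
  proof -
    have "(\<Prod>i\<in>R. row_point z i) \<in> {-1, 1}"
      using cube_values[OF row_point_in_cube] RA by (intro prod_in_signs) blast
    moreover have "(\<Prod>j\<in>C. \<Phi> z j) \<in> {-1, 1}"
    proof (rule prod_in_signs)
      fix j assume j: "j \<in> C"
      have "restrict (point A (\<lambda>i. z (i, j))) (S j) \<in> cube (S j)"
        using dep_split_f(3)[OF CB(1)[OF j]] unfolding S_def by (intro restrict_in_cube) auto
      then show "\<Phi> z j \<in> {-1, 1}" unfolding \<Phi>_def using \<phi>(1)[OF CB(2)[OF j]] by blast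
    qed
    ultimately show ?thesis unfolding p_row by auto
  qed
  have "p \<in> cube (rows_of W) \<rightarrow> {-1, 1}"
    using row_point_surj[OF rows_of_block[OF W]] p p_val by fastforce
  moreover have "q \<in> cube (cols_of W) \<rightarrow> {-1, 1}"
    using col_point_surj[OF cols_of_block[OF W]] q p_val pq by fastforce
  moreover have "xor_block A B f g W p q"
    unfolding xor_block_def
    by (rule exI[of _ \<phi>], rule exI[of _ \<gamma>])
      (use \<phi> \<gamma> p q in \<open>auto simp: p_def q_def S_def T_def S2_def T2_def R_def C_def\<close>)
  ultimately show ?thesis
    by (intro exI[of _ p] exI[of _ q] conjI allI) (simp_all add: p q pq)
qed

end

section \<open>The shape of a block\<close>

lemma flips_if_bdep_singleton:
  assumes "fsupp u" "bdep u = {i}" shows "flips u i"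
proof -
  have val: "u x = u (\<lambda>_. x i)" for x
    by (rule eq_if_agree_on_bdep[OF assms(1)]) (simp add: assms(2))
  obtain x where "u (x(i := \<not> x i)) \<noteq> u x" using assms(2) unfolding bdep_def by blast
  then have "u (\<lambda>_. True) \<noteq> u (\<lambda>_. False)"
    unfolding val[of x] val[of "x(i := \<not> x i)"] by (cases "x i") auto
  then have "u (y(i := \<not> y i)) \<noteq> u y" for y
    unfolding val[of y] val[of "y(i := \<not> y i)"] by (cases "y i") auto
  then show ?thesis by (simp add: flips_def)
qed

text \<open>The factors \<open>h\<close> are known only under the row condition, which suffices
  because the first product vanishes otherwise. In the application, the row condition is what puts
  the forced bits in place so that a column factor becomes an indicator.\<close>

lemma and_value:
  fixes x d :: "'c \<Rightarrow> bool" and y \<beta> :: "'d \<Rightarrow> bool"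
  assumes "finite R" "finite C"
    and h: "\<And>j. (\<forall>i\<in>R. x i = d i) \<Longrightarrow> j \<in> C \<Longrightarrow> h j = (if y j = \<beta> j then 1 else 0)"
  shows "2 * (\<Prod>i\<in>R. (sign_of (d i) * sign_of (x i) + 1) / 2) * (\<Prod>j\<in>C. h j) - 1 =
    sign_of ((\<forall>i\<in>R. x i = d i) \<and> (\<forall>j\<in>C. y j = \<beta> j))"
proof (cases "\<forall>i\<in>R. x i = d i")
  case True
  have "(\<Prod>j\<in>C. h j) = (\<Prod>j\<in>C. if y j = \<beta> j then 1 else 0)" using h[OF True] by (intro prod.cong) auto
  then have "(\<Prod>j\<in>C. h j) = (if \<forall>j\<in>C. y j = \<beta> j then 1 else 0)"
    unfolding prod_indicator'[OF assms(2)] .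
  moreover have "(\<Prod>i\<in>R. (sign_of (d i) * sign_of (x i) + 1) / 2) = 1"
    unfolding prod_indicator[OF assms(1)] using True by simp
  ultimately show ?thesis unfolding sign_of_def[of "_ \<and> _"] using True by simp
next
  case False
  then have "\<not> (\<forall>i\<in>R. d i = x i)" by metis
  then have 0: "(\<Prod>i\<in>R. (sign_of (d i) * sign_of (x i) + 1) / 2) = 0"
    unfolding prod_indicator[OF assms(1)] by (rule if_not_P)
  have "sign_of ((\<forall>i\<in>R. x i = d i) \<and> (\<forall>j\<in>C. y j = \<beta> j)) = -1"
    unfolding sign_of_simps(5) using False by blast
  then show ?thesis unfolding 0 by (simp only: mult_zero_left mult_zero_right diff_0)
qed

context real_system
begin

text \<open>The flip negates the single factor for row \<open>i0\<close>. The factors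
  \<open>\<phi> j\<close> read rows of degree 1 only, and \<open>i0\<close> is not one of
  them.\<close>

lemma xor_block_flip:
  assumes W: "W \<in> blocks" and xb: "xor_block A B f g W p q"
    and e0: "(i0, j0) \<in> W \<inter> core" and fl: "flips (bool_fun B (g i0)) j0"
  shows "p (restrict (row_point (z((i0, j0) := \<not> z (i0, j0)))) (rows_of W)) =
    - p (restrict (row_point z) (rows_of W))"
proof -
  define z' where "z' = z((i0, j0) := \<not> z (i0, j0))"
  define R where "R = rows_ge2 B g W"
  have R: "R = {i \<in> rows_of W. junta2 (bool_fun B (g i))}" unfolding R_def by (rule rows_ge2_block[OF W])
  have RA: "R \<subseteq> A" using rows_of_block[OF W] by (auto simp: R)
  have finR: "finite R" using RA finA finite_subset by blast
  have i0: "i0 \<in> R" using e0 by (force simp: R rows_of_def core_def)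
  obtain \<phi> where p: "\<And>x. x \<in> cube A \<Longrightarrow> p (restrict x (rows_of W)) = (\<Prod>i\<in>R. x i) *
      (\<Prod>j\<in>cols_ge2 A f W. \<phi> j (restrict (sgn_point A B g x) (dep_eq1 A (f j) B g)))"
    using xb unfolding xor_block_def R_def by blast
  have other: "row_point z' i = row_point z i" if "i \<in> A" "i \<noteq> i0" for i
    using that row_value_upd[of i i0 z j0] by (simp add: row_point_def z'_def)
  have at: "row_point z' i0 = - row_point z i0"
  proof -
    have "row_value z' i0 = (\<not> row_value z i0)"
      using flipsD[OF fl, of "\<lambda>j. z (i0, j)"] unfolding z'_def row_value_upd_same
      by (simp add: row_value_def)
    then show ?thesis using i0 RA by (simp add: row_point_def subset_iff)
  qed
  have "(\<Prod>i\<in>R. row_point z' i) = - (\<Prod>i\<in>R. row_point z i)"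
  proof -
    have "(\<Prod>i\<in>R - {i0}. row_point z' i) = (\<Prod>i\<in>R - {i0}. row_point z i)"
      using other RA by (intro prod.cong) auto
    then show ?thesis unfolding prod.remove[OF finR i0] at by simp
  qed
  moreover have "restrict (sgn_point A B g (row_point z')) (dep_eq1 A (f j) B g) =
      restrict (sgn_point A B g (row_point z)) (dep_eq1 A (f j) B g)" if "j \<in> cols_ge2 A f W" for j
  proof (rule restrict_ext)
    fix i assume i: "i \<in> dep_eq1 A (f j) B g"
    have j: "j \<in> B" using that cols_of_block[OF W] by (auto simp: cols_ge2_def)
    have "i \<noteq> i0" "i \<in> A" using i i0 dep_split_f(3)[OF j] unfolding dep_eq1_f[OF j] R by auto
    then show "sgn_point A B g (row_point z') i = sgn_point A B g (row_point z) i"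
      using other[of i] by (simp add: sgn_point_def)
  qed
  ultimately show ?thesis
    unfolding p[OF row_point_in_cube] z'_def[symmetric] by simp
qed

lemma dictator_if_deg_1:
  "i \<in> A \<Longrightarrow> deg B (g i) = 1 \<Longrightarrow> dictator B (g i)"
  using deg_g(1)[of i] constant_iff_bdep_empty[OF finB g_bool[of i]] g_nonconst[of i]
    not_junta2_cases[of "bool_fun B (g i)"]
  unfolding dictator_def dep_F Dep_eq_bdep[OF g_bool[of i]] by (auto simp: Dep_eq_bdep[OF g_bool])

text \<open>\<open>P\<close> treats rows and columns alike, so it serves as the common value of
  \<open>p\<close> and \<open>q\<close>. When all rows of degree at least 2 have their forcing
  value, every core cell carries its bit \<open>\<kappa> i j\<close>, and then the forced part of a
  column says exactly that its value is \<open>\<beta> j\<close>. The argument for \<open>q\<close>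
  starts from the columns.\<close>

lemma and_block_exists:
  fixes W \<kappa> d \<beta>
  defines "P \<equiv> \<lambda>z. \<forall>(i, j)\<in>W. (junta2 (bool_fun B (g i)) \<longrightarrow> row_value z i = d i) \<and>
    (junta2 (bool_fun A (f j)) \<longrightarrow> col_value z j = \<beta> j)"
  assumes W: "W \<in> blocks"
    and "and": "\<And>i j. (i, j) \<in> W \<inter> core \<Longrightarrow> and_cell (i, j) (\<kappa> i j) (d i) (\<beta> j)"
  shows "\<exists>p q. p \<in> cube (rows_of W) \<rightarrow> {-1, 1} \<and> q \<in> cube (cols_of W) \<rightarrow> {-1, 1} \<and>
    and_block A B f g W p q \<and>
    (\<forall>z. p (restrict (row_point z) (rows_of W)) = sign_of (P z)) \<and>
    (\<forall>z. q (restrict (col_point z) (cols_of W)) = sign_of (P z))"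
proof -
  define S where "S j = dep_eq1 A (f j) B g" for j
  define T where "T i = dep_eq1 B (g i) A f" for i
  define S2 where "S2 j = dep_ge2 A (f j) B g" for j
  define T2 where "T2 i = dep_ge2 B (g i) A f" for i
  define R C where "R = rows_ge2 B g W" and "C = cols_ge2 A f W"
  have R: "R = {i \<in> rows_of W. junta2 (bool_fun B (g i))}" unfolding R_def by (rule rows_ge2_block[OF W])
  have C: "C = {j \<in> cols_of W. junta2 (bool_fun A (f j))}" unfolding C_def by (rule cols_ge2_block[OF W])
  have fin: "finite R" "finite C"
    using finite_block[OF W] unfolding R C rows_of_def cols_of_def by auto
  have RA: "i \<in> A" "i \<in> rows_of W" if "i \<in> R" for i using that rows_of_block[OF W] by (auto simp: R)
  have CB: "j \<in> B" "j \<in> cols_of W" if "j \<in> C" for j using that cols_of_block[OF W] by (auto simp: C)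
  have T2: "j \<in> C \<and> (i, j) \<in> W \<inter> core" if "i \<in> R" "j \<in> T2 i" for i j
    using dep_g_block(2,3)[OF W RA(2)[OF that(1)]] that block_subset[OF W]
    unfolding T2_def dep_ge2_g[OF RA(1)[OF that(1)]] C R core_def by auto
  have S2: "i \<in> R \<and> (i, j) \<in> W \<inter> core" if "j \<in> C" "i \<in> S2 j" for i j
    using dep_f_block(2,3)[OF W CB(2)[OF that(1)]] that block_subset[OF W]
    unfolding S2_def dep_ge2_f[OF CB(1)[OF that(1)]] C R core_def by auto
  have fo: "forces (bool_fun B (g i)) (d i) j (\<kappa> i j)" "forces (bool_fun A (f j)) (\<beta> j) i (\<kappa> i j)"
    if "(i, j) \<in> W \<inter> core" for i j
    using "and"[OF that] by (simp_all add: and_cell_def)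
  define \<phi> where "\<phi> j = forced_part A (f j) (S j) (\<lambda>i. \<kappa> i j) (\<beta> j)" for j
  define \<gamma> where "\<gamma> i = forced_part B (g i) (T i) (\<kappa> i) (d i)" for i
  have \<phi>: "\<phi> j \<in> cube (S j) \<rightarrow> {0, 1}" "\<forall>x\<in>cube A. f j x = \<phi> j (restrict x (S j)) *
      (2 * sign_of (\<beta> j) * (\<Prod>i\<in>S2 j. (sign_of (\<kappa> i j) * x i + 1) / 2)) - sign_of (\<beta> j)"
    if j: "j \<in> C" for j
  proof -
    show "\<phi> j \<in> cube (S j) \<rightarrow> {0, 1}" by (auto simp: \<phi>_def forced_part_def)
    show "\<forall>x\<in>cube A. f j x = \<phi> j (restrict x (S j)) *
      (2 * sign_of (\<beta> j) * (\<Prod>i\<in>S2 j. (sign_of (\<kappa> i j) * x i + 1) / 2)) - sign_of (\<beta> j)"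
      unfolding \<phi>_def S_def S2_def
      using S2[OF j] fo(2) unfolding S2_def
      by (intro ballI forces_factor[OF finA f_bool[OF CB(1)[OF j]] dep_split_f(1,2)[OF CB(1)[OF j]]]) auto
  qed
  have \<gamma>: "\<gamma> i \<in> cube (T i) \<rightarrow> {0, 1}" "\<forall>y\<in>cube B. g i y = \<gamma> i (restrict y (T i)) *
      (2 * sign_of (d i) * (\<Prod>j\<in>T2 i. (sign_of (\<kappa> i j) * y j + 1) / 2)) - sign_of (d i)"
    if i: "i \<in> R" for i
  proof -
    show "\<gamma> i \<in> cube (T i) \<rightarrow> {0, 1}" by (auto simp: \<gamma>_def forced_part_def)
    show "\<forall>y\<in>cube B. g i y = \<gamma> i (restrict y (T i)) *
      (2 * sign_of (d i) * (\<Prod>j\<in>T2 i. (sign_of (\<kappa> i j) * y j + 1) / 2)) - sign_of (d i)"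
      unfolding \<gamma>_def T_def T2_def
      using T2[OF i] fo(1) unfolding T2_def
      by (intro ballI forces_factor[OF finB g_bool[OF RA(1)[OF i]] dep_split_g(1,2)[OF RA(1)[OF i]]]) auto
  qed
  define p where "p x = 2 * (\<Prod>i\<in>R. (sign_of (d i) * x i + 1) / 2) *
    (\<Prod>j\<in>C. \<phi> j (restrict (sgn_point A B g x) (S j))) - 1" for x
  define q where "q y = 2 * (\<Prod>j\<in>C. (sign_of (\<beta> j) * y j + 1) / 2) *
    (\<Prod>i\<in>R. \<gamma> i (restrict (sgn_point B A f y) (T i))) - 1" for y
  have p: "p (restrict x (rows_of W)) = p x" for x
    unfolding p_def S_def using sgn_point_restrict_rows[OF W]
    by (intro arg_cong2[of _ _ _ _ "(-)"] arg_cong2[of _ _ _ _ "(*)"] prod.cong) (auto simp: R C)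
  have q: "q (restrict y (cols_of W)) = q y" for y
    unfolding q_def T_def using sgn_point_restrict_cols[OF W]
    by (intro arg_cong2[of _ _ _ _ "(-)"] arg_cong2[of _ _ _ _ "(*)"] prod.cong) (auto simp: R C)
  have P: "P z \<longleftrightarrow> (\<forall>i\<in>R. row_value z i = d i) \<and> (\<forall>j\<in>C. col_value z j = \<beta> j)" for z
    unfolding P_def R C rows_of_def cols_of_def by fastforce
  have p_val: "p (row_point z) = sign_of (P z)" for z
  proof -
    have "p (row_point z) = 2 * (\<Prod>i\<in>R. (sign_of (d i) * sign_of (row_value z i) + 1) / 2) *
        (\<Prod>j\<in>C. \<phi> j (restrict (point A (\<lambda>i. z (i, j))) (S j))) - 1"
      unfolding p_def S_def using sgn_point_row_point CB RA
      by (intro arg_cong2[of _ _ _ _ "(-)"] arg_cong2[of _ _ _ _ "(*)"] prod.cong) (auto simp: row_point_def)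
    also have "\<dots> = sign_of (P z)"
      unfolding P
    proof (rule and_value[OF fin])
      fix j assume all: "\<forall>i\<in>R. row_value z i = d i" and j: "j \<in> C"
      have "z (i, j) = \<kappa> i j" if "i \<in> S2 j" for i
      proof -
        have "bool_fun B (g i) (\<lambda>j. z (i, j)) = d i"
          using all S2[OF j that] by (auto simp: row_value_def)
        then show ?thesis using forcesD[OF fo(1)[of i j], of "\<lambda>j. z (i, j)"] S2[OF j that] by blast
      qed
      then show "\<phi> j (restrict (point A (\<lambda>i. z (i, j))) (S j)) = (if col_value z j = \<beta> j then 1 else 0)"
        unfolding \<phi>_def S_def S2_def col_value_def
        by (intro forced_part_point[OF finA f_bool[OF CB(1)[OF j]] dep_split_f(1,2)[OF CB(1)[OF j]]])
    qed
    finally show ?thesis .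
  qed
  have q_val: "q (col_point z) = sign_of (P z)" for z
  proof -
    have "q (col_point z) = 2 * (\<Prod>j\<in>C. (sign_of (\<beta> j) * sign_of (col_value z j) + 1) / 2) *
        (\<Prod>i\<in>R. \<gamma> i (restrict (point B (\<lambda>j. z (i, j))) (T i))) - 1"
      unfolding q_def T_def using sgn_point_col_point CB RA
      by (intro arg_cong2[of _ _ _ _ "(-)"] arg_cong2[of _ _ _ _ "(*)"] prod.cong) (auto simp: col_point_def)
    also have "\<dots> = sign_of (P z)"
      unfolding P conj_commute[of "\<forall>i\<in>R. row_value z i = d i"]
    proof (rule and_value[OF fin(2,1)])
      fix i assume all: "\<forall>j\<in>C. col_value z j = \<beta> j" and i: "i \<in> R"
      have "z (i, j) = \<kappa> i j" if "j \<in> T2 i" for j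
      proof -
        have "bool_fun A (f j) (\<lambda>i. z (i, j)) = \<beta> j"
          using all T2[OF i that] by (auto simp: col_value_def)
        then show ?thesis using forcesD[OF fo(2)[of i j], of "\<lambda>i. z (i, j)"] T2[OF i that] by blast
      qed
      then show "\<gamma> i (restrict (point B (\<lambda>j. z (i, j))) (T i)) = (if row_value z i = d i then 1 else 0)"
        unfolding \<gamma>_def T_def T2_def row_value_def
        by (intro forced_part_point[OF finB g_bool[OF RA(1)[OF i]] dep_split_g(1,2)[OF RA(1)[OF i]]])
    qed
    finally show ?thesis .
  qed
  have sgn: "sign_of t = - 1 \<or> sign_of t = 1" for t by (cases t) auto
  have "p \<in> cube (rows_of W) \<rightarrow> {-1, 1}"
    using row_point_surj[OF rows_of_block[OF W]] p p_val sgn by fastforce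
  moreover have "q \<in> cube (cols_of W) \<rightarrow> {-1, 1}"
    using col_point_surj[OF cols_of_block[OF W]] q q_val sgn by fastforce
  moreover have "and_block A B f g W p q"
    unfolding and_block_def
  proof (intro conjI ballI exI[of _ "\<lambda>j. sign_of (\<beta> j)"] exI[of _ "\<lambda>i. sign_of (d i)"]
      exI[of _ "\<lambda>i j. sign_of (\<kappa> i j)"] exI[of _ \<phi>] exI[of _ \<gamma>])
    show "dictator B (g i)" if "i \<in> rows_eq1 B g W" for i
      using that rows_of_block[OF W] by (intro dictator_if_deg_1) (auto simp: rows_eq1_def)
    show "dictator A (f j)" if "j \<in> cols_eq1 A f W" for j
      using that cols_of_block[OF W]
      by (intro real_system.dictator_if_deg_1[OF real_swapped]) (auto simp: cols_eq1_def)
  qed (use \<phi> \<gamma> p q sgn in \<open>auto simp: p_def q_def S_def T_def S2_def T2_def R_def C_def\<close>)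
  ultimately show ?thesis
    by (intro exI[of _ p] exI[of _ q] conjI allI) (simp_all add: p q p_val q_val)
qed

text \<open>Without core cells, every column met by row \<open>i\<close> belongs to a dictator and
  contains no second cell, so no path leaves the row: the block is a star.\<close>

lemma row_of_noncore_block:
  assumes W: "W \<in> blocks" "W \<inter> core = {}" and ij: "(i, j) \<in> W" "junta2 (bool_fun B (g i))"
  shows "rows_of W = {i}" "\<And>b. b \<in> cols_of W \<Longrightarrow> (i, b) \<in> W \<and> \<not> junta2 (bool_fun A (f b))"
proof -
  have col: "\<not> junta2 (bool_fun A (f b))" if "(i, b) \<in> W" for b
    using that W ij(2) block_subset[OF W(1)] by (auto simp: core_def)
  have row: "fst e = i" if "e \<in> W" for e
  proof -
    have "((i, j), e) \<in> link\<^sup>*" by (rule block_connected[OF W(1) ij(1) that])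
    then have "e \<in> W \<and> fst e = i"
    proof induction
      case base
      then show ?case using ij by simp
    next
      case (step e e')
      obtain b a' b' where e: "e = (i, b)" "e' = (a', b')" using step.IH by (metis prod.collapse)
      have l: "(a', b') \<in> cells" "a' = i \<or> b' = b" using step.hyps(2) by (auto simp: link_def e)
      then have W': "(a', b') \<in> W" using block_closed[OF W(1), of e e'] step.IH by (auto simp: e)
      have "a' = i"
      proof (rule ccontr)
        assume "a' \<noteq> i"
        then have "b' = b" using l by simp
        then have "a' \<in> bdep (bool_fun A (f b))" "i \<in> bdep (bool_fun A (f b))"
          using cellsD(4) l(1) step.IH block_subset[OF W(1)] by (auto simp: e)
        with col[of b] step.IH \<open>a' \<noteq> i\<close> show False using not_junta2_unique by (metis e(1))
      qed
      with W' show ?case by (simp add: e)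
    qed
    then show ?thesis ..
  qed
  have "rows_of W \<subseteq> {i}" unfolding rows_of_def using row by blast
  moreover have "i \<in> rows_of W" unfolding rows_of_def using ij(1) by (rule rev_image_eqI) simp
  ultimately show "rows_of W = {i}" by blast
  show "(i, b) \<in> W \<and> \<not> junta2 (bool_fun A (f b))" if b: "b \<in> cols_of W" for b
  proof -
    obtain a where "(a, b) \<in> W" using b by (auto simp: cols_of_def)
    moreover from row[OF this] have "a = i" by simp
    ultimately show ?thesis using col by blast
  qed
qed

lemma col_of_noncore_block:
  assumes W: "W \<in> blocks" "W \<inter> core = {}" and ij: "(i, j) \<in> W" "junta2 (bool_fun A (f j))"
  shows "cols_of W = {j}" "\<And>a. a \<in> rows_of W \<Longrightarrow> (a, j) \<in> W \<and> \<not> junta2 (bool_fun B (g a))"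
proof -
  have row: "\<not> junta2 (bool_fun B (g a))" if "(a, j) \<in> W" for a
    using that W ij(2) block_subset[OF W(1)] by (auto simp: core_def)
  have col: "snd e = j" if "e \<in> W" for e
  proof -
    have "((i, j), e) \<in> link\<^sup>*" by (rule block_connected[OF W(1) ij(1) that])
    then have "e \<in> W \<and> snd e = j"
    proof induction
      case base
      then show ?case using ij by simp
    next
      case (step e e')
      obtain a a' b' where e: "e = (a, j)" "e' = (a', b')" using step.IH by (metis prod.collapse)
      have l: "(a', b') \<in> cells" "a' = a \<or> b' = j" using step.hyps(2) by (auto simp: link_def e)
      then have W': "(a', b') \<in> W" using block_closed[OF W(1), of e e'] step.IH by (auto simp: e)
      have "b' = j"
      proof (rule ccontr)
        assume "b' \<noteq> j"
        then have "a' = a" using l by simp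
        then have "b' \<in> bdep (bool_fun B (g a))" "j \<in> bdep (bool_fun B (g a))"
          using cellsD(3) l(1) step.IH block_subset[OF W(1)] by (auto simp: e)
        with row[of a] step.IH \<open>b' \<noteq> j\<close> show False using not_junta2_unique by (metis e(1))
      qed
      with W' show ?case by (simp add: e)
    qed
    then show ?thesis ..
  qed
  have "cols_of W \<subseteq> {j}" unfolding cols_of_def using col by blast
  moreover have "j \<in> cols_of W" unfolding cols_of_def using ij(1) by (rule rev_image_eqI) simp
  ultimately show "cols_of W = {j}" by blast
  show "(a, j) \<in> W \<and> \<not> junta2 (bool_fun B (g a))" if a: "a \<in> rows_of W" for a
  proof -
    obtain b where "(a, b) \<in> W" using a by (auto simp: rows_of_def)
    moreover from col[OF this] have "b = j" by simp
    ultimately show ?thesis using row by blast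
  qed
qed

text \<open>The last conjunct is what makes the outer function \<open>h\<close> well defined: inside
  a block, the output can change only along with the block function.\<close>

lemma block_form:
  assumes W: "W \<in> blocks"
  shows "\<exists>p q. p \<in> cube (rows_of W) \<rightarrow> {-1, 1} \<and> q \<in> cube (cols_of W) \<rightarrow> {-1, 1} \<and>
    (singleton_block A B f g W p q \<or> xor_block A B f g W p q \<or> and_block A B f g W p q) \<and>
    (\<forall>z. p (restrict (row_point z) (rows_of W)) = q (restrict (col_point z) (cols_of W))) \<and>
    (\<forall>z z'. (\<forall>e. e \<notin> W \<longrightarrow> z' e = z e) \<longrightarrow>
      p (restrict (row_point z') (rows_of W)) = p (restrict (row_point z) (rows_of W)) \<longrightarrow>
      outp z' = outp z)"
proof (cases "W \<inter> core = {}")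
  case False
  then obtain i0 j0 where e0: "(i0, j0) \<in> W \<inter> core" by fastforce
  show ?thesis
  proof (cases "xor_cell (i0, j0)")
    case True
    then have xor: "xor_cell e" if "e \<in> W \<inter> core" for e using core_block_uniform[OF W e0 that] by blast
    have core: "(i, j) \<in> core" if "(i, j) \<in> W" "junta2 (bool_fun B (g i))" "junta2 (bool_fun A (f j))" for i j
      using that block_subset[OF W] by (auto simp: core_def)
    have xr: "flips (bool_fun A (f j)) i" if ij: "(i, j) \<in> W" "junta2 (bool_fun B (g i))" for i j
    proof (cases "junta2 (bool_fun A (f j))")
      case True
      then show ?thesis using xor[of "(i, j)"] core ij by (auto simp: xor_cell_def)
    next
      case False
      then show ?thesis
        using dictator_f(3)[of i j] ij block_subset[OF W] by (intro flips_if_bdep_singleton[OF fsupp_f]) auto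
    qed
    have xc: "flips (bool_fun B (g i)) j" if ij: "(i, j) \<in> W" "junta2 (bool_fun A (f j))" for i j
    proof (cases "junta2 (bool_fun B (g i))")
      case True
      then show ?thesis using xor[of "(i, j)"] core ij by (auto simp: xor_cell_def)
    next
      case False
      then show ?thesis
        using dictator_g(3)[of i j] ij block_subset[OF W] by (intro flips_if_bdep_singleton[OF fsupp_g]) auto
    qed
    obtain p q where pq: "p \<in> cube (rows_of W) \<rightarrow> {-1, 1}" "q \<in> cube (cols_of W) \<rightarrow> {-1, 1}"
      "xor_block A B f g W p q"
      and eq: "\<And>z. p (restrict (row_point z) (rows_of W)) = q (restrict (col_point z) (cols_of W))"
      using xor_block_exists[OF W xr xc] by blast
    have fl: "flips (bool_fun B (g i0)) j0" using True by (simp add: xor_cell_def)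
    have U: "\<forall>z z'. (\<forall>e. e \<notin> W \<longrightarrow> z' e = z e) \<longrightarrow>
      p (restrict (row_point z') (rows_of W)) = p (restrict (row_point z) (rows_of W)) \<longrightarrow>
      outp z' = outp z"
    proof (intro allI impI)
      fix z z' assume ag: "\<forall>e. e \<notin> W \<longrightarrow> z' e = z e"
        and pz: "p (restrict (row_point z') (rows_of W)) = p (restrict (row_point z) (rows_of W))"
      show "outp z' = outp z"
      proof (rule xor_block_outp[OF W e0 xor, where \<pi> = "\<lambda>z. p (restrict (row_point z) (rows_of W))"])
      show "p (restrict (row_point z) (rows_of W)) = p (restrict (row_point z') (rows_of W))"
        if "row_value z = row_value z'" for z z' using that by (simp add: row_point_def)
      show "p (restrict (row_point z) (rows_of W)) = p (restrict (row_point z') (rows_of W))"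
        if "col_value z = col_value z'" for z z' unfolding eq using that by (simp add: col_point_def)
      show "p (restrict (row_point (z((i0, j0) := \<not> z (i0, j0)))) (rows_of W)) \<noteq>
          p (restrict (row_point z) (rows_of W))" for z
      proof -
        have "p (restrict (row_point z) (rows_of W)) \<in> {-1, 1}"
          using pq(1) restrict_in_cube[OF rows_of_block[OF W] row_point_in_cube] by blast
        then show ?thesis unfolding xor_block_flip[OF W pq(3) e0 fl] by auto
      qed
      qed (use ag pz in blast)+
    qed
    show ?thesis
      using pq eq U by (intro exI[of _ p] exI[of _ q] conjI) blast+
  next
    case False
    obtain \<kappa> d \<beta> where *: "\<forall>i j. (i, j) \<in> core \<longrightarrow> \<not> xor_cell (i, j) \<longrightarrow>
        and_cell (i, j) (\<kappa> i j) (d i) (\<beta> j)"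
      using and_cell_parameters by (elim exE)
    have "and": "and_cell (i, j) (\<kappa> i j) (d i) (\<beta> j)" if "(i, j) \<in> W \<inter> core" for i j
    proof (rule *[rule_format])
      show "(i, j) \<in> core" using that by simp
      show "\<not> xor_cell (i, j)" using core_block_uniform[OF W that e0] False by metis
    qed
    define P where "P z \<longleftrightarrow> (\<forall>(i, j)\<in>W. (junta2 (bool_fun B (g i)) \<longrightarrow> row_value z i = d i) \<and>
      (junta2 (bool_fun A (f j)) \<longrightarrow> col_value z j = \<beta> j))" for z
    obtain p q where pq: "p \<in> cube (rows_of W) \<rightarrow> {-1, 1}" "q \<in> cube (cols_of W) \<rightarrow> {-1, 1}"
      "and_block A B f g W p q"
      and val: "\<And>z. p (restrict (row_point z) (rows_of W)) = sign_of (P z)"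
      "\<And>z. q (restrict (col_point z) (cols_of W)) = sign_of (P z)"
      using and_block_exists[OF W "and"] unfolding P_def[symmetric] by blast
    have U: "\<forall>z z'. (\<forall>e. e \<notin> W \<longrightarrow> z' e = z e) \<longrightarrow>
      p (restrict (row_point z') (rows_of W)) = p (restrict (row_point z) (rows_of W)) \<longrightarrow>
      outp z' = outp z"
    proof (intro allI impI)
      fix z z' assume ag: "\<forall>e. e \<notin> W \<longrightarrow> z' e = z e"
        and pz: "p (restrict (row_point z') (rows_of W)) = p (restrict (row_point z) (rows_of W))"
      have PP: "P z' = P z" using pz unfolding val by simp
      show "outp z' = outp z"
        by (rule and_block_outp[where W = W and \<kappa> = \<kappa> and d = d and \<beta> = \<beta>, OF W e0])
          (fact "and" ag[rule_format] PP[unfolded P_def])+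
    qed
    have eq: "p (restrict (row_point z) (rows_of W)) = q (restrict (col_point z) (cols_of W))" for z
      unfolding val ..
    show ?thesis
      using pq eq U by (intro exI[of _ p] exI[of _ q] conjI) blast+
  qed
next
  case noncore: True
  obtain i j where ij: "(i, j) \<in> W" using block_nonempty[OF W] by fastforce
  note ijc = ij[THEN subsetD[OF block_subset[OF W]]]
  have ijAB: "i \<in> A" "j \<in> B" using cellsD[OF ijc] by auto
  have outp_rows: "outp z' = outp z"
    if r: "rows_of W = {i}" and ag: "\<forall>e. e \<notin> W \<longrightarrow> z' e = z e" and e: "row_point z' i = row_point z i" for z z'
  proof (rule outp_eq_if_rows)
    fix a
    show "row_value z' a = row_value z a"
    proof (cases "a = i")
      case True
      then show ?thesis using e ijAB by (simp add: row_point_def)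
    next
      case False
      then have "(a, b) \<notin> W" for b using r by (force simp: rows_of_def)
      then show ?thesis using ag by (simp add: row_value_def)
    qed
  qed
  have outp_cols: "outp z' = outp z"
    if r: "cols_of W = {j}" and ag: "\<forall>e. e \<notin> W \<longrightarrow> z' e = z e" and e: "col_point z' j = col_point z j" for z z'
  proof (rule outp_eq_if_cols)
    fix b
    show "col_value z' b = col_value z b"
    proof (cases "b = j")
      case True
      then show ?thesis using e ijAB by (simp add: col_point_def)
    next
      case False
      then have "(a, b) \<notin> W" for a using r by (force simp: cols_of_def)
      then show ?thesis using ag by (simp add: col_value_def)
    qed
  qed
  consider (row) "junta2 (bool_fun B (g i))" | (col) "junta2 (bool_fun A (f j))"
    | (single) "\<not> junta2 (bool_fun B (g i))" "\<not> junta2 (bool_fun A (f j))" by blast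
  then show ?thesis
  proof cases
    \<comment> \<open>The columns are dictators, so \<open>dep_ge2\<close> of \<open>g i\<close> is
      empty and the XOR shape holds with \<open>g i\<close> itself as the factor; nothing about
      \<open>g i\<close> has to be known.\<close>
    case row
    note star = row_of_noncore_block[OF W noncore ij row]
    have eq_i: "a = i" "\<not> junta2 (bool_fun A (f b))" if "(a, b) \<in> W" for a b
    proof -
      have "a \<in> rows_of W" "b \<in> cols_of W" using that by (force simp: rows_of_def cols_of_def)+
      then show "a = i" "\<not> junta2 (bool_fun A (f b))" using star by auto
    qed
    obtain p q where pq: "p \<in> cube (rows_of W) \<rightarrow> {-1, 1}" "q \<in> cube (cols_of W) \<rightarrow> {-1, 1}"
      "xor_block A B f g W p q"
      and eq: "\<And>z. p (restrict (row_point z) (rows_of W)) = q (restrict (col_point z) (cols_of W))"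
    proof -
      have "\<exists>p q. p \<in> cube (rows_of W) \<rightarrow> {-1, 1} \<and> q \<in> cube (cols_of W) \<rightarrow> {-1, 1} \<and>
        xor_block A B f g W p q \<and>
        (\<forall>z. p (restrict (row_point z) (rows_of W)) = q (restrict (col_point z) (cols_of W)))"
      proof (rule xor_block_exists[OF W])
        fix a b assume ab: "(a, b) \<in> W"
        show "flips (bool_fun A (f b)) a"
          using dictator_f(3)[of a b] eq_i[OF ab] ab block_subset[OF W]
          by (intro flips_if_bdep_singleton[OF fsupp_f]) auto
        show "flips (bool_fun B (g a)) b" if "junta2 (bool_fun A (f b))"
          using that eq_i[OF ab] by blast
      qed
      with that show thesis by blast
    qed
    \<comment> \<open>Both index sets of the XOR formula degenerate and \<open>p\<close> is the bare
      coordinate \<open>x i\<close>, so keeping \<open>p\<close> means keeping the value of the only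
      row.\<close>
    have R: "rows_ge2 B g W = {i}" "cols_ge2 A f W = {}"
      unfolding rows_ge2_block[OF W] cols_ge2_block[OF W] star(1) using row star(2) by auto
    have "p (restrict x (rows_of W)) = x i" if "x \<in> cube A" for x
      using pq(3) that unfolding xor_block_def R by auto
    note p_eq = this
    have U: "\<forall>z z'. (\<forall>e. e \<notin> W \<longrightarrow> z' e = z e) \<longrightarrow>
      p (restrict (row_point z') (rows_of W)) = p (restrict (row_point z) (rows_of W)) \<longrightarrow>
      outp z' = outp z"
      using outp_rows[OF star(1)] unfolding p_eq[OF row_point_in_cube] by blast
    show ?thesis
      using pq eq U by (intro exI[of _ p] exI[of _ q] conjI) blast+
  next
    case col
    note star = col_of_noncore_block[OF W noncore ij col]
    have eq_j: "b = j" "\<not> junta2 (bool_fun B (g a))" if "(a, b) \<in> W" for a b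
    proof -
      have "a \<in> rows_of W" "b \<in> cols_of W" using that by (force simp: rows_of_def cols_of_def)+
      then show "b = j" "\<not> junta2 (bool_fun B (g a))" using star by auto
    qed
    obtain p q where pq: "p \<in> cube (rows_of W) \<rightarrow> {-1, 1}" "q \<in> cube (cols_of W) \<rightarrow> {-1, 1}"
      "xor_block A B f g W p q"
      and eq: "\<And>z. p (restrict (row_point z) (rows_of W)) = q (restrict (col_point z) (cols_of W))"
    proof -
      have "\<exists>p q. p \<in> cube (rows_of W) \<rightarrow> {-1, 1} \<and> q \<in> cube (cols_of W) \<rightarrow> {-1, 1} \<and>
        xor_block A B f g W p q \<and>
        (\<forall>z. p (restrict (row_point z) (rows_of W)) = q (restrict (col_point z) (cols_of W)))"
      proof (rule xor_block_exists[OF W])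
        fix a b assume ab: "(a, b) \<in> W"
        show "flips (bool_fun A (f b)) a" if "junta2 (bool_fun B (g a))"
          using that eq_j[OF ab] by blast
        show "flips (bool_fun B (g a)) b"
          using dictator_g(3)[of a b] eq_j[OF ab] ab block_subset[OF W]
          by (intro flips_if_bdep_singleton[OF fsupp_g]) auto
      qed
      with that show thesis by blast
    qed
    have R: "cols_ge2 A f W = {j}" "rows_ge2 B g W = {}"
      unfolding rows_ge2_block[OF W] cols_ge2_block[OF W] star(1) using col star(2) by auto
    have "q (restrict y (cols_of W)) = y j" if "y \<in> cube B" for y
      using pq(3) that unfolding xor_block_def R by auto
    note q_eq = this
    have U: "\<forall>z z'. (\<forall>e. e \<notin> W \<longrightarrow> z' e = z e) \<longrightarrow>
      p (restrict (row_point z') (rows_of W)) = p (restrict (row_point z) (rows_of W)) \<longrightarrow>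
      outp z' = outp z"
      using outp_cols[OF star(1)] unfolding eq q_eq[OF col_point_in_cube] by blast
    show ?thesis
      using pq eq U by (intro exI[of _ p] exI[of _ q] conjI) blast+
  next
    case single
    note dg = dictator_g[OF ijc single(1)] and df = dictator_f[OF ijc single(2)]
    have W1: "W = {(i, j)}"
    proof -
      have "e = (i, j)" if "e \<in> W" for e
      proof -
        have "((i, j), e) \<in> link\<^sup>*" by (rule block_connected[OF W ij that])
        then show ?thesis
        proof induction
          case (step e e')
          then have "e' \<in> cells" "fst e' = i \<or> snd e' = j" by (auto simp: link_def)
          then show ?case using dg(3) df(3) cellsD(3,4)[of "fst e'" "snd e'"] by (cases e') auto
        qed simp
      qed
      then show ?thesis using ij by blast
    qed
    have rc: "rows_of W = {i}" "cols_of W = {j}" by (simp_all add: W1 rows_of_def cols_of_def)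
    define p where "p x = dict_sgn A (f j) * x i" for x :: "'a \<Rightarrow> real"
    define q where "q y = dict_sgn B (g i) * y j" for y :: "'b \<Rightarrow> real"
    have "p \<in> cube (rows_of W) \<rightarrow> {-1, 1}"
      using df(1) cube_values[of _ "{i}" i] unfolding rc p_def by fastforce
    moreover have "q \<in> cube (cols_of W) \<rightarrow> {-1, 1}"
      using dg(1) cube_values[of _ "{j}" j] unfolding rc q_def by fastforce
    moreover have "singleton_block A B f g W p q"
      unfolding singleton_block_def rc
      using W1 df(2) dg(2) by (intro exI[of _ i] exI[of _ j]) (auto simp: p_def q_def)
    moreover have "p (restrict (row_point z) (rows_of W)) = q (restrict (col_point z) (cols_of W))" for z
      using df(2) dg(2) ijAB by (simp add: rc p_def q_def row_point_eq col_point_eq)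
    moreover have p_eq: "p (restrict (row_point z') (rows_of W)) = p (restrict (row_point z) (rows_of W)) \<longleftrightarrow>
        row_point z' i = row_point z i" for z z'
      using df(1) by (auto simp: rc p_def)
    have "\<forall>z z'. (\<forall>e. e \<notin> W \<longrightarrow> z' e = z e) \<longrightarrow>
      p (restrict (row_point z') (rows_of W)) = p (restrict (row_point z) (rows_of W)) \<longrightarrow>
      outp z' = outp z"
      using outp_rows[OF rc(1)] unfolding p_eq by blast
    ultimately show ?thesis
      by (intro exI[of _ p] exI[of _ q] conjI) blast+
  qed
qed

end

section \<open>The decomposition into blocks\<close>

context real_system
begin

lemma F_row_point: "F (row_point z) = sign_of (outp z)"
  unfolding row_point_def outp_def by (rule bool_fun_value[OF F_bool])

lemma G_col_point: "G (col_point z) = sign_of (outp z)"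
  unfolding col_point_def outp_col by (rule bool_fun_value[OF G_bool])

lemma block_decomposition:
  "\<exists>Z\<^sub>0 (k::nat) Z h f0 g0.
       Z\<^sub>0 \<subseteq> A \<times> B \<and>
       Z\<^sub>0 = (\<Union>l\<in>{1..k}. Z l) \<and> (\<forall>l\<in>{1..k}. Z l \<noteq> {}) \<and> disjoint_family_on Z {1..k} \<and>
       disjoint_family_on (\<lambda>l. rows_of (Z l)) {1..k} \<and>
       disjoint_family_on (\<lambda>l. cols_of (Z l)) {1..k} \<and>
       (\<forall>l\<in>{1..k}. \<forall>(i, j)\<in>Z l.
          Dep B (g i) \<subseteq> cols_of (Z l) \<and> Dep A (f j) \<subseteq> rows_of (Z l)) \<and>
       (\<forall>l\<in>{1..k}. \<forall>i\<in>rows_of (Z l). \<forall>j\<in>cols_of (Z l).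
          j \<in> Dep B (g i) \<longleftrightarrow> i \<in> Dep A (f j)) \<and>
       h \<in> cube {1..k} \<rightarrow> {-1, 1} \<and>
       (\<forall>l\<in>{1..k}. f0 l \<in> cube (rows_of (Z l)) \<rightarrow> {-1, 1} \<and>
                   g0 l \<in> cube (cols_of (Z l)) \<rightarrow> {-1, 1}) \<and>
       (\<forall>x\<in>cube A. F x = h (\<lambda>l\<in>{1..k}. f0 l (restrict x (rows_of (Z l))))) \<and>
       (\<forall>y\<in>cube B. G y = h (\<lambda>l\<in>{1..k}. g0 l (restrict y (cols_of (Z l))))) \<and>
       (\<forall>l\<in>{1..k}.
          singleton_block A B f g (Z l) (f0 l) (g0 l) \<or>
          xor_block A B f g (Z l) (f0 l) (g0 l) \<or>
          and_block A B f g (Z l) (f0 l) (g0 l))"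
proof -
  obtain Z where Z: "bij_betw Z {1..card blocks} blocks"
    using ex_bij_betw_nat_finite_1[OF finite_blocks] by blast
  define k where "k = card blocks"
  have ZW: "Z l \<in> blocks" if "l \<in> {1..k}" for l
    using that Z unfolding k_def by (rule_tac bij_betwE[rule_format])
  have Z_union: "(\<Union>l\<in>{1..k}. Z l) = cells"
    using Z Union_blocks unfolding k_def bij_betw_def by auto
  have Z_adj: "l = l'" if "l \<in> {1..k}" "l' \<in> {1..k}" "e \<in> Z l" "e' \<in> Z l'" "fst e = fst e' \<or> snd e = snd e'"
    for l l' e e'
  proof -
    have "Z l = Z l'" by (rule blocks_eq_if_adjacent[OF ZW[OF that(1)] ZW[OF that(2)] that(3-5)])
    then show ?thesis using Z that(1,2) unfolding k_def bij_betw_def by (auto dest: inj_onD)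
  qed
  define Q where "Q l pq \<longleftrightarrow> fst pq \<in> cube (rows_of (Z l)) \<rightarrow> {-1, 1} \<and>
    snd pq \<in> cube (cols_of (Z l)) \<rightarrow> {-1, 1} \<and>
    (singleton_block A B f g (Z l) (fst pq) (snd pq) \<or> xor_block A B f g (Z l) (fst pq) (snd pq) \<or>
      and_block A B f g (Z l) (fst pq) (snd pq)) \<and>
    (\<forall>z. fst pq (restrict (row_point z) (rows_of (Z l))) = snd pq (restrict (col_point z) (cols_of (Z l)))) \<and>
    (\<forall>z z'. (\<forall>e. e \<notin> Z l \<longrightarrow> z' e = z e) \<longrightarrow>
      fst pq (restrict (row_point z') (rows_of (Z l))) = fst pq (restrict (row_point z) (rows_of (Z l))) \<longrightarrow>
      outp z' = outp z)" for l pq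
  have "\<forall>l\<in>{1..k}. \<exists>pq. Q l pq"
  proof
    fix l assume l: "l \<in> {1..k}"
    obtain p q where "Q l (p, q)"
      using block_form[OF ZW[OF l]] unfolding Q_def fst_conv snd_conv by (elim exE)
    then show "\<exists>pq. Q l pq" ..
  qed
  from bchoice[OF this] obtain pq where pq: "\<forall>l\<in>{1..k}. Q l (pq l)" ..
  define f0 g0 where "f0 l = fst (pq l)" and "g0 l = snd (pq l)" for l
  have bool: "f0 l \<in> cube (rows_of (Z l)) \<rightarrow> {-1, 1}" "g0 l \<in> cube (cols_of (Z l)) \<rightarrow> {-1, 1}"
    and form: "singleton_block A B f g (Z l) (f0 l) (g0 l) \<or> xor_block A B f g (Z l) (f0 l) (g0 l) \<or>
      and_block A B f g (Z l) (f0 l) (g0 l)"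
    and f0_g0: "\<forall>z. f0 l (restrict (row_point z) (rows_of (Z l))) = g0 l (restrict (col_point z) (cols_of (Z l)))"
    and f0_outp: "\<forall>z z'. (\<forall>e. e \<notin> Z l \<longrightarrow> z' e = z e) \<longrightarrow>
      f0 l (restrict (row_point z') (rows_of (Z l))) = f0 l (restrict (row_point z) (rows_of (Z l))) \<longrightarrow>
      outp z' = outp z" if "l \<in> {1..k}" for l
    using bspec[OF pq that] unfolding Q_def f0_def g0_def by - (elim conjE, assumption)+
  define \<pi> where "\<pi> l z = f0 l (restrict (row_point z) (rows_of (Z l)))" for l z
  have \<pi>_col: "\<pi> l z = g0 l (restrict (col_point z) (cols_of (Z l)))" if "l \<in> {1..k}" for l z
    unfolding \<pi>_def by (rule f0_g0[OF that, rule_format])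
  have \<pi>_outp: "outp z' = outp z" if "l \<in> {1..k}" "\<forall>e. e \<notin> Z l \<longrightarrow> z' e = z e" "\<pi> l z' = \<pi> l z" for l z z'
    by (rule f0_outp[OF that(1), rule_format]) (use that(2,3) in \<open>auto simp: \<pi>_def\<close>)
  have \<pi>_local: "\<pi> l z' = \<pi> l z" if l: "l \<in> {1..k}" and ag: "\<forall>e\<in>Z l. z' e = z e" for l z z'
  proof -
    have "row_value z' i = row_value z i" if i: "i \<in> rows_of (Z l)" for i
      unfolding row_value_def
    proof (rule eq_if_agree_on_bdep[OF fsupp_g])
      fix j assume "j \<in> bdep (bool_fun B (g i))"
      then have "(i, j) \<in> Z l" by (rule dep_g_block(3)[OF ZW[OF l] i])
      with ag show "z' (i, j) = z (i, j)" by blast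
    qed
    then have "restrict (row_point z') (rows_of (Z l)) = restrict (row_point z) (rows_of (Z l))"
      by (intro restrict_ext) (auto simp: row_point_def point_def)
    then show ?thesis unfolding \<pi>_def by simp
  qed
  \<comment> \<open>The blocks of \<open>z\<close> are replaced by those of \<open>z'\<close> one at
    a time. Blocks are disjoint, and the function of a block sees only its own cells, so each
    replacement keeps the block function concerned and hence the output.\<close>
  have determined: "outp z' = outp z" if eq: "\<forall>l\<in>{1..k}. \<pi> l z' = \<pi> l z" for z z'
  proof -
    define mix where "mix L e = (if e \<in> (\<Union>l\<in>L. Z l) then z' e else z e)" for L e
    have "outp (mix L) = outp z" if "finite L" "L \<subseteq> {1..k}" for L
      using that
    proof induction
      case empty
      have "mix {} = z" by (simp add: mix_def fun_eq_iff)
      then show ?case by simp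
    next
      case (insert l L)
      have l: "l \<in> {1..k}" using insert.prems by simp
      have disj: "e \<notin> Z l'" if "e \<in> Z l" "l' \<in> L" for e l'
        using Z_adj[of l l' e e] that insert by blast
      have "\<pi> l (mix (insert l L)) = \<pi> l z'"
        by (rule \<pi>_local[OF l]) (simp add: mix_def)
      also have "\<dots> = \<pi> l z" using eq l by blast
      also have "\<dots> = \<pi> l (mix L)"
        by (rule \<pi>_local[OF l]) (use disj in \<open>auto simp: mix_def\<close>)
      finally have "\<pi> l (mix (insert l L)) = \<pi> l (mix L)" .
      moreover have "\<forall>e. e \<notin> Z l \<longrightarrow> mix (insert l L) e = mix L e" by (simp add: mix_def)
      ultimately have "outp (mix (insert l L)) = outp (mix L)" using \<pi>_outp[OF l] by blast
      then show ?case using insert by simp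
    qed
    from this[of "{1..k}"] have 1: "outp (mix {1..k}) = outp z" by simp
    \<comment> \<open>The mixture still carries the entries of \<open>z\<close> outside
      \<open>cells\<close>, but the relevant rows read no such entry.\<close>
    have "outp (mix {1..k}) = outp z'"
    proof (rule outp_eq_if_rows)
      fix i assume i: "i \<in> bdep (bool_fun A F)"
      show "row_value (mix {1..k}) i = row_value z' i"
        unfolding row_value_def
      proof (rule eq_if_agree_on_bdep[OF fsupp_g])
        fix j assume "j \<in> bdep (bool_fun B (g i))"
        with i have "(i, j) \<in> cells" by (simp add: cells_def)
        then show "mix {1..k} (i, j) = z' (i, j)" unfolding mix_def Z_union by simp
      qed
    qed
    with 1 show ?thesis by simp
  qed
  \<comment> \<open>By \<open>determined\<close> the chosen configuration does not matter. On tuples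
    that no configuration attains, the value 1 keeps \<open>h\<close> Boolean.\<close>
  define h where "h b = (if \<exists>z. \<forall>l\<in>{1..k}. \<pi> l z = b l
    then sign_of (outp (SOME z. \<forall>l\<in>{1..k}. \<pi> l z = b l)) else 1)" for b
  have h: "h b = sign_of (outp z)" if b: "\<forall>l\<in>{1..k}. \<pi> l z = b l" for b z
  proof -
    have "\<forall>l\<in>{1..k}. \<pi> l (SOME z. \<forall>l\<in>{1..k}. \<pi> l z = b l) = b l"
      by (rule someI[of "\<lambda>z. \<forall>l\<in>{1..k}. \<pi> l z = b l", OF b])
    then have "outp (SOME z. \<forall>l\<in>{1..k}. \<pi> l z = b l) = outp z" using b by (intro determined) simp
    then show ?thesis unfolding h_def using b by auto
  qed
  show ?thesis
  proof (intro exI[of _ cells] exI[of _ k] exI[of _ Z] exI[of _ h] exI[of _ f0] exI[of _ g0] conjI)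
    show "cells \<subseteq> A \<times> B" using cellsD(1,2) by auto
    show "cells = (\<Union>l\<in>{1..k}. Z l)" using Z_union by simp
    show "\<forall>l\<in>{1..k}. Z l \<noteq> {}" using block_nonempty ZW by blast
    show rows: "disjoint_family_on (\<lambda>l. rows_of (Z l)) {1..k}"
      unfolding disjoint_family_on_def rows_of_def using Z_adj by (auto simp del: split_paired_All)
    show "disjoint_family_on (\<lambda>l. cols_of (Z l)) {1..k}"
      unfolding disjoint_family_on_def cols_of_def using Z_adj by (auto simp del: split_paired_All)
    show "disjoint_family_on Z {1..k}"
      using rows unfolding disjoint_family_on_def rows_of_def by blast
    show "\<forall>l\<in>{1..k}. \<forall>(i, j)\<in>Z l. Dep B (g i) \<subseteq> cols_of (Z l) \<and> Dep A (f j) \<subseteq> rows_of (Z l)"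
    proof (intro ballI, clarify)
      fix l i j assume l: "l \<in> {1..k}" and ij: "(i, j) \<in> Z l"
      have ij': "i \<in> rows_of (Z l)" "j \<in> cols_of (Z l)" using ij by (force simp: rows_of_def cols_of_def)+
      show "Dep B (g i) \<subseteq> cols_of (Z l) \<and> Dep A (f j) \<subseteq> rows_of (Z l)"
        using dep_g_block(1,2)[OF ZW[OF l] ij'(1)] dep_f_block(1,2)[OF ZW[OF l] ij'(2)] dep_g dep_f by simp
    qed
    show "\<forall>l\<in>{1..k}. \<forall>i\<in>rows_of (Z l). \<forall>j\<in>cols_of (Z l). j \<in> Dep B (g i) \<longleftrightarrow> i \<in> Dep A (f j)"
    proof (intro ballI)
      fix l i j assume l: "l \<in> {1..k}" and i: "i \<in> rows_of (Z l)" and j: "j \<in> cols_of (Z l)"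
      have "(i, j) \<in> cells \<longleftrightarrow> j \<in> bdep (bool_fun B (g i))" "(i, j) \<in> cells \<longleftrightarrow> i \<in> bdep (bool_fun A (f j))"
        using dep_g_block(1)[OF ZW[OF l] i] dep_f_block(1)[OF ZW[OF l] j]
        by (simp add: cells_def dep_F, simp add: cells_col dep_G)
      then show "j \<in> Dep B (g i) \<longleftrightarrow> i \<in> Dep A (f j)"
        using dep_g[OF dep_g_block(1)[OF ZW[OF l] i]] dep_f[OF dep_f_block(1)[OF ZW[OF l] j]] by simp
    qed
    show "h \<in> cube {1..k} \<rightarrow> {-1, 1}" by (auto simp: h_def sign_of_def)
    show "\<forall>l\<in>{1..k}. f0 l \<in> cube (rows_of (Z l)) \<rightarrow> {-1, 1} \<and> g0 l \<in> cube (cols_of (Z l)) \<rightarrow> {-1, 1}"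
      using bool by blast
    show "\<forall>x\<in>cube A. F x = h (\<lambda>l\<in>{1..k}. f0 l (restrict x (rows_of (Z l))))"
    proof
      fix x assume "x \<in> cube A"
      then obtain z where x: "x = row_point z" using cube_row_point by blast
      show "F x = h (\<lambda>l\<in>{1..k}. f0 l (restrict x (rows_of (Z l))))"
        unfolding x F_row_point by (rule h[symmetric]) (simp add: \<pi>_def)
    qed
    show "\<forall>y\<in>cube B. G y = h (\<lambda>l\<in>{1..k}. g0 l (restrict y (cols_of (Z l))))"
    proof
      fix y assume "y \<in> cube B"
      then obtain z where y: "y = col_point z" using cube_col_point by blast
      show "G y = h (\<lambda>l\<in>{1..k}. g0 l (restrict y (cols_of (Z l))))"
        unfolding y G_col_point by (rule h[symmetric]) (simp add: \<pi>_col)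
    qed
    show "\<forall>l\<in>{1..k}. singleton_block A B f g (Z l) (f0 l) (g0 l) \<or>
          xor_block A B f g (Z l) (f0 l) (g0 l) \<or> and_block A B f g (Z l) (f0 l) (g0 l)"
      using form by blast
  qed
qed

end

section \<open>From the original functions to the reduced system\<close>

lemma restrict_coords_point:
  "S \<subseteq> A \<Longrightarrow> restrict_coords A S u (point S x) = u (point A (\<lambda>i. if i \<in> S then x i else True))"
  unfolding restrict_coords_def by (rule arg_cong[of _ _ u]) (auto simp: point_def fun_eq_iff)

lemma restrict_coords_bool:
  assumes "S \<subseteq> A" "u \<in> cube A \<rightarrow> {-1, 1}" shows "restrict_coords A S u \<in> cube S \<rightarrow> {-1, 1}"
proof
  fix x assume x: "x \<in> cube S"
  obtain x' where "x = point S x'" using cubeE[OF x] .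
  then show "restrict_coords A S u x \<in> {-1, 1}"
    using funcset_mem[OF assms(2) point_in_cube] by (simp add: restrict_coords_point[OF assms(1)])
qed

lemma bool_fun_restrict_coords:
  assumes "finite A" "S \<subseteq> A" "bdep (bool_fun A u) \<subseteq> S"
  shows "bool_fun S (restrict_coords A S u) = bool_fun A u"
proof
  fix x
  have "bool_fun A u (\<lambda>i. if i \<in> S then x i else True) = bool_fun A u x"
    by (rule eq_if_agree_on_bdep[OF fsupp_bool_fun[OF assms(1)]]) (use assms(3) in auto)
  then show "bool_fun S (restrict_coords A S u) x = bool_fun A u x"
    unfolding bool_fun_def restrict_coords_point[OF assms(2)] .
qed

text \<open>A constant function attains one value only, so the hypothesis on \<open>w\<close> pins
  its entries outside \<open>nonconst_indices\<close> to exactly those that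
  \<open>fix_constants\<close> inserts.\<close>

lemma fix_constants_point:
  assumes v: "\<And>k. k \<in> K \<Longrightarrow> v k \<in> cube A \<rightarrow> {-1, 1}"
    and w: "\<And>k. k \<in> K \<Longrightarrow> k \<notin> nonconst_indices K A v \<Longrightarrow> \<exists>y. w k = bool_fun A (v k) y"
  shows "fix_constants K A v u (point (nonconst_indices K A v) w) = u (point K w)"
proof -
  have "the_elem (v k ` cube A) = sign_of (w k)" if k: "k \<in> K" "k \<notin> nonconst_indices K A v" for k
  proof -
    obtain c where c: "\<And>x. x \<in> cube A \<Longrightarrow> v k x = c"
      using k by (auto simp: nonconst_indices_def constant_on_def)
    obtain y where "w k = bool_fun A (v k) y" using w[OF k] by blast
    then have "sign_of (w k) = c" using bool_fun_value[OF v[OF k(1)], of y] c[of "point A y"] by simp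
    moreover have "v k ` cube A = {c}"
      using image_cong[of "cube A" "cube A" "v k" "\<lambda>_. c", OF refl c] image_constant[OF point_in_cube[of A y], of c] by simp
    ultimately show ?thesis by simp
  qed
  then show ?thesis
    unfolding fix_constants_def
    by (intro arg_cong[of _ _ u]) (auto simp: point_def fun_eq_iff)
qed

lemma fix_constants_bool:
  assumes v: "\<And>k. k \<in> K \<Longrightarrow> v k \<in> cube A \<rightarrow> {-1, 1}" and u: "u \<in> cube K \<rightarrow> {-1, 1}"
  shows "fix_constants K A v u \<in> cube (nonconst_indices K A v) \<rightarrow> {-1, 1}"
proof
  fix x assume x: "x \<in> cube (nonconst_indices K A v)"
  obtain x' where x': "x = point (nonconst_indices K A v) x'" using cubeE[OF x] .
  define w where "w k = (if k \<in> nonconst_indices K A v then x' k else bool_fun A (v k) (\<lambda>_. True))" for k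
  have "x = point (nonconst_indices K A v) w" unfolding x' by (rule point_cong) (simp add: w_def)
  moreover have "fix_constants K A v u (point (nonconst_indices K A v) w) = u (point K w)"
    by (rule fix_constants_point[OF v]) (auto simp: w_def)
  ultimately show "fix_constants K A v u x \<in> {-1, 1}" using funcset_mem[OF u point_in_cube] by simp
qed

lemma ball_cube_iff: "(\<forall>x\<in>cube A. P x) \<longleftrightarrow> (\<forall>x. P (point A x))"
proof
  assume P: "\<forall>x. P (point A x)"
  show "\<forall>x\<in>cube A. P x"
  proof
    fix x assume x: "x \<in> cube A"
    show "P x" by (subst cube_point[OF x]) (rule P[rule_format])
  qed
qed simp

lemma composition_identity_iff:
  assumes f: "\<And>j. j \<le> m \<Longrightarrow> f j \<in> cube {1..n} \<rightarrow> {-1, 1}"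
    and g: "\<And>i. i \<le> n \<Longrightarrow> g i \<in> cube {1..m} \<rightarrow> {-1, 1}"
  shows "composition_identity n m f g \<longleftrightarrow>
    (\<forall>z. bool_fun {1..n} (f 0) (\<lambda>i. bool_fun {1..m} (g i) (\<lambda>j. z (i, j))) =
         bool_fun {1..m} (g 0) (\<lambda>j. bool_fun {1..n} (f j) (\<lambda>i. z (i, j))))"
proof -
  let ?N = "{1..n}" and ?M = "{1..m}"
  have rows: "(\<lambda>i\<in>?N. g i (\<lambda>j\<in>?M. point (?N \<times> ?M) z (i, j))) =
      point ?N (\<lambda>i. bool_fun ?M (g i) (\<lambda>j. z (i, j)))" for z
  proof -
    have "(\<lambda>j\<in>?M. point (?N \<times> ?M) z (i, j)) = point ?M (\<lambda>j. z (i, j))" if "i \<in> ?N" for i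
      using that by (auto simp: point_def fun_eq_iff)
    then show ?thesis
      unfolding point_def[of ?N "\<lambda>i. bool_fun ?M (g i) (\<lambda>j. z (i, j))"]
      by (intro restrict_ext) (simp add: bool_fun_value[OF g] del: One_nat_def)
  qed
  have cols: "(\<lambda>j\<in>?M. f j (\<lambda>i\<in>?N. point (?N \<times> ?M) z (i, j))) =
      point ?M (\<lambda>j. bool_fun ?N (f j) (\<lambda>i. z (i, j)))" for z
  proof -
    have "(\<lambda>i\<in>?N. point (?N \<times> ?M) z (i, j)) = point ?N (\<lambda>i. z (i, j))" if "j \<in> ?M" for j
      using that by (auto simp: point_def fun_eq_iff)
    then show ?thesis
      unfolding point_def[of ?M "\<lambda>j. bool_fun ?N (f j) (\<lambda>i. z (i, j))"]
      by (intro restrict_ext) (simp add: bool_fun_value[OF f] del: One_nat_def)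
  qed
  have "composition_identity n m f g \<longleftrightarrow>
    (\<forall>z. f 0 (\<lambda>i\<in>?N. g i (\<lambda>j\<in>?M. point (?N \<times> ?M) z (i, j))) =
         g 0 (\<lambda>j\<in>?M. f j (\<lambda>i\<in>?N. point (?N \<times> ?M) z (i, j))))"
    unfolding composition_identity_def by (rule ball_cube_iff)
  then show ?thesis
    unfolding rows cols bool_fun_value[OF f[OF le0]] bool_fun_value[OF g[OF le0]] sign_of_simps .
qed

theorem theorem4p33:
  fixes n m :: nat and f g :: "nat \<Rightarrow> (nat \<Rightarrow> real) \<Rightarrow> real"
  assumes f_bool: "\<And>j. j \<le> m \<Longrightarrow> f j \<in> cube {1..n} \<rightarrow> {-1, 1}"
    and g_bool: "\<And>i. i \<le> n \<Longrightarrow> g i \<in> cube {1..m} \<rightarrow> {-1, 1}"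
    and identity: "composition_identity n m f g"
    and J: "J = nonconst_indices {1..m} {1..n} f"
    and G0: "G\<^sub>0 = fix_constants {1..m} {1..n} f (g 0)"
    and I: "I = nonconst_indices {1..n} {1..m} g"
    and F0: "F\<^sub>0 = fix_constants {1..n} {1..m} g (f 0)"
    and J': "J' = Dep J G\<^sub>0"
    and G0': "G\<^sub>0' = restrict_coords J J' G\<^sub>0"
    and I': "I' = Dep I F\<^sub>0"
    and F0': "F\<^sub>0' = restrict_coords I I' F\<^sub>0"
    and f': "f' = (\<lambda>j. restrict_coords {1..n} I' (f j))"
    and g': "g' = (\<lambda>i. restrict_coords {1..m} J' (g i))"
  shows "(\<forall>j\<in>J'. Dep {1..n} (f j) \<subseteq> I') \<and>
    (\<forall>i\<in>I'. Dep {1..m} (g i) \<subseteq> J') \<and>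
    (\<exists>Z\<^sub>0 (k::nat) Z h f0 g0.
       Z\<^sub>0 \<subseteq> I' \<times> J' \<and>
       Z\<^sub>0 = (\<Union>l\<in>{1..k}. Z l) \<and> (\<forall>l\<in>{1..k}. Z l \<noteq> {}) \<and> disjoint_family_on Z {1..k} \<and>
       disjoint_family_on (\<lambda>l. rows_of (Z l)) {1..k} \<and>
       disjoint_family_on (\<lambda>l. cols_of (Z l)) {1..k} \<and>
       (\<forall>l\<in>{1..k}. \<forall>(i, j)\<in>Z l.
          Dep J' (g' i) \<subseteq> cols_of (Z l) \<and> Dep I' (f' j) \<subseteq> rows_of (Z l)) \<and>
       (\<forall>l\<in>{1..k}. \<forall>i\<in>rows_of (Z l). \<forall>j\<in>cols_of (Z l).
          j \<in> Dep J' (g' i) \<longleftrightarrow> i \<in> Dep I' (f' j)) \<and>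
       h \<in> cube {1..k} \<rightarrow> {-1, 1} \<and>
       (\<forall>l\<in>{1..k}. f0 l \<in> cube (rows_of (Z l)) \<rightarrow> {-1, 1} \<and>
                   g0 l \<in> cube (cols_of (Z l)) \<rightarrow> {-1, 1}) \<and>
       (\<forall>x\<in>cube I'. F\<^sub>0' x = h (\<lambda>l\<in>{1..k}. f0 l (restrict x (rows_of (Z l))))) \<and>
       (\<forall>y\<in>cube J'. G\<^sub>0' y = h (\<lambda>l\<in>{1..k}. g0 l (restrict y (cols_of (Z l))))) \<and>
       (\<forall>l\<in>{1..k}.
          singleton_block I' J' f' g' (Z l) (f0 l) (g0 l) \<or>
          xor_block I' J' f' g' (Z l) (f0 l) (g0 l) \<or>
          and_block I' J' f' g' (Z l) (f0 l) (g0 l))) \<and>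
    (\<forall>fa ga.
       (\<forall>j\<in>{0..m} - (J - J'). fa j = f j) \<and>
       (\<forall>j\<in>J - J'. fa j \<in> cube {1..n} \<rightarrow> {-1, 1}) \<and>
       (\<forall>i\<in>{0..n} - (I - I'). ga i = g i) \<and>
       (\<forall>i\<in>I - I'. ga i \<in> cube {1..m} \<rightarrow> {-1, 1}) \<longrightarrow>
       composition_identity n m fa ga)"
proof -
  let ?N = "{1..n}" and ?M = "{1..m}"
  define fb where "fb j = bool_fun ?N (f j)" for j
  define gb where "gb i = bool_fun ?M (g i)" for i
  define F G where "F = bool_fun I F\<^sub>0" and "G = bool_fun J G\<^sub>0"
  have IN: "I \<subseteq> ?N" and JM: "J \<subseteq> ?M" unfolding I J nonconst_indices_def by auto
  have fin: "finite I" "finite J" using IN JM finite_subset by blast+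
  have fB: "f j \<in> cube ?N \<rightarrow> {-1, 1}" if "j \<in> ?M" for j using f_bool that by simp
  have gB: "g i \<in> cube ?M \<rightarrow> {-1, 1}" if "i \<in> ?N" for i using g_bool that by simp
  have F0_bool: "F\<^sub>0 \<in> cube I \<rightarrow> {-1, 1}"
    unfolding F0 I by (rule fix_constants_bool[OF gB f_bool]) auto
  have G0_bool: "G\<^sub>0 \<in> cube J \<rightarrow> {-1, 1}"
    unfolding G0 J by (rule fix_constants_bool[OF fB g_bool]) auto
  \<comment> \<open>\<open>F\<close> agrees with \<open>f 0\<close> wherever the inputs outside
    \<open>I\<close> are attained by their constant functions; the inputs in \<open>I\<close> may be
    anything. This freedom is used again for the replaced functions in
    \<open>arbitrary\<close>.\<close>
  have F: "F w = bool_fun ?N (f 0) w" if "\<And>i. i \<in> ?N \<Longrightarrow> i \<notin> I \<Longrightarrow> \<exists>y. w i = gb i y" for w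
  proof -
    have "fix_constants ?N ?M g (f 0) (point I w) = f 0 (point ?N w)"
      unfolding I by (rule fix_constants_point[OF gB]) (use that[unfolded gb_def I] in auto)
    then show ?thesis unfolding F_def bool_fun_def F0 by simp
  qed
  have G: "G w = bool_fun ?M (g 0) w" if "\<And>j. j \<in> ?M \<Longrightarrow> j \<notin> J \<Longrightarrow> \<exists>x. w j = fb j x" for w
  proof -
    have "fix_constants ?M ?N f (g 0) (point J w) = g 0 (point ?M w)"
      unfolding J by (rule fix_constants_point[OF fB]) (use that[unfolded fb_def J] in auto)
    then show ?thesis unfolding G_def bool_fun_def G0 by simp
  qed
  have ident: "bool_fun ?N (f 0) (\<lambda>i. gb i (\<lambda>j. z (i, j))) = bool_fun ?M (g 0) (\<lambda>j. fb j (\<lambda>i. z (i, j)))" for z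
    using composition_identity_iff[of m f n g, OF f_bool g_bool] identity unfolding fb_def gb_def by blast
  have I'_eq: "I' = bdep F" unfolding I' F_def by (rule Dep_eq_bdep[OF F0_bool])
  have J'_eq: "J' = bdep G" unfolding J' G_def by (rule Dep_eq_bdep[OF G0_bool])
  have I'I: "I' \<subseteq> I" unfolding I'_eq F_def by (rule bdep_bool_fun_subset)
  have J'J: "J' \<subseteq> J" unfolding J'_eq G_def by (rule bdep_bool_fun_subset)
  have FG: "F (\<lambda>i. gb i (\<lambda>j. z (i, j))) = G (\<lambda>j. fb j (\<lambda>i. z (i, j)))" for z
  proof -
    have "F (\<lambda>i. gb i (\<lambda>j. z (i, j))) = bool_fun ?N (f 0) (\<lambda>i. gb i (\<lambda>j. z (i, j)))"
      by (rule F) blast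
    moreover have "G (\<lambda>j. fb j (\<lambda>i. z (i, j))) = bool_fun ?M (g 0) (\<lambda>j. fb j (\<lambda>i. z (i, j)))"
      by (rule G) blast
    ultimately show ?thesis using ident by simp
  qed
  have sys: "bool_system F G fb gb"
  proof
    show "fsupp F" "fsupp G" "fsupp (fb j)" "fsupp (gb i)" for i j
      unfolding F_def G_def fb_def gb_def by (intro fsupp_bool_fun fin finite_atLeastAtMost)+
    show "bdep (fb j) \<noteq> {}" if "j \<in> bdep G" for j
    proof -
      have j: "j \<in> J" using that J'J J'_eq by blast
      then show ?thesis unfolding fb_def
        using constant_iff_bdep_empty[OF _ fB, of j] by (auto simp: J nonconst_indices_def)
    qed
    show "bdep (gb i) \<noteq> {}" if "i \<in> bdep F" for i
    proof -
      have i: "i \<in> I" using that I'I I'_eq by blast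
      then show ?thesis unfolding gb_def
        using constant_iff_bdep_empty[OF _ gB, of i] by (auto simp: I nonconst_indices_def)
    qed
  qed (rule FG)
  interpret bool_system F G fb gb by (rule sys)
  have f_dep: "bdep (fb j) \<subseteq> I'" if "j \<in> J'" for j
    using bool_system.dep_transfer[OF sys[THEN bool_system.swapped], of j] that unfolding I'_eq J'_eq by blast
  have g_dep: "bdep (gb i) \<subseteq> J'" if "i \<in> I'" for i
    using dep_transfer[of i] that unfolding I'_eq J'_eq by blast
  have I'N: "I' \<subseteq> ?N" and J'M: "J' \<subseteq> ?M" using I'I IN J'J JM by auto
  have Dep_f: "Dep ?N (f j) = bdep (fb j)" if "j \<in> J'" for j
    unfolding fb_def using that J'M by (intro Dep_eq_bdep fB) auto
  have Dep_g: "Dep ?M (g i) = bdep (gb i)" if "i \<in> I'" for i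
    unfolding gb_def using that I'N by (intro Dep_eq_bdep gB) auto
  have F': "bool_fun I' F\<^sub>0' = F"
    unfolding F0' F_def by (rule bool_fun_restrict_coords[OF fin(1) I'I]) (simp add: I'_eq F_def)
  have G': "bool_fun J' G\<^sub>0' = G"
    unfolding G0' G_def by (rule bool_fun_restrict_coords[OF fin(2) J'J]) (simp add: J'_eq G_def)
  have fb': "bool_fun I' (f' j) = fb j" if "j \<in> J'" for j
    unfolding f' fb_def using f_dep[OF that] unfolding fb_def
    by (intro bool_fun_restrict_coords[OF _ I'N]) auto
  have gb': "bool_fun J' (g' i) = gb i" if "i \<in> I'" for i
    unfolding g' gb_def using g_dep[OF that] unfolding gb_def
    by (intro bool_fun_restrict_coords[OF _ J'M]) auto
  have rsys: "real_system I' J' F\<^sub>0' G\<^sub>0' f' g'"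
  proof
    show "finite I'" "finite J'" using I'I J'J fin finite_subset by blast+
    show "F\<^sub>0' \<in> cube I' \<rightarrow> {-1, 1}" unfolding F0' by (rule restrict_coords_bool[OF I'I F0_bool])
    show "G\<^sub>0' \<in> cube J' \<rightarrow> {-1, 1}" unfolding G0' by (rule restrict_coords_bool[OF J'J G0_bool])
    show "f' j \<in> cube I' \<rightarrow> {-1, 1}" if "j \<in> J'" for j
      unfolding f' using that J'M by (intro restrict_coords_bool[OF I'N] fB) auto
    show "g' i \<in> cube J' \<rightarrow> {-1, 1}" if "i \<in> I'" for i
      unfolding g' using that I'N by (intro restrict_coords_bool[OF J'M] gB) auto
    show "bdep (bool_fun I' F\<^sub>0') = I'" "bdep (bool_fun J' G\<^sub>0') = J'" unfolding F' G' by (fact I'_eq[symmetric] J'_eq[symmetric])+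
    show "fsupp (bool_fun I' F\<^sub>0')" "fsupp (bool_fun J' G\<^sub>0')" unfolding F' G' by (fact fsupp_F fsupp_G)+
    show "fsupp (bool_fun I' (f' j))" "fsupp (bool_fun J' (g' i))" for i j
      using I'I J'J fin by (meson finite_subset fsupp_bool_fun)+
    show "bdep (bool_fun I' (f' j)) \<noteq> {}" if "j \<in> bdep (bool_fun J' G\<^sub>0')" for j
      using that fb' f_nonconst[of j] unfolding G' J'_eq[symmetric] by simp
    show "bdep (bool_fun J' (g' i)) \<noteq> {}" if "i \<in> bdep (bool_fun I' F\<^sub>0')" for i
      using that gb' g_nonconst[of i] unfolding F' I'_eq[symmetric] by simp
    fix z
    \<comment> \<open>\<open>g'\<close> matches the original functions only at indices in
      \<open>I'\<close>. These are the only ones \<open>F\<close> reads, so the identity survives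
      the restriction; \<open>G\<close> is treated likewise.\<close>
    have "F (\<lambda>i. bool_fun J' (g' i) (\<lambda>j. z (i, j))) = F (\<lambda>i. gb i (\<lambda>j. z (i, j)))"
      by (rule eq_if_agree_on_bdep[OF fsupp_F]) (simp add: gb' I'_eq[symmetric])
    moreover have "G (\<lambda>j. bool_fun I' (f' j) (\<lambda>i. z (i, j))) = G (\<lambda>j. fb j (\<lambda>i. z (i, j)))"
      by (rule eq_if_agree_on_bdep[OF fsupp_G]) (simp add: fb' J'_eq[symmetric])
    ultimately show "bool_fun I' F\<^sub>0' (\<lambda>i. bool_fun J' (g' i) (\<lambda>j. z (i, j))) =
        bool_fun J' G\<^sub>0' (\<lambda>j. bool_fun I' (f' j) (\<lambda>i. z (i, j)))"
      unfolding F' G' using FG by simp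
  qed
  have arbitrary: "composition_identity n m fa ga"
    if fa: "\<forall>j\<in>{0..m} - (J - J'). fa j = f j" "\<forall>j\<in>J - J'. fa j \<in> cube {1..n} \<rightarrow> {-1, 1}"
      and ga: "\<forall>i\<in>{0..n} - (I - I'). ga i = g i" "\<forall>i\<in>I - I'. ga i \<in> cube {1..m} \<rightarrow> {-1, 1}" for fa ga
  proof -
    have fa_bool: "fa j \<in> cube ?N \<rightarrow> {-1, 1}" if "j \<le> m" for j
      using that fa f_bool[OF that] by (cases "j \<in> J - J'") auto
    have ga_bool: "ga i \<in> cube ?M \<rightarrow> {-1, 1}" if "i \<le> n" for i
      using that ga g_bool[OF that] by (cases "i \<in> I - I'") auto
    have fa_eq: "fa j = f j" if "j \<in> ?M" "j \<notin> J - J'" for j using that fa(1) by simp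
    have ga_eq: "ga i = g i" if "i \<in> ?N" "i \<notin> I - I'" for i using that ga(1) by simp
    \<comment> \<open>Index 0 holds the outer functions; as it lies in neither index set, they are
      not among the functions replaced.\<close>
    have "0 \<notin> I" "0 \<notin> J" using IN JM by auto
    then have 0: "fa 0 = f 0" "ga 0 = g 0" using fa(1) ga(1) by simp_all
    have "bool_fun ?N (fa 0) (\<lambda>i. bool_fun ?M (ga i) (\<lambda>j. z (i, j))) =
        bool_fun ?M (ga 0) (\<lambda>j. bool_fun ?N (fa j) (\<lambda>i. z (i, j)))" for z
      unfolding 0
    proof -
      \<comment> \<open>Replaced functions sit at indices in \<open>I - I'\<close>. Indices outside
        \<open>I\<close> keep their constants, so \<open>f 0\<close> can be exchanged for
        \<open>F\<close>, and \<open>F\<close> does not react to the replaced inputs. The way back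
        through \<open>G\<close> is the same.\<close>
      have "bool_fun ?N (f 0) (\<lambda>i. bool_fun ?M (ga i) (\<lambda>j. z (i, j))) = F (\<lambda>i. bool_fun ?M (ga i) (\<lambda>j. z (i, j)))"
        by (rule F[symmetric]) (use ga_eq in \<open>auto simp: gb_def\<close>)
      also have "\<dots> = F (\<lambda>i. gb i (\<lambda>j. z (i, j)))"
        by (rule eq_if_agree_on_bdep[OF fsupp_F]) (use ga_eq I'N in \<open>auto simp: gb_def I'_eq[symmetric]\<close>)
      also have "\<dots> = G (\<lambda>j. fb j (\<lambda>i. z (i, j)))" by (rule FG)
      also have "\<dots> = G (\<lambda>j. bool_fun ?N (fa j) (\<lambda>i. z (i, j)))"
        by (rule eq_if_agree_on_bdep[OF fsupp_G]) (use fa_eq J'M in \<open>auto simp: fb_def J'_eq[symmetric]\<close>)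
      also have "\<dots> = bool_fun ?M (g 0) (\<lambda>j. bool_fun ?N (fa j) (\<lambda>i. z (i, j)))"
        by (rule G) (use fa_eq in \<open>auto simp: fb_def\<close>)
      finally show "bool_fun ?N (f 0) (\<lambda>i. bool_fun ?M (ga i) (\<lambda>j. z (i, j))) =
        bool_fun ?M (g 0) (\<lambda>j. bool_fun ?N (fa j) (\<lambda>i. z (i, j)))" .
    qed
    then show ?thesis using composition_identity_iff[of m fa n ga] fa_bool ga_bool by blast
  qed
  show ?thesis
  proof (intro conjI)
    show "\<forall>j\<in>J'. Dep {1..n} (f j) \<subseteq> I'" using Dep_f f_dep by blast
    show "\<forall>i\<in>I'. Dep {1..m} (g i) \<subseteq> J'" using Dep_g g_dep by blast
  qed (rule real_system.block_decomposition[OF rsys], intro allI impI, elim conjE, rule arbitrary)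
qed

end
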